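(* Let $\omega$ be a weight on $\mathbb{N}$, and let $\ell^1(\omega)=\ell^1(\mathbb{N},\omega)$ be the dual Banach algebra with pointwise multiplication and predual $c_0(\omega^{-1})$. Then: (i) $\ell^1(\omega)$ is not Connes amenable; (ii) $\ell^1(\omega)$ is not pointwise Connes amenable; (iii) $\ell^1(\omega)$ is not $w^*$-approximately Connes amenable; (iv) $\ell^1(\omega)$ is pointwise $w^*$-approximately Connes amenable.
   Context: A weight on a discrete semigroup $S$ is a function $\omega:S\to[1,\infty)$ with $\omega(gh)\le\omega(g)\omega(h)$ for all $g,h\in S$; a weight on $\mathbb{N}$ is a weight on the additive semigroup $\mathbb{N}$, i.e. $\omega(m+n)\le\omega(m)\omega(n)$. $\ell^1(\omega)=\ell^1(\mathbb{N},\omega)$ is the Banach space of all complex sequences $(a_n)_{n\in\mathbb{N}}$ with $\|(a_n)\|=\sum_n|a_n|\omega(n)<\infty$. It is a dual Banach algebra under pointwise multiplication, with predual $c_0(\omega^{-1})$, the Banach space of complex sequences $(b_n)$ with $b_n/\omega(n)\to0$, normed by $\sup_n|b_n|/\omega(n)$, and duality $\langle b,a\rangle=\sum_n a_nb_n$. Let $\mathcal{A}$ be a Banach algebra. A Banach $\mathcal{A}$-bimodule $E$ is dual if there is a closed submodule $E_*$ of $E^*$ (the predual) such that $E=(E_* )^*$. A Banach algebra is a dual Banach algebra if it is dual as a Banach bimodule over itself. For a dual Banach algebra $\mathcal{A}$, a dual Banach $\mathcal{A}$-bimodule $E$ is normal if the module actions of $\mathcal{A}$ on $E$ are $w^*$-continuous,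 i.e. for each $x\in E$ the maps $a\mapsto a\cdot x$ and $a\mapsto x\cdot a$ from $\mathcal{A}$ to $E$ are $w^*$-$w^*$-continuous. A derivation is a bounded linear map $D:\mathcal{A}\to E$ with $D(ab)=D(a)\cdot b+a\cdot D(b)$; it is $w^*$-continuous if it is $w^*$-$w^*$-continuous. A dual Banach algebra $\mathcal{A}$ is: - Connes amenable if for every normal, dual Banach $\mathcal{A}$-bimodule $E$ and every $w^*$-continuous derivation $D:\mathcal{A}\to E$ there is $x\in E$ with $D(a)=a\cdot x-x\cdot a$ for all $a\in\mathcal{A}$; - pointwise Connes amenable if for each $a_0\in\mathcal{A}$ and all such $E$, $D$ there is $x\in E$ with $D(a_0)=a_0\cdot x-x\cdot a_0$; - $w^*$-approximately Connes amenable if for all such $E$, $D$ there is a net $(x_n)\subseteq E$ with $D(a)=w^*\text{-}\lim_n(a\cdot x_n-x_n\cdot a)$ for all $a\in\mathcal{A}$; - pointwise $w^*$-approximately Connes amenable if for each $a_0\in\mathcal{A}$ and all such $E$, $D$ there is a net $(x_n)\subseteq E$ with $D(a_0)=w^*\text{-}\lim_n(a_0\cdot x_n-x_n\cdot a_0)$. *)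

theory Defs
  imports "HOL-Analysis.Analysis" "HOL-Algebra.Module"
begin

section \<open>Complex normed spaces on carrier sets\<close>

text \<open>The library has no class of complex normed spaces, and the statement quantifies over
  Banach spaces and forms duals of them, so spaces are records with explicit carriers.
  The fields \<open>mult\<close> and \<open>one\<close>, inherited from the library's record of modules, carry no
  information for a mere space; \<open>mult\<close> is the product when the record stands for a Banach algebra,
  and \<open>one\<close> is never used (Banach algebras need not be unital).\<close>

definition complex_field :: "complex ring" where
  "complex_field = \<lparr>carrier = UNIV, mult = (*), one = 1, zero = 0, add = (+)\<rparr>"

record 'e nspace = "(complex, 'e) module" +
  nrm :: "'e \<Rightarrow> real"

text \<open>The library's metric spaces need a symmetric, nonnegative distance also off the carrier,
  hence the value 0 there.\<close>

definition ndist :: "('e, 'm) nspace_scheme \<Rightarrow> 'e \<Rightarrow> 'e \<Rightarrow> real" where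
  "ndist E x y = (if x \<in> carrier E \<and> y \<in> carrier E then nrm E (x \<ominus>\<^bsub>E\<^esub> y) else 0)"

definition ntopology :: "('e, 'm) nspace_scheme \<Rightarrow> 'e topology" where
  "ntopology E = Metric_space.mtopology (carrier E) (ndist E)"

locale normed_space = Module.module complex_field E
  for E :: "('e, 'm) nspace_scheme" +
  assumes nrm_nonneg: "x \<in> carrier E \<Longrightarrow> 0 \<le> nrm E x"
    and nrm_eq_0: "x \<in> carrier E \<Longrightarrow> nrm E x = 0 \<longleftrightarrow> x = \<zero>\<^bsub>E\<^esub>"
    and nrm_triangle: "x \<in> carrier E \<Longrightarrow> y \<in> carrier E \<Longrightarrow> nrm E (x \<oplus>\<^bsub>E\<^esub> y) \<le> nrm E x + nrm E y"
    and nrm_smult: "x \<in> carrier E \<Longrightarrow> nrm E (c \<odot>\<^bsub>E\<^esub> x) = cmod c * nrm E x"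

locale banach_space = normed_space +
  assumes complete: "Metric_space.mcomplete (carrier E) (ndist E)"

definition bounded_linear_on :: "('e, 'm) nspace_scheme \<Rightarrow> ('f, 'n) nspace_scheme \<Rightarrow> ('e \<Rightarrow> 'f) \<Rightarrow> bool" where
  "bounded_linear_on E F T \<longleftrightarrow>
     T \<in> carrier E \<rightarrow> carrier F \<and>
     (\<forall>x\<in>carrier E. \<forall>y\<in>carrier E. T (x \<oplus>\<^bsub>E\<^esub> y) = T x \<oplus>\<^bsub>F\<^esub> T y) \<and>
     (\<forall>c. \<forall>x\<in>carrier E. T (c \<odot>\<^bsub>E\<^esub> x) = c \<odot>\<^bsub>F\<^esub> T x) \<and>
     (\<exists>C. \<forall>x\<in>carrier E. nrm F (T x) \<le> C * nrm E x)"

definition complex_nspace :: "complex nspace" where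
  "complex_nspace = \<lparr>carrier = UNIV, mult = (*), one = 1, zero = 0, add = (+), smult = (*), nrm = cmod\<rparr>"

text \<open>The Banach dual \<open>E\<^sup>*\<close>. Functionals are made extensional, so that they are determined by
  their values on \<open>carrier E\<close>.\<close>

definition dual :: "('e, 'm) nspace_scheme \<Rightarrow> ('e \<Rightarrow> complex) nspace" where
  "dual E =
    \<lparr>carrier = {f \<in> extensional (carrier E). bounded_linear_on E complex_nspace f},
     mult = undefined, one = undefined,
     zero = (\<lambda>x\<in>carrier E. 0),
     add = (\<lambda>f g. \<lambda>x\<in>carrier E. f x + g x),
     smult = (\<lambda>c f. \<lambda>x\<in>carrier E. c * f x),
     nrm = (\<lambda>f. SUP x\<in>{x \<in> carrier E. nrm E x \<le> 1}. cmod (f x))\<rparr>"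

section \<open>Banach algebras and Banach bimodules\<close>

locale banach_algebra = banach_space A for A :: "('a, 'm) nspace_scheme" +
  assumes mult_closed: "a \<in> carrier A \<Longrightarrow> b \<in> carrier A \<Longrightarrow> a \<otimes>\<^bsub>A\<^esub> b \<in> carrier A"
    and mult_assoc: "a \<in> carrier A \<Longrightarrow> b \<in> carrier A \<Longrightarrow> c \<in> carrier A \<Longrightarrow>
      (a \<otimes>\<^bsub>A\<^esub> b) \<otimes>\<^bsub>A\<^esub> c = a \<otimes>\<^bsub>A\<^esub> (b \<otimes>\<^bsub>A\<^esub> c)"
    and mult_add_left: "a \<in> carrier A \<Longrightarrow> b \<in> carrier A \<Longrightarrow> c \<in> carrier A \<Longrightarrow>
      (a \<oplus>\<^bsub>A\<^esub> b) \<otimes>\<^bsub>A\<^esub> c = a \<otimes>\<^bsub>A\<^esub> c \<oplus>\<^bsub>A\<^esub> b \<otimes>\<^bsub>A\<^esub> c"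
    and mult_add_right: "a \<in> carrier A \<Longrightarrow> b \<in> carrier A \<Longrightarrow> c \<in> carrier A \<Longrightarrow>
      a \<otimes>\<^bsub>A\<^esub> (b \<oplus>\<^bsub>A\<^esub> c) = a \<otimes>\<^bsub>A\<^esub> b \<oplus>\<^bsub>A\<^esub> a \<otimes>\<^bsub>A\<^esub> c"
    and mult_smult_left: "a \<in> carrier A \<Longrightarrow> b \<in> carrier A \<Longrightarrow>
      (\<gamma> \<odot>\<^bsub>A\<^esub> a) \<otimes>\<^bsub>A\<^esub> b = \<gamma> \<odot>\<^bsub>A\<^esub> (a \<otimes>\<^bsub>A\<^esub> b)"
    and mult_smult_right: "a \<in> carrier A \<Longrightarrow> b \<in> carrier A \<Longrightarrow>
      a \<otimes>\<^bsub>A\<^esub> (\<gamma> \<odot>\<^bsub>A\<^esub> b) = \<gamma> \<odot>\<^bsub>A\<^esub> (a \<otimes>\<^bsub>A\<^esub> b)"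
    and nrm_mult: "a \<in> carrier A \<Longrightarrow> b \<in> carrier A \<Longrightarrow> nrm A (a \<otimes>\<^bsub>A\<^esub> b) \<le> nrm A a * nrm A b"

record ('a, 'e) bimodule = "'e nspace" +
  lact :: "'a \<Rightarrow> 'e \<Rightarrow> 'e"
  ract :: "'e \<Rightarrow> 'a \<Rightarrow> 'e"

locale banach_bimodule = A: banach_algebra A + E: banach_space E
  for A :: "('a, 'm) nspace_scheme" and E :: "('a, 'e) bimodule" +
  assumes lact_closed: "a \<in> carrier A \<Longrightarrow> x \<in> carrier E \<Longrightarrow> lact E a x \<in> carrier E"
    and ract_closed: "a \<in> carrier A \<Longrightarrow> x \<in> carrier E \<Longrightarrow> ract E x a \<in> carrier E"
    and lact_add: "a \<in> carrier A \<Longrightarrow> x \<in> carrier E \<Longrightarrow> y \<in> carrier E \<Longrightarrow>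
      lact E a (x \<oplus>\<^bsub>E\<^esub> y) = lact E a x \<oplus>\<^bsub>E\<^esub> lact E a y"
    and ract_add: "a \<in> carrier A \<Longrightarrow> x \<in> carrier E \<Longrightarrow> y \<in> carrier E \<Longrightarrow>
      ract E (x \<oplus>\<^bsub>E\<^esub> y) a = ract E x a \<oplus>\<^bsub>E\<^esub> ract E y a"
    and add_lact: "a \<in> carrier A \<Longrightarrow> b \<in> carrier A \<Longrightarrow> x \<in> carrier E \<Longrightarrow>
      lact E (a \<oplus>\<^bsub>A\<^esub> b) x = lact E a x \<oplus>\<^bsub>E\<^esub> lact E b x"
    and add_ract: "a \<in> carrier A \<Longrightarrow> b \<in> carrier A \<Longrightarrow> x \<in> carrier E \<Longrightarrow>
      ract E x (a \<oplus>\<^bsub>A\<^esub> b) = ract E x a \<oplus>\<^bsub>E\<^esub> ract E x b"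
    and lact_smult: "a \<in> carrier A \<Longrightarrow> x \<in> carrier E \<Longrightarrow>
      lact E a (\<gamma> \<odot>\<^bsub>E\<^esub> x) = \<gamma> \<odot>\<^bsub>E\<^esub> lact E a x"
    and ract_smult: "a \<in> carrier A \<Longrightarrow> x \<in> carrier E \<Longrightarrow>
      ract E (\<gamma> \<odot>\<^bsub>E\<^esub> x) a = \<gamma> \<odot>\<^bsub>E\<^esub> ract E x a"
    and smult_lact: "a \<in> carrier A \<Longrightarrow> x \<in> carrier E \<Longrightarrow>
      lact E (\<gamma> \<odot>\<^bsub>A\<^esub> a) x = \<gamma> \<odot>\<^bsub>E\<^esub> lact E a x"
    and smult_ract: "a \<in> carrier A \<Longrightarrow> x \<in> carrier E \<Longrightarrow>
      ract E x (\<gamma> \<odot>\<^bsub>A\<^esub> a) = \<gamma> \<odot>\<^bsub>E\<^esub> ract E x a"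
    and lact_mult: "a \<in> carrier A \<Longrightarrow> b \<in> carrier A \<Longrightarrow> x \<in> carrier E \<Longrightarrow>
      lact E (a \<otimes>\<^bsub>A\<^esub> b) x = lact E a (lact E b x)"
    and ract_mult: "a \<in> carrier A \<Longrightarrow> b \<in> carrier A \<Longrightarrow> x \<in> carrier E \<Longrightarrow>
      ract E x (a \<otimes>\<^bsub>A\<^esub> b) = ract E (ract E x a) b"
    and lact_ract: "a \<in> carrier A \<Longrightarrow> b \<in> carrier A \<Longrightarrow> x \<in> carrier E \<Longrightarrow>
      lact E a (ract E x b) = ract E (lact E a x) b"
    and act_bounded: "\<exists>C. \<forall>a\<in>carrier A. \<forall>x\<in>carrier E.
      nrm E (lact E a x) \<le> C * nrm A a * nrm E x \<and> nrm E (ract E x a) \<le> C * nrm A a * nrm E x"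

section \<open>Preduals and weak* topologies\<close>

text \<open>A predual is a set \<open>P\<close> of functionals on \<open>E\<close>, with the norm inherited from \<open>E\<^sup>*\<close>.
  The last two conditions say \<open>E = P\<^sup>*\<close>: the canonical map \<open>E \<rightarrow> P\<^sup>*\<close> is an isometric bijection.\<close>

definition predual_of :: "('e, 'm) nspace_scheme \<Rightarrow> ('e \<Rightarrow> complex) set \<Rightarrow> bool" where
  "predual_of E P \<longleftrightarrow>
     submodule P complex_field (dual E) \<and> closedin (ntopology (dual E)) P \<and>
     bij_betw (\<lambda>x. \<lambda>f\<in>P. f x) (carrier E) (carrier (dual ((dual E)\<lparr>carrier := P\<rparr>))) \<and>
     (\<forall>x\<in>carrier E. nrm (dual ((dual E)\<lparr>carrier := P\<rparr>)) (\<lambda>f\<in>P. f x) = nrm E x)"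

text \<open>The module actions on \<open>E\<^sup>*\<close> are \<open>(a \<cdot> f)(x) = f(x \<cdot> a)\<close> and \<open>(f \<cdot> a)(x) = f(a \<cdot> x)\<close>.\<close>

definition dual_banach_bimodule ::
  "('a, 'm) nspace_scheme \<Rightarrow> ('a, 'e) bimodule \<Rightarrow> ('e \<Rightarrow> complex) set \<Rightarrow> bool" where
  "dual_banach_bimodule A E P \<longleftrightarrow>
     banach_bimodule A E \<and> predual_of E P \<and>
     (\<forall>a\<in>carrier A. \<forall>f\<in>P.
        (\<lambda>x\<in>carrier E. f (ract E x a)) \<in> P \<and> (\<lambda>x\<in>carrier E. f (lact E a x)) \<in> P)"

definition regular_bimodule :: "'a nspace \<Rightarrow> ('a, 'a) bimodule" where
  "regular_bimodule A = nspace.extend A \<lparr>lact = mult A, ract = mult A\<rparr>"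

definition dual_banach_algebra :: "'a nspace \<Rightarrow> ('a \<Rightarrow> complex) set \<Rightarrow> bool" where
  "dual_banach_algebra A P \<longleftrightarrow> banach_algebra A \<and> dual_banach_bimodule A (regular_bimodule A) P"

definition wstar_topology :: "('e, 'm) nspace_scheme \<Rightarrow> ('e \<Rightarrow> complex) set \<Rightarrow> 'e topology" where
  "wstar_topology E P = topology_generated_by {{x \<in> carrier E. f x \<in> U} | f U. f \<in> P \<and> open U}"

definition normal_dual_bimodule ::
  "'a nspace \<Rightarrow> ('a \<Rightarrow> complex) set \<Rightarrow> ('a, 'e) bimodule \<Rightarrow> ('e \<Rightarrow> complex) set \<Rightarrow> bool" where
  "normal_dual_bimodule A PA E P \<longleftrightarrow>
     dual_banach_bimodule A E P \<and>
     (\<forall>x\<in>carrier E.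
        continuous_map (wstar_topology A PA) (wstar_topology E P) (\<lambda>a. lact E a x) \<and>
        continuous_map (wstar_topology A PA) (wstar_topology E P) (\<lambda>a. ract E x a))"

definition derivation :: "'a nspace \<Rightarrow> ('a, 'e) bimodule \<Rightarrow> ('a \<Rightarrow> 'e) \<Rightarrow> bool" where
  "derivation A E D \<longleftrightarrow>
     bounded_linear_on A E D \<and>
     (\<forall>a\<in>carrier A. \<forall>b\<in>carrier A. D (a \<otimes>\<^bsub>A\<^esub> b) = ract E (D a) b \<oplus>\<^bsub>E\<^esub> lact E a (D b))"

definition wstar_derivation ::
  "'a nspace \<Rightarrow> ('a \<Rightarrow> complex) set \<Rightarrow> ('a, 'e) bimodule \<Rightarrow> ('e \<Rightarrow> complex) set \<Rightarrow> ('a \<Rightarrow> 'e) \<Rightarrow> bool" where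
  "wstar_derivation A PA E P D \<longleftrightarrow>
     derivation A E D \<and> continuous_map (wstar_topology A PA) (wstar_topology E P) D"

abbreviation inner_der :: "('a, 'e) bimodule \<Rightarrow> 'e \<Rightarrow> 'a \<Rightarrow> 'e" where
  "inner_der E x a \<equiv> lact E a x \<ominus>\<^bsub>E\<^esub> ract E x a"

section \<open>Notions of Connes amenability\<close>

text \<open>In the following, \<open>A\<close> is a dual Banach algebra with predual \<open>PA\<close>. A formula of HOL cannot
  quantify over types, so the type argument gives the type from which the elements of the
  bimodules \<open>E\<close> are drawn; \<open>E\<close> ranges over all bimodules whose carrier is a subset of that type.
  The unrestricted notions correspond to all instances of the type argument together. In
  particular, failure for one type is failure of the unrestricted notion.

  A net in \<open>E\<close> is given by the filter generated by its tails, i.e. by a proper filter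
  containing \<open>carrier E\<close>; conversely, every such filter comes from a net.\<close>

definition Connes_amenable :: "'e itself \<Rightarrow> 'a nspace \<Rightarrow> ('a \<Rightarrow> complex) set \<Rightarrow> bool" where
  "Connes_amenable _ A PA \<longleftrightarrow>
     (\<forall>(E :: ('a, 'e) bimodule) P D.
        normal_dual_bimodule A PA E P \<and> wstar_derivation A PA E P D \<longrightarrow>
        (\<exists>x\<in>carrier E. \<forall>a\<in>carrier A. D a = inner_der E x a))"

definition pointwise_Connes_amenable :: "'e itself \<Rightarrow> 'a nspace \<Rightarrow> ('a \<Rightarrow> complex) set \<Rightarrow> bool" where
  "pointwise_Connes_amenable _ A PA \<longleftrightarrow>
     (\<forall>a\<in>carrier A. \<forall>(E :: ('a, 'e) bimodule) P D.
        normal_dual_bimodule A PA E P \<and> wstar_derivation A PA E P D \<longrightarrow>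
        (\<exists>x\<in>carrier E. D a = inner_der E x a))"

definition wstar_approx_Connes_amenable :: "'e itself \<Rightarrow> 'a nspace \<Rightarrow> ('a \<Rightarrow> complex) set \<Rightarrow> bool" where
  "wstar_approx_Connes_amenable _ A PA \<longleftrightarrow>
     (\<forall>(E :: ('a, 'e) bimodule) P D.
        normal_dual_bimodule A PA E P \<and> wstar_derivation A PA E P D \<longrightarrow>
        (\<exists>F. F \<noteq> bot \<and> (\<forall>\<^sub>F x in F. x \<in> carrier E) \<and>
           (\<forall>a\<in>carrier A. limitin (wstar_topology E P) (\<lambda>x. inner_der E x a) (D a) F)))"

definition pointwise_wstar_approx_Connes_amenable ::
  "'e itself \<Rightarrow> 'a nspace \<Rightarrow> ('a \<Rightarrow> complex) set \<Rightarrow> bool" where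
  "pointwise_wstar_approx_Connes_amenable _ A PA \<longleftrightarrow>
     (\<forall>a\<in>carrier A. \<forall>(E :: ('a, 'e) bimodule) P D.
        normal_dual_bimodule A PA E P \<and> wstar_derivation A PA E P D \<longrightarrow>
        (\<exists>F. F \<noteq> bot \<and> (\<forall>\<^sub>F x in F. x \<in> carrier E) \<and>
           limitin (wstar_topology E P) (\<lambda>x. inner_der E x a) (D a) F))"

section \<open>Weighted sequence algebras\<close>

definition weight :: "('s::semigroup_add \<Rightarrow> real) \<Rightarrow> bool" where
  "weight \<omega> \<longleftrightarrow> (\<forall>g. 1 \<le> \<omega> g) \<and> (\<forall>g h. \<omega> (g + h) \<le> \<omega> g * \<omega> h)"

text \<open>Addition, scalar multiplication and product are pointwise.\<close>

definition ell1 :: "(nat \<Rightarrow> real) \<Rightarrow> (nat \<Rightarrow> complex) nspace" where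
  "ell1 \<omega> =
    \<lparr>carrier = {a. summable (\<lambda>n. cmod (a n) * \<omega> n)},
     mult = (\<lambda>a b n. a n * b n), one = undefined,
     zero = (\<lambda>n. 0), add = (\<lambda>a b n. a n + b n),
     smult = (\<lambda>c a n. c * a n),
     nrm = (\<lambda>a. \<Sum>n. cmod (a n) * \<omega> n)\<rparr>"

text \<open>\<open>c\<^sub>0(\<omega>\<^sup>-\<^sup>1)\<close>, as a set of sequences and as the set of functionals on \<open>\<ell>\<^sup>1(\<omega>)\<close> it induces. The
  norm \<open>sup\<^sub>n |b\<^sub>n| / \<omega>(n)\<close> is the one inherited from the dual of \<open>\<ell>\<^sup>1(\<omega>)\<close>.\<close>

definition c0_inv :: "(nat \<Rightarrow> real) \<Rightarrow> (nat \<Rightarrow> complex) set" where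
  "c0_inv \<omega> = {b. (\<lambda>n. b n / complex_of_real (\<omega> n)) \<longlonglongrightarrow> 0}"

definition c0_predual :: "(nat \<Rightarrow> real) \<Rightarrow> ((nat \<Rightarrow> complex) \<Rightarrow> complex) set" where
  "c0_predual \<omega> = (\<lambda>b. \<lambda>a\<in>carrier (ell1 \<omega>). \<Sum>n. a n * b n) ` c0_inv \<omega>"

section \<open>\<open>\<ell>\<^sup>1(\<omega>)\<close> is a dual Banach algebra with predual \<open>c\<^sub>0(\<omega>\<^sup>-\<^sup>1)\<close>\<close>

lemma cring_complex_field: "cring complex_field"
proof (rule cringI)
  show "abelian_group complex_field"
  proof (rule abelian_groupI)
    show "\<exists>y\<in>carrier complex_field. y \<oplus>\<^bsub>complex_field\<^esub> x = \<zero>\<^bsub>complex_field\<^esub>" for x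
      by (rule bexI[of _ "- x"]) (auto simp: complex_field_def)
  qed (auto simp: complex_field_def)
  show "Group.comm_monoid complex_field"
    by (rule comm_monoidI) (auto simp: complex_field_def)
qed (auto simp: complex_field_def algebra_simps)

lemma complex_field_simps [simp]:
  "carrier complex_field = UNIV" "x \<oplus>\<^bsub>complex_field\<^esub> y = x + y" "x \<otimes>\<^bsub>complex_field\<^esub> y = x * y"
  "\<zero>\<^bsub>complex_field\<^esub> = 0" "\<one>\<^bsub>complex_field\<^esub> = 1"
  by (auto simp: complex_field_def)

lemma dual_simps:
  "carrier (dual E) = {f \<in> extensional (carrier E). bounded_linear_on E complex_nspace f}"
  "\<zero>\<^bsub>dual E\<^esub> = (\<lambda>x\<in>carrier E. 0)"
  "f \<oplus>\<^bsub>dual E\<^esub> g = (\<lambda>x\<in>carrier E. f x + g x)"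
  "c \<odot>\<^bsub>dual E\<^esub> f = (\<lambda>x\<in>carrier E. c * f x)"
  "nrm (dual E) f = (SUP x\<in>{x \<in> carrier E. nrm E x \<le> 1}. cmod (f x))"
  by (auto simp: dual_def)

lemma mem_dual_iff:
  "f \<in> carrier (dual E) \<longleftrightarrow> f \<in> extensional (carrier E) \<and>
     (\<forall>x\<in>carrier E. \<forall>y\<in>carrier E. f (x \<oplus>\<^bsub>E\<^esub> y) = f x + f y) \<and>
     (\<forall>c. \<forall>x\<in>carrier E. f (c \<odot>\<^bsub>E\<^esub> x) = c * f x) \<and>
     (\<exists>C. \<forall>x\<in>carrier E. cmod (f x) \<le> C * nrm E x)"
  by (auto simp: dual_simps bounded_linear_on_def complex_nspace_def)

context normed_space
begin

lemma smult_c: "x \<in> carrier E \<Longrightarrow> c \<odot>\<^bsub>E\<^esub> x \<in> carrier E"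
  using smult_closed[of c x] by simp

lemma minus_eq_smult: assumes "x \<in> carrier E" "y \<in> carrier E"
  shows "x \<ominus>\<^bsub>E\<^esub> y = x \<oplus>\<^bsub>E\<^esub> (- 1) \<odot>\<^bsub>E\<^esub> y"
proof -
  have "\<ominus>\<^bsub>complex_field\<^esub> 1 = - 1"
    using abelian_group.minus_equality[OF cring.axioms(1)[OF cring_complex_field, THEN ring.axioms(1)], of "-1" 1]
    by simp
  then have "(- 1) \<odot>\<^bsub>E\<^esub> y = \<ominus>\<^bsub>E\<^esub> y"
    using smult_l_minus[of 1 y] smult_one[of y] assms by simp
  then show ?thesis by (simp add: a_minus_def)
qed

lemma nrm_minus_commute: assumes "x \<in> carrier E" "y \<in> carrier E"
  shows "nrm E (x \<ominus>\<^bsub>E\<^esub> y) = nrm E (y \<ominus>\<^bsub>E\<^esub> x)"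
proof -
  have "x \<ominus>\<^bsub>E\<^esub> y = (- 1) \<odot>\<^bsub>E\<^esub> (y \<ominus>\<^bsub>E\<^esub> x)"
    using assms smult_assoc1[of "-1" "-1" x] smult_one[of x] 
      smult_r_distr[of "-1" y "(-1) \<odot>\<^bsub>E\<^esub> x"]
    by (simp add: minus_eq_smult smult_c M.a_comm)
  then show ?thesis using assms nrm_smult[of "y \<ominus>\<^bsub>E\<^esub> x" "-1"] by simp
qed

lemma ndist_le: assumes "x \<in> carrier E" "y \<in> carrier E" "z \<in> carrier E"
  shows "ndist E x z \<le> ndist E x y + ndist E y z"
proof -
  have "x \<ominus>\<^bsub>E\<^esub> z = (x \<ominus>\<^bsub>E\<^esub> y) \<oplus>\<^bsub>E\<^esub> (y \<ominus>\<^bsub>E\<^esub> z)"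
    using assms by (simp add: a_minus_def M.a_assoc) (metis M.a_assoc M.a_inv_closed M.l_neg M.l_zero)
  then show ?thesis
    using nrm_triangle[of "x \<ominus>\<^bsub>E\<^esub> y" "y \<ominus>\<^bsub>E\<^esub> z"] assms by (simp add: ndist_def)
qed

lemma Metric: "Metric_space (carrier E) (ndist E)" 
proof
  show "0 \<le> ndist E x y" for x y
    by (auto simp: ndist_def intro!: nrm_nonneg)
  show "ndist E x y = ndist E y x" for x y
    by (auto simp: ndist_def intro!: nrm_minus_commute)
  show "(ndist E x y = 0) = (x = y)" if "x \<in> carrier E" "y \<in> carrier E" for x y
  proof -
    have "x \<ominus>\<^bsub>E\<^esub> y = \<zero>\<^bsub>E\<^esub> \<longleftrightarrow> x = y"
      using that by (metis a_minus_def M.add.inv_solve_right M.l_zero M.minus_closed M.r_neg M.zero_closed)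
    then show ?thesis using that by (simp add: ndist_def nrm_eq_0)
  qed
qed (rule ndist_le)

lemma dual_bdd:
  assumes "f \<in> carrier (dual E)"
  shows "bdd_above ((\<lambda>x. cmod (f x)) ` {x \<in> carrier E. nrm E x \<le> 1})"
proof -
  from assms obtain C where C: "\<And>x. x \<in> carrier E \<Longrightarrow> cmod (f x) \<le> C * nrm E x"
    unfolding mem_dual_iff by blast
  have "cmod (f x) \<le> \<bar>C\<bar>" if "x \<in> carrier E" "nrm E x \<le> 1" for x
  proof -
    have "cmod (f x) \<le> C * nrm E x" using C that by auto
    also have "\<dots> \<le> \<bar>C\<bar> * nrm E x" using that nrm_nonneg[of x] by (intro mult_right_mono) auto
    also have "\<dots> \<le> \<bar>C\<bar> * 1" using that by (intro mult_left_mono) auto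
    finally show ?thesis by simp
  qed
  then show ?thesis by (auto intro!: bdd_aboveI2)
qed

lemma dual_bound:
  assumes f: "f \<in> carrier (dual E)" and x: "x \<in> carrier E"
  shows "cmod (f x) \<le> nrm (dual E) f * nrm E x"
proof (cases "nrm E x = 0")
  case True
  then show ?thesis using f x by (force simp: mem_dual_iff)
next
  case False
  define r where "r = nrm E x"
  have r: "r > 0" using False nrm_nonneg[OF x] by (simp add: r_def)
  define y where "y = complex_of_real (1/r) \<odot>\<^bsub>E\<^esub> x"
  have y: "y \<in> carrier E" "nrm E y \<le> 1"
    using x r by (auto simp: y_def smult_c nrm_smult r_def[symmetric] norm_divide)
  have "cmod (f y) \<le> nrm (dual E) f"
    unfolding dual_simps by (rule cSUP_upper) (use y dual_bdd[OF f] in auto)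
  moreover have "f y = complex_of_real (1/r) * f x"
    using f x by (auto simp: y_def mem_dual_iff)
  ultimately show ?thesis using r by (simp add: norm_mult norm_divide field_simps r_def)
qed

lemma dual_le:
  assumes "\<And>x. x \<in> carrier E \<Longrightarrow> cmod (f x) \<le> C * nrm E x" "0 \<le> C"
  shows "nrm (dual E) f \<le> C"
  unfolding dual_simps
proof (rule cSUP_least)
  show "{x \<in> carrier E. nrm E x \<le> 1} \<noteq> {}"
    using nrm_eq_0[of "\<zero>\<^bsub>E\<^esub>"] by (auto intro!: exI[of _ "\<zero>\<^bsub>E\<^esub>"])
  show "cmod (f x) \<le> C" if "x \<in> {x \<in> carrier E. nrm E x \<le> 1}" for x
  proof -
    have "cmod (f x) \<le> C * nrm E x" using assms that by auto
    also have "\<dots> \<le> C * 1" using that assms by (intro mult_left_mono) auto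
    finally show ?thesis by simp
  qed
qed

lemma dual_nonneg: assumes "f \<in> carrier (dual E)" shows "0 \<le> nrm (dual E) f"
proof -
  have "cmod (f \<zero>\<^bsub>E\<^esub>) \<le> nrm (dual E) f"
    unfolding dual_simps by (rule cSUP_upper)
      (use dual_bdd[OF assms] nrm_eq_0[of "\<zero>\<^bsub>E\<^esub>"] in auto)
  then show ?thesis using norm_ge_zero order_trans by blast
qed

lemma dual_add: assumes f: "f \<in> carrier (dual E)" and g: "g \<in> carrier (dual E)"
  shows "f \<oplus>\<^bsub>dual E\<^esub> g \<in> carrier (dual E)"
proof -
  have "cmod (f x + g x) \<le> (nrm (dual E) f + nrm (dual E) g) * nrm E x" if "x \<in> carrier E" for x
    using dual_bound[OF f that] dual_bound[OF g that] norm_triangle_ineq[of "f x" "g x"]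
    by (simp add: ring_distribs)
  then have "\<exists>C. \<forall>x\<in>carrier E. cmod (f x + g x) \<le> C * nrm E x" by blast
  then show ?thesis using f g
    by (simp add: mem_dual_iff dual_simps(3) smult_c ring_distribs add_ac)
qed

lemma dual_smult: assumes f: "f \<in> carrier (dual E)"
  shows "c \<odot>\<^bsub>dual E\<^esub> f \<in> carrier (dual E)"
proof -
  have "cmod (c * f x) \<le> (cmod c * nrm (dual E) f) * nrm E x" if "x \<in> carrier E" for x
    using dual_bound[OF f that] mult_left_mono[of "cmod (f x)" "nrm (dual E) f * nrm E x" "cmod c"]
    by (simp add: norm_mult mult_ac)
  then have "\<exists>C. \<forall>x\<in>carrier E. cmod (c * f x) \<le> C * nrm E x" by blast
  then show ?thesis using f
    by (simp add: mem_dual_iff dual_simps(4) smult_c ring_distribs mult_ac)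
qed

lemma dual_normed_space: "normed_space (dual E)"
proof (intro normed_space.intro normed_space_axioms.intro moduleI cring_complex_field abelian_groupI)
  show "\<zero>\<^bsub>dual E\<^esub> \<in> carrier (dual E)"
    by (auto simp: mem_dual_iff dual_simps(2) smult_c intro!: exI[of _ 0])
  show "\<exists>g\<in>carrier (dual E). g \<oplus>\<^bsub>dual E\<^esub> f = \<zero>\<^bsub>dual E\<^esub>" if "f \<in> carrier (dual E)" for f
    by (rule bexI[of _ "(-1) \<odot>\<^bsub>dual E\<^esub> f"]) (use dual_smult[OF that, of "-1"] in \<open>auto simp: dual_simps(2-4)\<close>)
  show "\<zero>\<^bsub>dual E\<^esub> \<oplus>\<^bsub>dual E\<^esub> f = f" if "f \<in> carrier (dual E)" for f
    using that by (auto simp: mem_dual_iff dual_simps(2-4) extensional_def)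
  show "\<one>\<^bsub>complex_field\<^esub> \<odot>\<^bsub>dual E\<^esub> f = f" if "f \<in> carrier (dual E)" for f
    using that by (auto simp: mem_dual_iff dual_simps(2-4) extensional_def)
  show "nrm (dual E) f = 0 \<longleftrightarrow> f = \<zero>\<^bsub>dual E\<^esub>" if f: "f \<in> carrier (dual E)" for f
  proof
    assume "nrm (dual E) f = 0"
    then have "f x = 0" if "x \<in> carrier E" for x using dual_bound[OF f that] by simp
    then show "f = \<zero>\<^bsub>dual E\<^esub>" using f by (auto simp: mem_dual_iff dual_simps(2) extensional_def)
  next
    assume z: "f = \<zero>\<^bsub>dual E\<^esub>"
    have "nrm (dual E) f \<le> 0" by (rule dual_le) (auto simp: z dual_simps(2))
    then show "nrm (dual E) f = 0" using dual_nonneg[OF f] by simp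
  qed
  show "nrm (dual E) (f \<oplus>\<^bsub>dual E\<^esub> g) \<le> nrm (dual E) f + nrm (dual E) g"
    if f: "f \<in> carrier (dual E)" and g: "g \<in> carrier (dual E)" for f g
  proof (rule dual_le)
    show "cmod ((f \<oplus>\<^bsub>dual E\<^esub> g) x) \<le> (nrm (dual E) f + nrm (dual E) g) * nrm E x" if "x \<in> carrier E" for x
      using dual_bound[OF f that] dual_bound[OF g that] norm_triangle_ineq[of "f x" "g x"] that
      by (simp add: ring_distribs dual_simps(3))
  qed (use dual_nonneg f g in auto)
  have le: "nrm (dual E) (c \<odot>\<^bsub>dual E\<^esub> f) \<le> cmod c * nrm (dual E) f"
    if f: "f \<in> carrier (dual E)" for f c
  proof (rule dual_le)
    show "cmod ((c \<odot>\<^bsub>dual E\<^esub> f) x) \<le> cmod c * nrm (dual E) f * nrm E x" if "x \<in> carrier E" for x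
      using dual_bound[OF f that] mult_left_mono[of "cmod (f x)" "nrm (dual E) f * nrm E x" "cmod c"] that
      by (simp add: norm_mult mult_ac dual_simps(4))
  qed (use dual_nonneg f in auto)
  show "nrm (dual E) (c \<odot>\<^bsub>dual E\<^esub> f) = cmod c * nrm (dual E) f" if f: "f \<in> carrier (dual E)" for f c
  proof (cases "c = 0")
    case True
    then show ?thesis using le[OF f, of c] dual_nonneg[OF dual_smult[OF f, of c]] by simp
  next
    case False
    have "f = (1/c) \<odot>\<^bsub>dual E\<^esub> (c \<odot>\<^bsub>dual E\<^esub> f)"
      using f False by (auto simp: mem_dual_iff dual_simps(4) extensional_def)
    then have "nrm (dual E) f \<le> cmod (1/c) * nrm (dual E) (c \<odot>\<^bsub>dual E\<^esub> f)"
      using le[OF dual_smult[OF f, of c], of "1/c"] by simp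
    then show ?thesis using le[OF f, of c] False by (simp add: norm_divide field_simps)
  qed
qed (auto simp: dual_add dual_smult dual_nonneg, auto simp: dual_simps(2-4) algebra_simps)

end

lemma ell1_simps:
  "carrier (ell1 \<omega>) = {a. summable (\<lambda>n. cmod (a n) * \<omega> n)}"
  "\<zero>\<^bsub>ell1 \<omega>\<^esub> = (\<lambda>n. 0)" "a \<oplus>\<^bsub>ell1 \<omega>\<^esub> b = (\<lambda>n. a n + b n)" "a \<otimes>\<^bsub>ell1 \<omega>\<^esub> b = (\<lambda>n. a n * b n)"
  "c \<odot>\<^bsub>ell1 \<omega>\<^esub> a = (\<lambda>n. c * a n)" "nrm (ell1 \<omega>) a = (\<Sum>n. cmod (a n) * \<omega> n)"
  by (auto simp: ell1_def)

context
  fixes \<omega> :: "nat \<Rightarrow> real"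
  assumes w1: "\<And>n. 1 \<le> \<omega> n"
begin

lemma w0: "0 < \<omega> n" "0 \<le> \<omega> n" "\<omega> n \<noteq> 0" using w1[of n] by auto

lemma ell1_add: assumes "a \<in> carrier (ell1 \<omega>)" "b \<in> carrier (ell1 \<omega>)"
  shows "a \<oplus>\<^bsub>ell1 \<omega>\<^esub> b \<in> carrier (ell1 \<omega>)"
proof -
  have "summable (\<lambda>n. cmod (a n) * \<omega> n + cmod (b n) * \<omega> n)"
    using assms by (auto simp: ell1_simps intro: summable_add)
  then have "summable (\<lambda>n. cmod (a n + b n) * \<omega> n)"
    by (rule summable_comparison_test'[where N = 0])
       (use w0 norm_triangle_ineq mult_right_mono[OF norm_triangle_ineq w0(2)] in \<open>auto simp: abs_mult ring_distribs\<close>)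
  then show ?thesis by (simp add: ell1_simps)
qed

lemma ell1_smult: assumes "a \<in> carrier (ell1 \<omega>)" 
  shows "c \<odot>\<^bsub>ell1 \<omega>\<^esub> a \<in> carrier (ell1 \<omega>)"
  using assms summable_mult[of "\<lambda>n. cmod (a n) * \<omega> n" "cmod c"]
  by (simp add: ell1_simps norm_mult mult.assoc)

lemma ell1_entry: assumes "a \<in> carrier (ell1 \<omega>)" 
  shows "cmod (a n) * \<omega> n \<le> nrm (ell1 \<omega>) a"
  using sum_le_suminf[of "\<lambda>n. cmod (a n) * \<omega> n" "{n}"] assms w0 by (simp add: ell1_simps)

lemma ell1_entry': assumes "a \<in> carrier (ell1 \<omega>)" 
  shows "cmod (a n) \<le> nrm (ell1 \<omega>) a"
  using ell1_entry[OF assms, of n] mult_left_mono[OF w1[of n], of "cmod (a n)"] by simp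

lemma ell1_nonneg: "a \<in> carrier (ell1 \<omega>) \<Longrightarrow> 0 \<le> nrm (ell1 \<omega>) a"
  using ell1_entry'[of a 0] norm_ge_zero[of "a 0"] by linarith

lemma ell1_normed: "normed_space (ell1 \<omega>)"
proof (intro normed_space.intro normed_space_axioms.intro moduleI cring_complex_field abelian_groupI)
  show "\<exists>g\<in>carrier (ell1 \<omega>). g \<oplus>\<^bsub>ell1 \<omega>\<^esub> f = \<zero>\<^bsub>ell1 \<omega>\<^esub>" if "f \<in> carrier (ell1 \<omega>)" for f
    by (rule bexI[of _ "(-1) \<odot>\<^bsub>ell1 \<omega>\<^esub> f"]) (use ell1_smult[OF that, of "-1"] in \<open>auto simp: ell1_simps(2-5)\<close>)
  show "nrm (ell1 \<omega>) a = 0 \<longleftrightarrow> a = \<zero>\<^bsub>ell1 \<omega>\<^esub>" if "a \<in> carrier (ell1 \<omega>)" for a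
    using ell1_entry'[OF that] by (auto simp: ell1_simps(2)) (auto simp: ell1_simps)
  show "nrm (ell1 \<omega>) (a \<oplus>\<^bsub>ell1 \<omega>\<^esub> b) \<le> nrm (ell1 \<omega>) a + nrm (ell1 \<omega>) b"
    if "a \<in> carrier (ell1 \<omega>)" "b \<in> carrier (ell1 \<omega>)" for a b
  proof -
    have "(\<Sum>n. cmod (a n + b n) * \<omega> n) \<le> (\<Sum>n. cmod (a n) * \<omega> n + cmod (b n) * \<omega> n)"
    proof (rule suminf_le)
      show "cmod (a n + b n) * \<omega> n \<le> cmod (a n) * \<omega> n + cmod (b n) * \<omega> n" for n
        using mult_right_mono[OF norm_triangle_ineq w0(2)] by (simp add: ring_distribs)
    qed (use ell1_add[OF that] that in \<open>auto simp: ell1_simps intro: summable_add\<close>)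
    then show ?thesis using that by (simp add: ell1_simps suminf_add[symmetric])
  qed
  show "nrm (ell1 \<omega>) (c \<odot>\<^bsub>ell1 \<omega>\<^esub> a) = cmod c * nrm (ell1 \<omega>) a" if "a \<in> carrier (ell1 \<omega>)" for a c
    using that suminf_mult[of "\<lambda>n. cmod (a n) * \<omega> n" "cmod c"]
    by (simp add: ell1_simps norm_mult mult.assoc)
qed (auto simp: ell1_add ell1_smult ell1_nonneg, auto simp: ell1_simps algebra_simps)

interpretation L: normed_space "ell1 \<omega>" by (rule ell1_normed)

lemma ell1_minus: assumes "a \<in> carrier (ell1 \<omega>)" "b \<in> carrier (ell1 \<omega>)"
  shows "a \<ominus>\<^bsub>ell1 \<omega>\<^esub> b = (\<lambda>n. a n - b n)"
  using L.minus_eq_smult[OF assms] by (simp add: ell1_simps)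

lemma ell1_boundedI: assumes "\<And>N. (\<Sum>n<N. cmod (a n) * \<omega> n) \<le> C"
  shows "a \<in> carrier (ell1 \<omega>)" "nrm (ell1 \<omega>) a \<le> C"
proof -
  have s: "summable (\<lambda>n. cmod (a n) * \<omega> n)"
    by (rule summableI_nonneg_bounded[OF _ assms]) (use w0 in auto)
  then show "a \<in> carrier (ell1 \<omega>)" "nrm (ell1 \<omega>) a \<le> C"
    using suminf_le_const[OF s assms] by (auto simp: ell1_simps)
qed

lemma ell1_complete: "Metric_space.mcomplete (carrier (ell1 \<omega>)) (ndist (ell1 \<omega>))"
proof -
  interpret M: Metric_space "carrier (ell1 \<omega>)" "ndist (ell1 \<omega>)" by (rule L.Metric)
  show ?thesis unfolding M.mcomplete_def
  proof (intro allI impI)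
    fix \<sigma> assume "M.MCauchy \<sigma>"
    then have \<sigma>: "\<And>k. \<sigma> k \<in> carrier (ell1 \<omega>)"
      and cau: "\<And>\<epsilon>. \<epsilon> > 0 \<Longrightarrow> \<exists>N. \<forall>k\<ge>N. \<forall>l\<ge>N. ndist (ell1 \<omega>) (\<sigma> k) (\<sigma> l) < \<epsilon>"
      by (auto simp: M.MCauchy_def)
    have nd: "ndist (ell1 \<omega>) (\<sigma> k) (\<sigma> l) = nrm (ell1 \<omega>) (\<lambda>n. \<sigma> k n - \<sigma> l n)" for k l
      using \<sigma> by (simp add: ndist_def ell1_minus)
    have dc: "(\<lambda>n. \<sigma> k n - \<sigma> l n) \<in> carrier (ell1 \<omega>)" for k l
      using L.M.minus_closed[OF \<sigma>[of k] \<sigma>[of l]] \<sigma> by (simp add: ell1_minus)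
    have "Cauchy (\<lambda>k. \<sigma> k n)" for n
    proof (rule metric_CauchyI)
      fix e :: real assume "e > 0"
      then obtain N where "\<forall>k\<ge>N. \<forall>l\<ge>N. ndist (ell1 \<omega>) (\<sigma> k) (\<sigma> l) < e" using cau by blast
      then show "\<exists>M. \<forall>k\<ge>M. \<forall>l\<ge>M. dist (\<sigma> k n) (\<sigma> l n) < e"
        using ell1_entry'[OF dc] unfolding nd dist_norm by (meson le_less_trans)
    qed
    then have "\<forall>n. \<exists>x. (\<lambda>k. \<sigma> k n) \<longlonglongrightarrow> x" by (auto simp: Cauchy_convergent_iff convergent_def)
    then obtain a where a: "\<And>n. (\<lambda>k. \<sigma> k n) \<longlonglongrightarrow> a n" by metis
    have key: "(\<lambda>n. \<sigma> k n - a n) \<in> carrier (ell1 \<omega>) \<and> nrm (ell1 \<omega>) (\<lambda>n. \<sigma> k n - a n) \<le> \<epsilon>"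
      if N: "\<forall>k\<ge>N. \<forall>l\<ge>N. ndist (ell1 \<omega>) (\<sigma> k) (\<sigma> l) < \<epsilon>" and k: "k \<ge> N" for N k \<epsilon>
    proof -
      have "(\<Sum>n<M. cmod (\<sigma> k n - a n) * \<omega> n) \<le> \<epsilon>" for M
      proof (rule LIMSEQ_le_const2)
        show "(\<lambda>l. \<Sum>n<M. cmod (\<sigma> k n - \<sigma> l n) * \<omega> n) \<longlonglongrightarrow> (\<Sum>n<M. cmod (\<sigma> k n - a n) * \<omega> n)"
          by (intro tendsto_intros a)
        show "\<exists>N. \<forall>l\<ge>N. (\<Sum>n<M. cmod (\<sigma> k n - \<sigma> l n) * \<omega> n) \<le> \<epsilon>"
        proof (intro exI allI impI)
          fix l assume "l \<ge> N"
          have "(\<Sum>n<M. cmod (\<sigma> k n - \<sigma> l n) * \<omega> n) \<le> nrm (ell1 \<omega>) (\<lambda>n. \<sigma> k n - \<sigma> l n)"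
            using dc[of k l] w0 unfolding ell1_simps by (intro sum_le_suminf) auto
          also have "\<dots> \<le> \<epsilon>" using N k \<open>l \<ge> N\<close> unfolding nd by (meson less_imp_le)
          finally show "(\<Sum>n<M. cmod (\<sigma> k n - \<sigma> l n) * \<omega> n) \<le> \<epsilon>" .
        qed
      qed
      then show ?thesis using ell1_boundedI[of "\<lambda>n. \<sigma> k n - a n" \<epsilon>] by simp
    qed
    have ac: "a \<in> carrier (ell1 \<omega>)"
    proof -
      obtain N where "\<forall>k\<ge>N. \<forall>l\<ge>N. ndist (ell1 \<omega>) (\<sigma> k) (\<sigma> l) < 1" using cau[of 1] by auto
      then have d: "(\<lambda>n. \<sigma> N n - a n) \<in> carrier (ell1 \<omega>)" using key by blast
      then have "\<sigma> N \<ominus>\<^bsub>ell1 \<omega>\<^esub> (\<lambda>n. \<sigma> N n - a n) \<in> carrier (ell1 \<omega>)" using \<sigma>[of N] by simp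
      then show ?thesis using \<sigma>[of N] d by (simp add: ell1_minus)
    qed
    have "limitin M.mtopology \<sigma> a sequentially"
      unfolding M.limit_metric_sequentially
    proof (intro conjI allI impI ac)
      fix \<epsilon> :: real assume "\<epsilon> > 0"
      then obtain N where N: "\<forall>k\<ge>N. \<forall>l\<ge>N. ndist (ell1 \<omega>) (\<sigma> k) (\<sigma> l) < \<epsilon>/2" using cau[of "\<epsilon>/2"] by auto
      show "\<exists>N. \<forall>n\<ge>N. \<sigma> n \<in> carrier (ell1 \<omega>) \<and> ndist (ell1 \<omega>) (\<sigma> n) a < \<epsilon>"
      proof (intro exI allI impI conjI \<sigma>)
        fix n assume "n \<ge> N"
        from key[OF N this] show "ndist (ell1 \<omega>) (\<sigma> n) a < \<epsilon>"
          using \<sigma> ac \<open>\<epsilon> > 0\<close> by (simp add: ndist_def ell1_minus)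
      qed
    qed
    then show "\<exists>x. limitin M.mtopology \<sigma> x sequentially" by blast
  qed
qed

lemma ell1_mult: assumes a: "a \<in> carrier (ell1 \<omega>)" and b: "b \<in> carrier (ell1 \<omega>)"
  shows "a \<otimes>\<^bsub>ell1 \<omega>\<^esub> b \<in> carrier (ell1 \<omega>) \<and> nrm (ell1 \<omega>) (a \<otimes>\<^bsub>ell1 \<omega>\<^esub> b) \<le> nrm (ell1 \<omega>) a * nrm (ell1 \<omega>) b"
proof -
  have "(\<Sum>n<N. cmod (a n * b n) * \<omega> n) \<le> nrm (ell1 \<omega>) a * nrm (ell1 \<omega>) b" for N
  proof -
    have "(\<Sum>n<N. cmod (a n * b n) * \<omega> n) \<le> (\<Sum>n<N. (cmod (a n) * \<omega> n) * nrm (ell1 \<omega>) b)"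
    proof (rule sum_mono)
      fix n 
      show "cmod (a n * b n) * \<omega> n \<le> (cmod (a n) * \<omega> n) * nrm (ell1 \<omega>) b"
        using mult_left_mono[OF ell1_entry'[OF b, of n], of "cmod (a n) * \<omega> n"] w0(2)[of n]
        by (simp add: norm_mult mult_ac)
    qed
    also have "\<dots> = (\<Sum>n<N. (cmod (a n) * \<omega> n)) * nrm (ell1 \<omega>) b" by (simp add: sum_distrib_right)
    also have "\<dots> \<le> nrm (ell1 \<omega>) a * nrm (ell1 \<omega>) b"
    proof (rule mult_right_mono[OF _ ell1_nonneg[OF b]])
      show "(\<Sum>n<N. (cmod (a n) * \<omega> n)) \<le> nrm (ell1 \<omega>) a"
        using a w0(2) unfolding ell1_simps by (intro sum_le_suminf) auto
    qed
    finally show ?thesis .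
  qed
  from ell1_boundedI[OF this] show ?thesis by (simp add: ell1_simps)
qed

lemma ell1_banach_algebra: "banach_algebra (ell1 \<omega>)"
  by (intro banach_algebra.intro banach_space.intro ell1_normed banach_algebra_axioms.intro
      banach_space_axioms.intro ell1_complete)
     (use ell1_mult in auto, auto simp: ell1_simps algebra_simps)

definition "c0_functional b = (\<lambda>a\<in>carrier (ell1 \<omega>). \<Sum>n. a n * b n)" for b :: "nat \<Rightarrow> complex"
definition unit_seq :: "nat \<Rightarrow> nat \<Rightarrow> complex" where "unit_seq n = (\<lambda>k. if k = n then 1 else 0)"
definition trunc :: "nat \<Rightarrow> (nat \<Rightarrow> complex) \<Rightarrow> nat \<Rightarrow> complex" where "trunc N a = (\<lambda>k. if k < N then a k else 0)"

lemma fin_supp: assumes "\<And>k. k \<ge> N \<Longrightarrow> a k = 0"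
  shows "a \<in> carrier (ell1 \<omega>)" "nrm (ell1 \<omega>) a = (\<Sum>n<N. cmod (a n) * \<omega> n)"
  using sums_finite[of "{..<N}" "\<lambda>n. cmod (a n) * \<omega> n"] assms 
  by (auto simp: ell1_simps sums_iff not_less)

lemma unit_seq: "unit_seq n \<in> carrier (ell1 \<omega>)" "nrm (ell1 \<omega>) (unit_seq n) = \<omega> n"
  using fin_supp[of "Suc n" "unit_seq n"] by (auto simp: unit_seq_def)

lemma trunc_closed: "trunc N a \<in> carrier (ell1 \<omega>)"
  by (rule fin_supp[of N]) (auto simp: trunc_def)

lemma trunc_0: "trunc 0 a = (\<lambda>n. 0)" by (auto simp: trunc_def)
lemma trunc_Suc: "trunc (Suc N) a = (\<lambda>n. trunc N a n + a N * unit_seq N n)" by (rule ext) (auto simp: trunc_def unit_seq_def less_Suc_eq)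

lemma trunc_tail: assumes a: "a \<in> carrier (ell1 \<omega>)"
  shows "(\<lambda>N. nrm (ell1 \<omega>) (\<lambda>n. a n - trunc N a n)) \<longlonglongrightarrow> 0"
proof -
  have s: "(\<lambda>n. cmod (a n) * \<omega> n) sums nrm (ell1 \<omega>) a"
    using a by (simp add: ell1_simps summable_sums)
  have "nrm (ell1 \<omega>) (\<lambda>n. a n - trunc N a n) = nrm (ell1 \<omega>) a - (\<Sum>n<N. cmod (a n) * \<omega> n)" for N
  proof -
    have "(\<lambda>n. if n \<in> {..<N} then cmod (a n) * \<omega> n else 0) sums (\<Sum>n<N. cmod (a n) * \<omega> n)"
      by (rule sums_If_finite_set) auto
    from sums_diff[OF s this]
    have "(\<lambda>n. cmod (a n - trunc N a n) * \<omega> n) sums (nrm (ell1 \<omega>) a - (\<Sum>n<N. cmod (a n) * \<omega> n))"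
      by (rule sums_cong[THEN iffD1, rotated]) (auto simp: trunc_def)
    then show ?thesis by (simp add: ell1_simps sums_iff)
  qed
  moreover have "(\<lambda>N. nrm (ell1 \<omega>) a - (\<Sum>n<N. cmod (a n) * \<omega> n)) \<longlonglongrightarrow> nrm (ell1 \<omega>) a - nrm (ell1 \<omega>) a"
    using s unfolding sums_def by (intro tendsto_intros)
  ultimately show ?thesis by simp
qed

lemma dual_eval: assumes f: "f \<in> carrier (dual (ell1 \<omega>))" and a: "a \<in> carrier (ell1 \<omega>)"
  shows "(\<lambda>n. a n * f (unit_seq n)) sums f a"
proof -
  have add: "f (\<lambda>n. x n + y n) = f x + f y" if "x \<in> carrier (ell1 \<omega>)" "y \<in> carrier (ell1 \<omega>)" for x y
    using f that by (auto simp: mem_dual_iff ell1_simps(2-5))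
  have sm: "f (\<lambda>n. c * x n) = c * f x" if "x \<in> carrier (ell1 \<omega>)" for x c
    using f that by (auto simp: mem_dual_iff ell1_simps(2-5))
  have sc: "(\<lambda>n. c * x n) \<in> carrier (ell1 \<omega>)" if "x \<in> carrier (ell1 \<omega>)" for x c
    using ell1_smult[OF that, of c] by (simp add: ell1_simps(5))
  have tr: "f (trunc N a) = (\<Sum>n<N. a n * f (unit_seq n))" for N
  proof (induction N)
    case 0
    have "f (\<lambda>n. 0 * a n) = 0 * f a" by (rule sm[OF a])
    then show ?case by (simp add: trunc_0)
  next
    case (Suc N)
    then show ?case unfolding trunc_Suc by (subst add) (auto simp: trunc_closed unit_seq sc sm)
  qed
  have d: "(\<lambda>n. a n - trunc N a n) \<in> carrier (ell1 \<omega>)" for N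
    using L.M.minus_closed[OF a trunc_closed[of N a]] by (simp add: ell1_minus a trunc_closed)
  have fd: "f (\<lambda>n. a n - trunc N a n) = f a - f (trunc N a)" for N
    using add[OF d[of N] trunc_closed[of N a]] by simp
  then have "cmod (f (trunc N a) - f a) \<le> nrm (dual (ell1 \<omega>)) f * nrm (ell1 \<omega>) (\<lambda>n. a n - trunc N a n)" for N
    using L.dual_bound[OF f d[of N]] unfolding fd by (simp only: norm_minus_commute)
  note le = this
  have "(\<lambda>N. nrm (dual (ell1 \<omega>)) f * nrm (ell1 \<omega>) (\<lambda>n. a n - trunc N a n)) \<longlonglongrightarrow> 0"
    using tendsto_mult_left[OF trunc_tail[OF a], of "nrm (dual (ell1 \<omega>)) f"] by simp
  then have "(\<lambda>N. f (trunc N a) - f a) \<longlonglongrightarrow> 0"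
    by (rule Lim_null_comparison[rotated]) (rule always_eventually, rule allI, rule le)
  then show ?thesis unfolding sums_def tr[symmetric] by (simp add: LIM_zero_cancel)
qed

lemma c0_functional_summable: assumes a: "a \<in> carrier (ell1 \<omega>)" and b: "\<And>n. cmod (b n) \<le> C * \<omega> n"
  shows "summable (\<lambda>n. cmod (a n * b n))" "cmod (c0_functional b a) \<le> C * nrm (ell1 \<omega>) a"
proof -
  have le: "cmod (a n * b n) \<le> C * (cmod (a n) * \<omega> n)" for n
    using mult_left_mono[OF b[of n], of "cmod (a n)"] by (simp add: norm_mult mult_ac)
  have s: "summable (\<lambda>n. C * (cmod (a n) * \<omega> n))"
    using a by (auto simp: ell1_simps intro: summable_mult)
  show sm: "summable (\<lambda>n. cmod (a n * b n))"
    by (rule summable_comparison_test'[OF s, of 0]) (use le in auto)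
  have "cmod (c0_functional b a) \<le> (\<Sum>n. cmod (a n * b n))" using a sm by (simp add: c0_functional_def summable_norm)
  also have "\<dots> \<le> (\<Sum>n. C * (cmod (a n) * \<omega> n))" by (rule suminf_le[OF le sm s])
  also have "\<dots> = C * nrm (ell1 \<omega>) a" using a by (simp add: ell1_simps suminf_mult)
  finally show "cmod (c0_functional b a) \<le> C * nrm (ell1 \<omega>) a" .
qed

lemma c0_functional_dual: assumes b: "\<And>n. cmod (b n) \<le> C * \<omega> n"
  shows "c0_functional b \<in> carrier (dual (ell1 \<omega>))" "nrm (dual (ell1 \<omega>)) (c0_functional b) \<le> C"
proof -
  have sm: "summable (\<lambda>n. a n * b n)" if "a \<in> carrier (ell1 \<omega>)" for a
    using c0_functional_summable(1)[OF that b] by (rule summable_norm_cancel)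
  show "c0_functional b \<in> carrier (dual (ell1 \<omega>))"
    unfolding mem_dual_iff
  proof (intro conjI ballI allI exI)
    show "c0_functional b \<in> extensional (carrier (ell1 \<omega>))" by (simp add: c0_functional_def)
    show "c0_functional b (x \<oplus>\<^bsub>ell1 \<omega>\<^esub> y) = c0_functional b x + c0_functional b y" if "x \<in> carrier (ell1 \<omega>)" "y \<in> carrier (ell1 \<omega>)" for x y
      using that ell1_add[OF that] sm[OF that(1)] sm[OF that(2)]
      by (simp add: c0_functional_def ell1_simps(2-5) ring_distribs suminf_add)
    show "c0_functional b (c \<odot>\<^bsub>ell1 \<omega>\<^esub> x) = c * c0_functional b x" if "x \<in> carrier (ell1 \<omega>)" for x c
      using that ell1_smult[OF that, of c] sm[OF that]
      by (simp add: c0_functional_def ell1_simps(2-5) mult.assoc suminf_mult)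
    show "cmod (c0_functional b x) \<le> C * nrm (ell1 \<omega>) x" if "x \<in> carrier (ell1 \<omega>)" for x
      by (rule c0_functional_summable(2)[OF that b])
  qed
  have "0 \<le> C" using b[of 0] w0[of 0] norm_ge_zero[of "b 0"]
    by (metis order_trans zero_le_mult_iff not_less)
  then show "nrm (dual (ell1 \<omega>)) (c0_functional b) \<le> C"
    by (rule L.dual_le[rotated]) (rule c0_functional_summable(2)[OF _ b])
qed

lemma c0_functional_unit_seq: "c0_functional b (unit_seq n) = b n"
proof -
  have "(\<lambda>k. unit_seq n k * b k) sums b n"
    using sums_single[of n b] by (rule sums_cong[THEN iffD1, rotated]) (auto simp: unit_seq_def)
  then show ?thesis by (simp add: c0_functional_def unit_seq sums_iff)
qed

lemma c0_bdd: assumes "b \<in> c0_inv \<omega>" obtains C where "C > 0" "\<And>n. cmod (b n) \<le> C * \<omega> n"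
proof -
  from assms have "Bseq (\<lambda>n. b n / complex_of_real (\<omega> n))"
    unfolding c0_inv_def by (auto intro: convergent_imp_Bseq convergentI)
  then obtain C where "C > 0" "\<And>n. cmod (b n / complex_of_real (\<omega> n)) \<le> C"
    unfolding Bseq_def by auto
  with that w0 show ?thesis by (metis abs_of_nonneg norm_divide norm_of_real pos_divide_le_eq)
qed

lemma mem_P_iff: "f \<in> c0_predual \<omega> \<longleftrightarrow> f \<in> carrier (dual (ell1 \<omega>)) \<and> (\<lambda>n. f (unit_seq n)) \<in> c0_inv \<omega>"
proof
  assume "f \<in> c0_predual \<omega>"
  then obtain b where b: "b \<in> c0_inv \<omega>" "f = c0_functional b" by (auto simp: c0_predual_def c0_functional_def)
  from c0_bdd[OF b(1)] obtain C where "\<And>n. cmod (b n) \<le> C * \<omega> n" by metis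
  then show "f \<in> carrier (dual (ell1 \<omega>)) \<and> (\<lambda>n. f (unit_seq n)) \<in> c0_inv \<omega>"
    using c0_functional_dual b by (auto simp: c0_functional_unit_seq)
next
  assume f: "f \<in> carrier (dual (ell1 \<omega>)) \<and> (\<lambda>n. f (unit_seq n)) \<in> c0_inv \<omega>"
  have "f = c0_functional (\<lambda>n. f (unit_seq n))"
  proof
    show "f a = c0_functional (\<lambda>n. f (unit_seq n)) a" for a
      using f dual_eval[of f a] by (cases "a \<in> carrier (ell1 \<omega>)") (auto simp: c0_functional_def sums_iff mem_dual_iff extensional_def)
  qed
  then show "f \<in> c0_predual \<omega>" using f by (auto simp: c0_predual_def c0_functional_def)
qed

interpretation LD: normed_space "dual (ell1 \<omega>)" by (rule L.dual_normed_space)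

lemma P_closed: "closedin (ntopology (dual (ell1 \<omega>))) (c0_predual \<omega>)"
proof -
  interpret M: Metric_space "carrier (dual (ell1 \<omega>))" "ndist (dual (ell1 \<omega>))" by (rule LD.Metric)
  show ?thesis unfolding ntopology_def M.metric_closedin_iff_sequentially_closed
  proof (intro conjI allI impI)
    show "c0_predual \<omega> \<subseteq> carrier (dual (ell1 \<omega>))" by (auto simp: mem_P_iff)
    fix \<sigma> f assume "range \<sigma> \<subseteq> c0_predual \<omega> \<and> limitin M.mtopology \<sigma> f sequentially"
    then have \<sigma>: "\<And>k. \<sigma> k \<in> c0_predual \<omega>" and f: "f \<in> carrier (dual (ell1 \<omega>))"
      and lim: "\<And>\<epsilon>. \<epsilon> > 0 \<Longrightarrow> \<exists>N. \<forall>n\<ge>N. ndist (dual (ell1 \<omega>)) (\<sigma> n) f < \<epsilon>"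
      unfolding M.limit_metric_sequentially by (blast, blast, meson)
    have "(\<lambda>n. f (unit_seq n) / complex_of_real (\<omega> n)) \<longlonglongrightarrow> 0"
    proof (rule LIMSEQ_I)
      fix e :: real assume e: "e > 0"
      then obtain k where k: "ndist (dual (ell1 \<omega>)) (\<sigma> k) f < e/2" using lim[of "e/2"] by auto
      have sk: "\<sigma> k \<in> carrier (dual (ell1 \<omega>))" "(\<lambda>n. \<sigma> k (unit_seq n) / complex_of_real (\<omega> n)) \<longlonglongrightarrow> 0"
        using \<sigma>[of k] by (auto simp: mem_P_iff c0_inv_def)
      from LIMSEQ_D[OF sk(2), of "e/2"] e obtain N where
        N: "\<And>n. n \<ge> N \<Longrightarrow> cmod (\<sigma> k (unit_seq n) / complex_of_real (\<omega> n)) < e/2" by auto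
      have g: "\<sigma> k \<ominus>\<^bsub>dual (ell1 \<omega>)\<^esub> f \<in> carrier (dual (ell1 \<omega>))" using sk f by simp
      have "cmod (f (unit_seq n) / complex_of_real (\<omega> n) - 0) < e" if "n \<ge> N" for n
      proof -
        have "(\<sigma> k \<ominus>\<^bsub>dual (ell1 \<omega>)\<^esub> f) (unit_seq n) = \<sigma> k (unit_seq n) - f (unit_seq n)"
          using sk f unit_seq[of n] by (simp add: LD.minus_eq_smult dual_simps(3,4))
        with L.dual_bound[OF g unit_seq(1)[of n]]
        have "cmod (\<sigma> k (unit_seq n) - f (unit_seq n)) \<le> nrm (dual (ell1 \<omega>)) (\<sigma> k \<ominus>\<^bsub>dual (ell1 \<omega>)\<^esub> f) * \<omega> n"
          unfolding unit_seq(2) by simp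
        also have "\<dots> \<le> e/2 * \<omega> n"
          by (rule mult_right_mono[OF _ w0(2)]) (use k f sk(1) in \<open>simp add: ndist_def\<close>)
        finally have "cmod (\<sigma> k (unit_seq n) - f (unit_seq n)) \<le> e/2 * \<omega> n" .
        then have "cmod ((\<sigma> k (unit_seq n) - f (unit_seq n)) / complex_of_real (\<omega> n)) \<le> e/2"
          using w0[of n] by (simp add: norm_divide pos_divide_le_eq)
        then show ?thesis
          using N[OF that] norm_triangle_ineq4[of "\<sigma> k (unit_seq n) / complex_of_real (\<omega> n)" "(\<sigma> k (unit_seq n) - f (unit_seq n)) / complex_of_real (\<omega> n)"]
          by (simp add: diff_divide_distrib)
      qed
      then show "\<exists>N. \<forall>n\<ge>N. cmod (f (unit_seq n) / complex_of_real (\<omega> n) - 0) < e" by blast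
    qed
    then show "f \<in> c0_predual \<omega>" using f by (auto simp: mem_P_iff c0_inv_def)
  qed
qed

lemma P_add: assumes "f \<in> c0_predual \<omega>" "g \<in> c0_predual \<omega>"
  shows "f \<oplus>\<^bsub>dual (ell1 \<omega>)\<^esub> g \<in> c0_predual \<omega>"
  using assms L.dual_add[of f g] tendsto_add[of "\<lambda>n. f (unit_seq n) / complex_of_real (\<omega> n)" 0 _ "\<lambda>n. g (unit_seq n) / complex_of_real (\<omega> n)" 0]
  by (auto simp: mem_P_iff c0_inv_def) (auto simp: dual_simps(3) unit_seq add_divide_distrib)

lemma P_smult: assumes "f \<in> c0_predual \<omega>"
  shows "c \<odot>\<^bsub>dual (ell1 \<omega>)\<^esub> f \<in> c0_predual \<omega>"
  using assms L.dual_smult[of f c] tendsto_mult_left[of "\<lambda>n. f (unit_seq n) / complex_of_real (\<omega> n)" 0 sequentially c]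
  by (auto simp: mem_P_iff c0_inv_def) (auto simp: dual_simps(4) unit_seq)

lemma P_sub: "submodule (c0_predual \<omega>) complex_field (dual (ell1 \<omega>))"
proof (rule LD.submoduleI)
  show "\<zero>\<^bsub>dual (ell1 \<omega>)\<^esub> \<in> c0_predual \<omega>"
    using LD.M.zero_closed by (simp add: mem_P_iff c0_inv_def) (simp add: dual_simps(2) unit_seq)
  show "\<ominus>\<^bsub>dual (ell1 \<omega>)\<^esub> f \<in> c0_predual \<omega>" if f: "f \<in> c0_predual \<omega>" for f
  proof -
    have fc: "f \<in> carrier (dual (ell1 \<omega>))" using f by (simp add: mem_P_iff)
    have "\<ominus>\<^bsub>dual (ell1 \<omega>)\<^esub> f = \<zero>\<^bsub>dual (ell1 \<omega>)\<^esub> \<ominus>\<^bsub>dual (ell1 \<omega>)\<^esub> f"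
      using fc by (simp add: a_minus_def)
    also have "\<dots> = (-1) \<odot>\<^bsub>dual (ell1 \<omega>)\<^esub> f"
      using fc LD.minus_eq_smult[of "\<zero>\<^bsub>dual (ell1 \<omega>)\<^esub>" f] LD.smult_c[OF fc] by simp
    finally show ?thesis using P_smult[OF f] by simp
  qed
qed (auto simp: P_add P_smult, auto simp: mem_P_iff)

abbreviation "c0_space \<equiv> (dual (ell1 \<omega>))\<lparr>carrier := c0_predual \<omega>\<rparr>"

lemma G_simps: "carrier c0_space = c0_predual \<omega>" "nrm c0_space = nrm (dual (ell1 \<omega>))"
  "add c0_space = add (dual (ell1 \<omega>))" "smult c0_space = smult (dual (ell1 \<omega>))" "zero c0_space = zero (dual (ell1 \<omega>))"
  by (auto simp: dual_def)

lemma P_dual: "f \<in> c0_predual \<omega> \<Longrightarrow> f \<in> carrier (dual (ell1 \<omega>))" by (simp add: mem_P_iff)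

lemma G_normed: "normed_space c0_space"
  using submodule.submodule_is_module[OF P_sub LD.module_axioms]
  by (auto simp: normed_space_def normed_space_axioms_def G_simps LD.nrm_nonneg LD.nrm_eq_0 LD.nrm_triangle LD.nrm_smult P_dual)

interpretation G: normed_space c0_space by (rule G_normed)

lemma c0_functional_tr_P: "c0_functional (trunc N b) \<in> c0_predual \<omega>"
proof -
  have "eventually (\<lambda>n. trunc N b n / complex_of_real (\<omega> n) = 0) sequentially"
    unfolding eventually_sequentially by (intro exI[of _ N]) (auto simp: trunc_def)
  then have "trunc N b \<in> c0_inv \<omega>" unfolding c0_inv_def mem_Collect_eq by (rule tendsto_eventually)
  then show ?thesis by (auto simp: c0_predual_def c0_functional_def)
qed

lemma c0_functional_unit_seq_P: "c0_functional (unit_seq n) \<in> c0_predual \<omega>"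
proof -
  have "unit_seq n = trunc (Suc n) (unit_seq n)" by (auto simp: trunc_def unit_seq_def)
  then show ?thesis using c0_functional_tr_P by metis
qed

lemma dual_ext: assumes "f \<in> carrier (dual (ell1 \<omega>))" "g \<in> carrier (dual (ell1 \<omega>))" "\<And>n. f (unit_seq n) = g (unit_seq n)"
  shows "f = g"
proof
  show "f a = g a" for a
    using assms dual_eval[of f a] dual_eval[of g a]
    by (cases "a \<in> carrier (ell1 \<omega>)") (auto simp: sums_iff mem_dual_iff extensional_def)
qed

lemma kappa: assumes a: "a \<in> carrier (ell1 \<omega>)"
  shows "(\<lambda>f\<in>c0_predual \<omega>. f a) \<in> carrier (dual c0_space)"
  unfolding mem_dual_iff G_simps
proof (intro conjI ballI allI exI)
  show "cmod ((\<lambda>f\<in>c0_predual \<omega>. f a) f) \<le> nrm (ell1 \<omega>) a * nrm (dual (ell1 \<omega>)) f" if "f \<in> c0_predual \<omega>" for f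
    using L.dual_bound[OF P_dual[OF that] a] that by (simp add: mult.commute)
qed (auto simp: P_add P_smult, auto simp: dual_simps(3,4) a)

definition "sgn_trunc N a = trunc N (\<lambda>n. cnj (sgn (a n)) * complex_of_real (\<omega> n))" for a

lemma sgn_trunc: "sgn_trunc N a n * a n = (if n < N then complex_of_real (cmod (a n) * \<omega> n) else 0)"
proof -
  have "cnj (sgn z) * z = complex_of_real (cmod z)" for z
  proof (cases "z = 0")
    case False
    have "cnj (sgn z) * z = (z * cnj z) / complex_of_real (cmod z)"
      by (simp add: sgn_eq)
    also have "\<dots> = complex_of_real (cmod z)"
      using False by (simp add: complex_norm_square[symmetric] power2_eq_square)
    finally show ?thesis .
  qed simp
  from this[of "a n"] show ?thesis
    by (simp add: sgn_trunc_def trunc_def mult.commute mult.left_commute)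
qed

lemma sgn_trunc_functional: "c0_functional (sgn_trunc N a) \<in> c0_predual \<omega>" "nrm (dual (ell1 \<omega>)) (c0_functional (sgn_trunc N a)) \<le> 1"
proof -
  show "c0_functional (sgn_trunc N a) \<in> c0_predual \<omega>" by (simp add: sgn_trunc_def c0_functional_tr_P)
  show "nrm (dual (ell1 \<omega>)) (c0_functional (sgn_trunc N a)) \<le> 1"
    by (rule c0_functional_dual) (use w0 in \<open>auto simp: sgn_trunc_def trunc_def norm_mult norm_sgn\<close>)
qed

lemma kappa_nrm: assumes a: "a \<in> carrier (ell1 \<omega>)"
  shows "nrm (dual c0_space) (\<lambda>f\<in>c0_predual \<omega>. f a) = nrm (ell1 \<omega>) a"
proof (rule antisym)
  show "nrm (dual c0_space) (\<lambda>f\<in>c0_predual \<omega>. f a) \<le> nrm (ell1 \<omega>) a"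
  proof (rule G.dual_le)
    show "cmod ((\<lambda>f\<in>c0_predual \<omega>. f a) f) \<le> nrm (ell1 \<omega>) a * nrm c0_space f" if "f \<in> carrier c0_space" for f
      using L.dual_bound[OF P_dual a, of f] that by (simp add: mult.commute G_simps)
  qed (rule ell1_nonneg[OF a])
  have "(\<Sum>n<N. cmod (a n) * \<omega> n) \<le> nrm (dual c0_space) (\<lambda>f\<in>c0_predual \<omega>. f a)" for N
  proof -
    have "(\<lambda>n. a n * sgn_trunc N a n) sums complex_of_real (\<Sum>n<N. cmod (a n) * \<omega> n)"
      using sums_If_finite_set[of "{..<N}" "\<lambda>n. complex_of_real (cmod (a n) * \<omega> n)"]
      by (simp add: mult.commute[of "a _"] sgn_trunc)
    then have e: "c0_functional (sgn_trunc N a) a = complex_of_real (\<Sum>n<N. cmod (a n) * \<omega> n)" using a by (simp add: c0_functional_def sums_iff)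
    have "cmod (c0_functional (sgn_trunc N a) a) \<le> nrm (dual c0_space) (\<lambda>f\<in>c0_predual \<omega>. f a) * nrm (dual (ell1 \<omega>)) (c0_functional (sgn_trunc N a))"
      using G.dual_bound[OF kappa[OF a], of "c0_functional (sgn_trunc N a)"] sgn_trunc_functional[of N a] by (simp add: G_simps del: of_real_sum)
    moreover have "\<dots> \<le> nrm (dual c0_space) (\<lambda>f\<in>c0_predual \<omega>. f a) * 1"
      by (intro mult_left_mono sgn_trunc_functional G.dual_nonneg kappa a)
    moreover have "(\<Sum>n<N. cmod (a n) * \<omega> n) \<le> cmod (c0_functional (sgn_trunc N a) a)"
      unfolding e norm_of_real by simp
    ultimately show ?thesis by linarith
  qed
  then show "nrm (ell1 \<omega>) a \<le> nrm (dual c0_space) (\<lambda>f\<in>c0_predual \<omega>. f a)" by (rule ell1_boundedI)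
qed

lemma kappa_surj: assumes \<Phi>: "\<Phi> \<in> carrier (dual c0_space)"
  shows "\<exists>a\<in>carrier (ell1 \<omega>). \<Phi> = (\<lambda>f\<in>c0_predual \<omega>. f a)"
proof -
  define a where "a n = \<Phi> (c0_functional (unit_seq n))" for n
  have add: "\<Phi> (f \<oplus>\<^bsub>dual (ell1 \<omega>)\<^esub> g) = \<Phi> f + \<Phi> g" if "f \<in> c0_predual \<omega>" "g \<in> c0_predual \<omega>" for f g
    using \<Phi> that by (auto simp: mem_dual_iff[of \<Phi>] G_simps)
  have sm: "\<Phi> (c \<odot>\<^bsub>dual (ell1 \<omega>)\<^esub> f) = c * \<Phi> f" if "f \<in> c0_predual \<omega>" for f c
    using \<Phi> that by (auto simp: mem_dual_iff[of \<Phi>] G_simps)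
  have tr: "\<Phi> (c0_functional (trunc N b)) = (\<Sum>n<N. b n * a n)" for N b
  proof (induction N)
    case 0
    have "c0_functional (trunc 0 b) = 0 \<odot>\<^bsub>dual (ell1 \<omega>)\<^esub> c0_functional (trunc 0 b)"
      by (auto simp: dual_simps(4) c0_functional_def trunc_0)
    then have "\<Phi> (c0_functional (trunc 0 b)) = 0 * \<Phi> (c0_functional (trunc 0 b))" using sm[OF c0_functional_tr_P, of 0 0 b] by simp
    then show ?case by simp
  next
    case (Suc N)
    have "c0_functional (trunc (Suc N) b) = c0_functional (trunc N b) \<oplus>\<^bsub>dual (ell1 \<omega>)\<^esub> (b N \<odot>\<^bsub>dual (ell1 \<omega>)\<^esub> c0_functional (unit_seq N))"
      by (rule dual_ext) (auto intro!: P_dual c0_functional_tr_P P_add P_smult c0_functional_unit_seq_P,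
         auto simp: dual_simps(3,4) unit_seq c0_functional_unit_seq trunc_Suc)
    then show ?case using Suc by (simp add: add sm c0_functional_tr_P c0_functional_unit_seq_P P_smult a_def)
  qed
  have "(\<Sum>n<N. cmod (a n) * \<omega> n) \<le> nrm (dual c0_space) \<Phi>" for N
  proof -
    have "\<Phi> (c0_functional (sgn_trunc N a)) = (\<Sum>n<N. sgn_trunc N a n * a n)" unfolding sgn_trunc_def by (subst tr) (auto simp: trunc_def)
    then have e: "\<Phi> (c0_functional (sgn_trunc N a)) = complex_of_real (\<Sum>n<N. cmod (a n) * \<omega> n)" by (simp add: sgn_trunc)
    have "cmod (\<Phi> (c0_functional (sgn_trunc N a))) \<le> nrm (dual c0_space) \<Phi> * nrm (dual (ell1 \<omega>)) (c0_functional (sgn_trunc N a))"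
      using G.dual_bound[OF \<Phi>, of "c0_functional (sgn_trunc N a)"] sgn_trunc_functional by (simp add: G_simps)
    moreover have "\<dots> \<le> nrm (dual c0_space) \<Phi> * 1"
      by (intro mult_left_mono sgn_trunc_functional G.dual_nonneg \<Phi>)
    moreover have "(\<Sum>n<N. cmod (a n) * \<omega> n) \<le> cmod (\<Phi> (c0_functional (sgn_trunc N a)))"
      unfolding e norm_of_real by simp
    ultimately show ?thesis by linarith
  qed
  then have ac: "a \<in> carrier (ell1 \<omega>)" by (rule ell1_boundedI)
  have "\<Phi> f = f a" if f: "f \<in> c0_predual \<omega>" for f
  proof -
    define b where "b n = f (unit_seq n)" for n
    have fc: "f \<in> carrier (dual (ell1 \<omega>))" using f by (rule P_dual)
    have b0: "(\<lambda>n. b n / complex_of_real (\<omega> n)) \<longlonglongrightarrow> 0" using f by (simp add: mem_P_iff c0_inv_def b_def)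
    have "(\<lambda>N. \<Phi> (c0_functional (trunc N b))) \<longlonglongrightarrow> \<Phi> f"
    proof (rule LIMSEQ_I)
      fix e :: real assume e: "e > 0"
      define K where "K = nrm (dual c0_space) \<Phi> + 1"
      have K: "K > 0" using G.dual_nonneg[OF \<Phi>] by (simp add: K_def)
      from LIMSEQ_D[OF b0, of "e/(2*K)"] e K obtain N0 where
        N0: "\<And>n. n \<ge> N0 \<Longrightarrow> cmod (b n / complex_of_real (\<omega> n)) < e/(2*K)" by auto
      have "cmod (\<Phi> (c0_functional (trunc N b)) - \<Phi> f) < e" if N: "N \<ge> N0" for N
      proof -
        define g where "g = c0_functional (trunc N b) \<oplus>\<^bsub>dual (ell1 \<omega>)\<^esub> ((-1) \<odot>\<^bsub>dual (ell1 \<omega>)\<^esub> f)"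
        have gP: "g \<in> c0_predual \<omega>" unfolding g_def by (intro P_add P_smult c0_functional_tr_P f)
        have gunit_seq: "g (unit_seq n) = trunc N b n - b n" for n
          by (simp add: g_def dual_simps(3,4) unit_seq c0_functional_unit_seq b_def)
        have le: "cmod (trunc N b n - b n) \<le> e/(2*K) * \<omega> n" for n
        proof (cases "n < N")
          case True then show ?thesis using e K w0[of n] by (simp add: trunc_def)
        next
          case False
          then have "cmod (b n) / \<omega> n < e/(2*K)" using N0[of n] N w0[of n] by (simp add: norm_divide)
          then have "cmod (b n) < e/(2*K) * \<omega> n" using w0[of n] by (simp only: pos_divide_less_eq)
          then show ?thesis using False by (simp add: trunc_def)
        qed
        have "g = c0_functional (\<lambda>n. trunc N b n - b n)"
          by (rule dual_ext) (use gP c0_functional_dual(1)[OF le] in \<open>auto simp: P_dual gunit_seq c0_functional_unit_seq\<close>)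
        then have "nrm (dual (ell1 \<omega>)) g \<le> e/(2*K)" using c0_functional_dual(2)[OF le] by simp
        moreover have "cmod (\<Phi> g) \<le> nrm (dual c0_space) \<Phi> * nrm (dual (ell1 \<omega>)) g"
          using G.dual_bound[OF \<Phi>, of g] gP by (simp add: G_simps)
        moreover have "nrm (dual c0_space) \<Phi> * nrm (dual (ell1 \<omega>)) g \<le> K * (e/(2*K))"
          using calculation(1) K by (intro mult_mono L.dual_nonneg P_dual gP) (auto simp: K_def)
        moreover have "\<Phi> g = \<Phi> (c0_functional (trunc N b)) - \<Phi> f"
          unfolding g_def by (simp add: add sm c0_functional_tr_P P_smult f)
        ultimately show ?thesis using K e by (simp add: field_simps)
      qed
      then show "\<exists>N0. \<forall>N\<ge>N0. cmod (\<Phi> (c0_functional (trunc N b)) - \<Phi> f) < e" by blast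
    qed
    moreover have "(\<lambda>N. \<Phi> (c0_functional (trunc N b))) \<longlonglongrightarrow> f a"
      using dual_eval[OF fc ac] unfolding tr sums_def b_def by (simp add: mult.commute)
    ultimately show ?thesis by (rule LIMSEQ_unique)
  qed
  moreover have "\<Phi> \<in> extensional (c0_predual \<omega>)" using \<Phi> by (simp add: mem_dual_iff[of \<Phi>] G_simps)
  ultimately have "\<Phi> = (\<lambda>f\<in>c0_predual \<omega>. f a)" by (auto simp: extensional_def)
  with ac show ?thesis by blast
qed

lemma kappa_inj: "inj_on (\<lambda>a. \<lambda>f\<in>c0_predual \<omega>. f a) (carrier (ell1 \<omega>))"
proof (rule inj_onI)
  fix a a' assume a: "a \<in> carrier (ell1 \<omega>)" "a' \<in> carrier (ell1 \<omega>)"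
    and eq: "(\<lambda>f\<in>c0_predual \<omega>. f a) = (\<lambda>f\<in>c0_predual \<omega>. f a')"
  have ev: "c0_functional (unit_seq n) x = x n" if "x \<in> carrier (ell1 \<omega>)" for x n
  proof -
    have "(\<lambda>k. x k * unit_seq n k) sums x n"
      using sums_single[of n x] by (rule sums_cong[THEN iffD1, rotated]) (auto simp: unit_seq_def)
    then show ?thesis using that by (simp add: c0_functional_def sums_iff)
  qed
  show "a = a'"
  proof
    show "a n = a' n" for n
      using fun_cong[OF eq, of "c0_functional (unit_seq n)"] a by (simp add: c0_functional_unit_seq_P ev)
  qed
qed

lemma predual_ell1: "predual_of (ell1 \<omega>) (c0_predual \<omega>)"
  unfolding predual_of_def bij_betw_def
  by (intro conjI ballI P_sub P_closed kappa_inj kappa_nrm) (use kappa kappa_surj in blast)+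

lemma regular_simps:
  "carrier (regular_bimodule A) = carrier A" "mult (regular_bimodule A) = mult A" "one (regular_bimodule A) = one A"
  "zero (regular_bimodule A) = zero A" "add (regular_bimodule A) = add A" "smult (regular_bimodule A) = smult A"
  "nrm (regular_bimodule A) = nrm A" "lact (regular_bimodule A) = mult A" "ract (regular_bimodule A) = mult A"
  by (auto simp: regular_bimodule_def nspace.defs)

lemma banach_space_regular: "banach_space A \<Longrightarrow> banach_space (regular_bimodule A)"
  unfolding banach_space_def banach_space_axioms_def normed_space_def normed_space_axioms_def
    Module.module_def abelian_group_def abelian_monoid_def abelian_group_axioms_def module_axioms_def
    comm_group_def group_def group_axioms_def Group.comm_monoid_def comm_monoid_axioms_def Group.monoid_def
    Units_def ndist_def[abs_def] a_minus_def a_inv_def m_inv_def regular_simps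
    partial_object.simps monoid.simps .

lemma dual_regular: "dual (regular_bimodule A) = dual A"
  by (simp add: dual_def bounded_linear_on_def regular_simps)

lemma banach_bimodule_regular: assumes "banach_algebra A"
  shows "banach_bimodule A (regular_bimodule A)"
proof -
  interpret A: banach_algebra A by fact
  have "\<exists>C. \<forall>a\<in>carrier A. \<forall>x\<in>carrier A. nrm A (a \<otimes>\<^bsub>A\<^esub> x) \<le> C * nrm A a * nrm A x \<and>
     nrm A (x \<otimes>\<^bsub>A\<^esub> a) \<le> C * nrm A a * nrm A x"
  proof (intro exI[of _ 1] ballI conjI)
    fix a x assume "a \<in> carrier A" "x \<in> carrier A"
    then show "nrm A (a \<otimes>\<^bsub>A\<^esub> x) \<le> 1 * nrm A a * nrm A x" "nrm A (x \<otimes>\<^bsub>A\<^esub> a) \<le> 1 * nrm A a * nrm A x"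
      using A.nrm_mult[of a x] A.nrm_mult[of x a] by (simp_all add: mult.commute)
  qed
  then show ?thesis
    by (intro banach_bimodule.intro assms banach_space_regular A.banach_space_axioms
        banach_bimodule_axioms.intro)
      (simp_all only: regular_simps A.mult_closed A.mult_assoc A.mult_add_left A.mult_add_right
         A.mult_smult_left A.mult_smult_right)
qed

lemma ell1_dual_banach_algebra: "dual_banach_algebra (ell1 \<omega>) (c0_predual \<omega>)"
proof -
  have act: "(\<lambda>x\<in>carrier (ell1 \<omega>). f (x \<otimes>\<^bsub>ell1 \<omega>\<^esub> a)) \<in> c0_predual \<omega>" (is "?g \<in> _")
    if a: "a \<in> carrier (ell1 \<omega>)" and f: "f \<in> c0_predual \<omega>" for a f
  proof -
    interpret B: banach_algebra "ell1 \<omega>" by (rule ell1_banach_algebra)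
    have fc: "f \<in> carrier (dual (ell1 \<omega>))" using f by (rule P_dual)
    have "cmod (f (x \<otimes>\<^bsub>ell1 \<omega>\<^esub> a)) \<le> (nrm (dual (ell1 \<omega>)) f * nrm (ell1 \<omega>) a) * nrm (ell1 \<omega>) x"
      if x: "x \<in> carrier (ell1 \<omega>)" for x
    proof -
      have "cmod (f (x \<otimes>\<^bsub>ell1 \<omega>\<^esub> a)) \<le> nrm (dual (ell1 \<omega>)) f * nrm (ell1 \<omega>) (x \<otimes>\<^bsub>ell1 \<omega>\<^esub> a)"
        by (rule L.dual_bound[OF fc]) (use ell1_mult x a in auto)
      also have "\<dots> \<le> nrm (dual (ell1 \<omega>)) f * (nrm (ell1 \<omega>) x * nrm (ell1 \<omega>) a)"
        by (rule mult_left_mono[OF _ L.dual_nonneg[OF fc]]) (use ell1_mult x a in auto)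
      finally show ?thesis by (simp add: mult_ac)
    qed
    then have bd: "\<exists>C. \<forall>x\<in>carrier (ell1 \<omega>). cmod (f (x \<otimes>\<^bsub>ell1 \<omega>\<^esub> a)) \<le> C * nrm (ell1 \<omega>) x" by blast
    have g: "?g \<in> carrier (dual (ell1 \<omega>))"
      using fc bd a by (simp add: mem_dual_iff B.mult_closed B.mult_add_left B.mult_smult_left L.smult_c)
    have gunit_seq: "?g (unit_seq n) = a n * f (unit_seq n)" for n
    proof -
      have "unit_seq n \<otimes>\<^bsub>ell1 \<omega>\<^esub> a = a n \<odot>\<^bsub>ell1 \<omega>\<^esub> unit_seq n" by (auto simp: ell1_simps unit_seq_def)
      then show ?thesis using fc by (simp add: unit_seq mem_dual_iff)
    qed
    have "(\<lambda>n. f (unit_seq n) / complex_of_real (\<omega> n)) \<longlonglongrightarrow> 0" using f by (simp add: mem_P_iff c0_inv_def)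
    moreover have "Bfun a sequentially" 
      using ell1_entry'[OF a] by (intro BfunI[of _ "nrm (ell1 \<omega>) a"]) auto
    ultimately have "(\<lambda>n. (f (unit_seq n) / complex_of_real (\<omega> n)) * a n) \<longlonglongrightarrow> 0"
      using bounded_bilinear.Zfun_prod_Bfun[OF bounded_bilinear_mult, of "\<lambda>n. f (unit_seq n) / complex_of_real (\<omega> n)" sequentially a]
      by (simp add: tendsto_Zfun_iff)
    then show ?thesis unfolding mem_P_iff c0_inv_def mem_Collect_eq gunit_seq using g by (simp add: mult.commute)
  qed
  have comm: "(\<lambda>x\<in>carrier (ell1 \<omega>). f (a \<otimes>\<^bsub>ell1 \<omega>\<^esub> x)) = (\<lambda>x\<in>carrier (ell1 \<omega>). f (x \<otimes>\<^bsub>ell1 \<omega>\<^esub> a))"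
    for f :: "(nat \<Rightarrow> complex) \<Rightarrow> complex" and a
    by (simp add: ell1_simps(4) mult.commute)
  have "predual_of (regular_bimodule (ell1 \<omega>)) (c0_predual \<omega>)"
    using predual_ell1 by (simp add: predual_of_def dual_regular regular_simps)
  then show ?thesis
    using ell1_banach_algebra act
    unfolding dual_banach_algebra_def dual_banach_bimodule_def regular_simps
    by (simp add: banach_bimodule_regular comm)
qed

end

theorem weighted_ell1_dual_banach_algebra:
  "weight \<omega> \<Longrightarrow> dual_banach_algebra (ell1 \<omega>) (c0_predual \<omega>)"
  by (rule ell1_dual_banach_algebra) (simp add: weight_def)

end

theory Submission
  imports Defs
begin

text \<open>
  Positive part. The inner derivations into a dual bimodule \<open>E\<close>, evaluated at one fixed \<open>a\<close>, form a
  subspace of \<open>E\<close>. By linear algebra in finitely many coordinates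
  (\<open>finite_interpolation\<close>), \<open>D a\<close> is a weak* limit of elements of this subspace as soon as \<open>D a\<close> is
  killed by every functional \<open>f\<close> of the predual that kills the subspace, that is, by every \<open>f\<close> with
  \<open>f (x \<cdot> a) = f (a \<cdot> x)\<close> for all \<open>x\<close>. The elements of the algebra that commute with \<open>f\<close> in this sense
  form a closed subalgebra. An element \<open>a\<close> of \<open>\<ell>\<^sup>1(\<omega>)\<close> tends to zero, so a polynomial approximation of the
  spectral projections shows that this subalgebra contains, together with \<open>a\<close>, the idempotent
  \<open>\<chi> = 1\<^bsub>{n. a n = \<alpha>}\<^esub>\<close> for each \<open>\<alpha> \<noteq> 0\<close> (\<open>commutes_with_level_indicator\<close>). For an idempotent \<open>\<chi>\<close> the product
  rule gives \<open>\<chi> \<cdot> D \<chi> \<cdot> \<chi> = 0\<close>, and this together with commutation yields \<open>f (D \<chi>) = 0\<close>. Since \<open>a\<close> is the norm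
  limit of combinations of its level idempotents, \<open>f (D a) = 0\<close>.

  Negative part. One bimodule serves all three failures. Adjoin a unit \<open>1\<close>, regarded as a further
  index \<open>\<infinity>\<close>, and consider the weighted \<open>\<ell>\<^sup>1\<close> space of matrices indexed by pairs of indices, which is the
  projective tensor square of the unitization, with the
  coordinate of \<open>1 \<otimes> 1\<close> split off. The derivation \<open>D a = a \<otimes> 1 - 1 \<otimes> a\<close> is implemented by \<open>1 \<otimes> 1\<close>, which
  is missing. If some \<open>x\<close> satisfies \<open>D a = a \<cdot> x - x \<cdot> a\<close> and \<open>a\<close> has no zero, then \<open>x(i,\<infinity>) = 1\<close> for all \<open>i\<close>,
  which is impossible for a summable matrix.

  A net that works for all \<open>a\<close> at once would have to respect every identity
  \<open>f (a \<cdot> x - x \<cdot> a) + g (b \<cdot> x - x \<cdot> b) = x(0,\<infinity>)\<close> with \<open>f\<close>, \<open>g\<close> in the predual. If \<open>f\<close> and \<open>g\<close> live on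
  proper pairs only, the left hand side tends to \<open>f (D a) + g (D b) = 0\<close>, while \<open>x(0,\<infinity>)\<close> tends to \<open>1\<close>.
  Such an identity exists (\<open>obstruction\<close>): let \<open>a\<close> and \<open>b\<close> live on the even and on the odd numbers, and
  let \<open>c\<close> be a matrix whose rows are the even and whose columns are the odd numbers, with all column
  sums \<open>0\<close> and all row sums \<open>0\<close> except the first, which is \<open>-1\<close>. Then \<open>f(i,j) = c(i,j) / a(i)\<close> and
  \<open>g(i,j) = c(i,j) / b(j)\<close> do it, because the contributions of proper pairs cancel and the boundary
  coordinates see only the row and column sums. Such a \<open>c\<close> cannot be absolutely summable, but it can be
  so small that \<open>f\<close> and \<open>g\<close> belong to the predual for suitable summable \<open>a\<close> and \<open>b\<close>: the second
  mixed differences of \<open>u / (u + v)\<close> are of order \<open>1 / (u + v)\<^sup>2\<close>, while \<open>a \<omega>\<close> and \<open>b \<omega>\<close> may decay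
  as slowly as \<open>n powr (- 3/2)\<close>.
\<close>

section \<open>Weak* limits from finitely many functionals\<close>

lemma topspace_wstar: "P \<noteq> {} \<Longrightarrow> topspace (wstar_topology E P) = carrier E"
  unfolding wstar_topology_def topology_generated_by_topspace by auto

lemma openin_wstar_basic: "f \<in> P \<Longrightarrow> open U \<Longrightarrow> openin (wstar_topology E P) {x \<in> carrier E. f x \<in> U}"
  unfolding wstar_topology_def by (rule topology_generated_by_Basis) blast

lemma limitin_wstarI:
  assumes "P \<noteq> {}" "d \<in> carrier E" "\<forall>\<^sub>F x in F. g x \<in> carrier E"
    and lim: "\<And>f. f \<in> P \<Longrightarrow> ((\<lambda>x. f (g x)) \<longlongrightarrow> f d) F"
  shows "limitin (wstar_topology E P) g d F"
  unfolding limitin_def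
proof (intro conjI allI impI)
  show "d \<in> topspace (wstar_topology E P)" using assms by (simp add: topspace_wstar)
  fix U assume "openin (wstar_topology E P) U \<and> d \<in> U"
  then have "generate_topology_on {{x \<in> carrier E. f x \<in> U} | f U. f \<in> P \<and> open U} U" "d \<in> U"
    by (auto simp: wstar_topology_def openin_topology_generated_by_iff)
  then show "\<forall>\<^sub>F x in F. g x \<in> U"
  proof (induction rule: generate_topology_on.induct)
    case (Int U V)
    then show ?case by (auto intro: eventually_conj)
  next
    case (UN K)
    then obtain k where k: "k \<in> K" "d \<in> k" by blast
    with UN have "\<forall>\<^sub>F x in F. g x \<in> k" by blast
    then show ?case by (rule eventually_mono) (use k in blast)
  next
    case (Basis B)
    then obtain f U where B: "B = {x \<in> carrier E. f x \<in> U}" "f \<in> P" "open U" by blast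
    then have "\<forall>\<^sub>F x in F. f (g x) \<in> U" using lim[OF B(2)] Basis by (auto simp: tendsto_def)
    then show ?case using assms(3) by eventually_elim (auto simp: B)
  qed auto
qed

lemma limitin_wstarD:
  assumes "limitin (wstar_topology E P) g d F" "f \<in> P" "d \<in> carrier E"
  shows "((\<lambda>x. f (g x)) \<longlongrightarrow> f d) F"
  unfolding tendsto_def
proof (intro allI impI)
  fix U assume "open U" "f d \<in> U"
  then have "\<forall>\<^sub>F x in F. g x \<in> {x \<in> carrier E. f x \<in> U}"
    using assms openin_wstar_basic[OF assms(2), of U E] unfolding limitin_def by blast
  then show "\<forall>\<^sub>F x in F. f (g x) \<in> U" by (rule eventually_mono) auto
qed

lemma continuous_map_wstar:
  assumes "PA \<noteq> {}" "P \<noteq> {}" "T \<in> carrier A \<rightarrow> carrier E"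
    and "\<And>f. f \<in> P \<Longrightarrow> (\<lambda>a\<in>carrier A. f (T a)) \<in> PA"
  shows "continuous_map (wstar_topology A PA) (wstar_topology E P) T"
  unfolding wstar_topology_def[of E]
proof (rule continuous_on_generated_topo)
  fix U assume "U \<in> {{x \<in> carrier E. f x \<in> U} | f U. f \<in> P \<and> open U}"
  then obtain f V where U: "U = {x \<in> carrier E. f x \<in> V}" "f \<in> P" "open V" by blast
  have "T -` U \<inter> topspace (wstar_topology A PA) = {a \<in> carrier A. (\<lambda>a\<in>carrier A. f (T a)) a \<in> V}"
    using assms by (auto simp: U topspace_wstar)
  then show "openin (wstar_topology A PA) (T -` U \<inter> topspace (wstar_topology A PA))"
    by (simp only: openin_wstar_basic[OF assms(4)[OF U(2)] U(3)])
next
  show "T ` topspace (wstar_topology A PA) \<subseteq> \<Union> {{x \<in> carrier E. f x \<in> U} | f U. f \<in> P \<and> open U}"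
    using assms(1-3) by (auto simp: topspace_wstar) blast
qed

context normed_space
begin

lemma submodule_dualD:
  assumes P: "submodule P complex_field (dual E)"
  shows "f \<in> P \<Longrightarrow> f \<in> carrier (dual E)" "P \<noteq> {}"
    "f \<in> P \<Longrightarrow> g \<in> P \<Longrightarrow> f \<oplus>\<^bsub>dual E\<^esub> c \<odot>\<^bsub>dual E\<^esub> g \<in> P"
proof -
  interpret D: normed_space "dual E" by (rule dual_normed_space)
  note s = D.submoduleE[OF P]
  show "f \<in> P \<Longrightarrow> f \<in> carrier (dual E)" "P \<noteq> {}" using s(1,2) by auto
  show "f \<in> P \<Longrightarrow> g \<in> P \<Longrightarrow> f \<oplus>\<^bsub>dual E\<^esub> c \<odot>\<^bsub>dual E\<^esub> g \<in> P" using s(4)[of c g] s(5) by simp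
qed

text \<open>The finite-dimensional form of the Hahn--Banach theorem: finitely many functionals cannot
  distinguish \<open>d\<close> from the range of \<open>T\<close> unless a combination of them kills the range but not \<open>d\<close>. The
  proof is Gaussian elimination on the functionals.\<close>

lemma finite_interpolation:
  assumes P: "submodule P complex_field (dual E)" and d: "d \<in> carrier E"
    and T: "T \<in> carrier E \<rightarrow> carrier E"
      "\<And>x y. x \<in> carrier E \<Longrightarrow> y \<in> carrier E \<Longrightarrow> T (x \<oplus>\<^bsub>E\<^esub> y) = T x \<oplus>\<^bsub>E\<^esub> T y"
      "\<And>c x. x \<in> carrier E \<Longrightarrow> T (c \<odot>\<^bsub>E\<^esub> x) = c \<odot>\<^bsub>E\<^esub> T x"
    and sep: "\<And>f. f \<in> P \<Longrightarrow> (\<And>x. x \<in> carrier E \<Longrightarrow> f (T x) = 0) \<Longrightarrow> f d = 0"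
    and F: "finite F" "F \<subseteq> P"
  shows "\<exists>x\<in>carrier E. \<forall>f\<in>F. f (T x) = f d"
  using F
proof (induction "card F" arbitrary: F rule: less_induct)
  case less
  have dual: "f \<in> carrier (dual E)" if "f \<in> P" for f using submodule_dualD(1)[OF P that] .
  have Tc: "T x \<in> carrier E" if "x \<in> carrier E" for x using T(1) that by auto
  show ?case
  proof (cases "\<forall>f\<in>F. \<forall>x\<in>carrier E. f (T x) = 0")
    case True
    then have "f (T \<zero>\<^bsub>E\<^esub>) = f d" if "f \<in> F" for f using sep[of f] that less by auto
    then show ?thesis by blast
  next
    case False
    then obtain f0 y where f0: "f0 \<in> F" and y: "y \<in> carrier E" and nz: "f0 (T y) \<noteq> 0" by blast
    have f0P: "f0 \<in> P" using f0 less by blast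
    define r where "r f = f (T y) / f0 (T y)" for f
    \<comment> \<open>subtracting multiples of \<open>f0\<close> makes all other functionals vanish at \<open>T y\<close>\<close>
    define red where "red f = f \<oplus>\<^bsub>dual E\<^esub> (- r f) \<odot>\<^bsub>dual E\<^esub> f0" for f
    have red: "red f z = f z - r f * f0 z" if "z \<in> carrier E" for f z
      using that by (simp add: red_def dual_simps(3,4))
    have "card (red ` (F - {f0})) < card F"
      using card_image_le[of "F - {f0}" red] card_Diff1_less[OF less(2) f0] less by simp
    moreover have "red ` (F - {f0}) \<subseteq> P"
      using less f0P submodule_dualD(3)[OF P] by (auto simp: red_def)
    ultimately obtain x where x: "x \<in> carrier E" "\<And>f. f \<in> F - {f0} \<Longrightarrow> red f (T x) = red f d"
      using less(1)[of "red ` (F - {f0})"] less(2) by auto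
    define t where "t = (f0 d - f0 (T x)) / f0 (T y)"
    define z where "z = x \<oplus>\<^bsub>E\<^esub> t \<odot>\<^bsub>E\<^esub> y"
    have fz: "f (T z) = f (T x) + t * f (T y)" if "f \<in> P" for f
      using dual[OF that] x y by (simp add: z_def T smult_c Tc mem_dual_iff)
    have "f (T z) = f d" if f: "f \<in> F" for f
    proof (cases "f = f0")
      case True
      then show ?thesis using fz[OF f0P] nz by (simp add: t_def)
    next
      case False
      have "f (T x) - r f * f0 (T x) = f d - r f * f0 d"
        using x(2)[of f] False f by (simp add: red x d Tc)
      moreover have "t * f (T y) = r f * f0 d - r f * f0 (T x)"
        by (simp add: t_def r_def right_diff_distrib diff_divide_distrib mult.commute)
      moreover have "f (T z) = f (T x) + t * f (T y)" using fz f less by blast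
      ultimately show ?thesis by (metis (no_types) add_diff_eq diff_add_cancel diff_add_eq)
    qed
    moreover have "z \<in> carrier E" using x y by (simp add: z_def smult_c)
    ultimately show ?thesis by blast
  qed
qed

text \<open>The net is indexed by the finite subsets of the predual, each of which is interpolated exactly.\<close>

lemma wstar_limit_of_range:
  assumes P: "submodule P complex_field (dual E)" and d: "d \<in> carrier E"
    and T: "T \<in> carrier E \<rightarrow> carrier E"
      "\<And>x y. x \<in> carrier E \<Longrightarrow> y \<in> carrier E \<Longrightarrow> T (x \<oplus>\<^bsub>E\<^esub> y) = T x \<oplus>\<^bsub>E\<^esub> T y"
      "\<And>c x. x \<in> carrier E \<Longrightarrow> T (c \<odot>\<^bsub>E\<^esub> x) = c \<odot>\<^bsub>E\<^esub> T x"
    and sep: "\<And>f. f \<in> P \<Longrightarrow> (\<And>x. x \<in> carrier E \<Longrightarrow> f (T x) = 0) \<Longrightarrow> f d = 0"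
  shows "\<exists>F. F \<noteq> bot \<and> (\<forall>\<^sub>F x in F. x \<in> carrier E) \<and> limitin (wstar_topology E P) T d F"
proof -
  have "\<exists>x\<in>carrier E. \<forall>f\<in>F. f (T x) = f d" if "finite F" "F \<subseteq> P" for F
    by (rule finite_interpolation[OF P d T]) (use sep that in auto)
  then obtain X where
    X: "\<And>F. finite F \<Longrightarrow> F \<subseteq> P \<Longrightarrow> X F \<in> carrier E \<and> (\<forall>f\<in>F. f (T (X F)) = f d)" by metis
  define N where "N = filtermap X (finite_subsets_at_top P)"
  have carr: "\<forall>\<^sub>F x in N. x \<in> carrier E"
    unfolding N_def eventually_filtermap eventually_finite_subsets_at_top
    by (rule exI[of _ "{}"]) (use X in auto)
  have "limitin (wstar_topology E P) T d N"
  proof (rule limitin_wstarI[OF submodule_dualD(2)[OF P] d])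
    show "\<forall>\<^sub>F x in N. T x \<in> carrier E" using carr by (rule eventually_mono) (use T(1) in auto)
    show "((\<lambda>x. f (T x)) \<longlongrightarrow> f d) N" if f: "f \<in> P" for f
    proof (rule tendsto_eventually)
      show "\<forall>\<^sub>F x in N. f (T x) = f d"
        unfolding N_def eventually_filtermap eventually_finite_subsets_at_top
        by (rule exI[of _ "{f}"]) (use X f in auto)
    qed
  qed
  moreover have "N \<noteq> bot" by (simp add: N_def filtermap_bot_iff)
  ultimately show ?thesis using carr by blast
qed

end

section \<open>Functionals commuting with an element\<close>

lemma suminf_tendsto_dominated:
  fixes a :: "nat \<Rightarrow> nat \<Rightarrow> complex"
  assumes "\<And>k. (\<lambda>n. a k n) \<longlonglongrightarrow> b k" "\<And>k n. cmod (a k n) \<le> M k" "summable M"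
  shows "(\<lambda>n. \<Sum>k. a k n) \<longlonglongrightarrow> (\<Sum>k. b k)"
proof -
  have "\<forall>\<^sub>F (k, n) in at_top \<times>\<^sub>F sequentially. cmod (a k n) \<le> M k"
    by (rule always_eventually) (use assms(2) in auto)
  from tannerys_theorem[OF assms(1) this assms(3)] show ?thesis by simp
qed

text \<open>For a functional \<open>f\<close> this says \<open>a \<cdot> f = f \<cdot> a\<close> in the dual module, or that \<open>f\<close> annihilates the values at \<open>a\<close> of all inner
  derivations.\<close>

definition commutes_with :: "('a, 'e) bimodule \<Rightarrow> ('e \<Rightarrow> complex) \<Rightarrow> 'a \<Rightarrow> bool" where
  "commutes_with E f a \<longleftrightarrow> (\<forall>x\<in>carrier E. f (ract E x a) = f (lact E a x))"

context banach_bimodule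
begin

lemma act_functional_dual:
  assumes f: "f \<in> carrier (dual E)" and x: "x \<in> carrier E"
  shows "(\<lambda>a\<in>carrier A. f (lact E a x)) \<in> carrier (dual A)"
    "(\<lambda>a\<in>carrier A. f (ract E x a)) \<in> carrier (dual A)"
proof -
  obtain C where C: "\<And>a x. a \<in> carrier A \<Longrightarrow> x \<in> carrier E \<Longrightarrow>
    nrm E (lact E a x) \<le> C * nrm A a * nrm E x \<and> nrm E (ract E x a) \<le> C * nrm A a * nrm E x"
    by (rule exE[OF act_bounded]) blast
  define K where "K = nrm (dual E) f * C * nrm E x"
  have "cmod (f (lact E a x)) \<le> K * nrm A a \<and> cmod (f (ract E x a)) \<le> K * nrm A a"
    if a: "a \<in> carrier A" for a
  proof -
    have "nrm (dual E) f * nrm E (lact E a x) \<le> nrm (dual E) f * (C * nrm A a * nrm E x)"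
      "nrm (dual E) f * nrm E (ract E x a) \<le> nrm (dual E) f * (C * nrm A a * nrm E x)"
      using C[OF a x] by (auto intro: mult_left_mono E.dual_nonneg[OF f])
    then show ?thesis
      using E.dual_bound[OF f lact_closed[OF a x]] E.dual_bound[OF f ract_closed[OF a x]]
      by (simp add: K_def mult_ac)
  qed
  then have b: "\<exists>K. \<forall>a\<in>carrier A. cmod (f (lact E a x)) \<le> K * nrm A a"
    "\<exists>K. \<forall>a\<in>carrier A. cmod (f (ract E x a)) \<le> K * nrm A a" by blast+
  have lin: "f (y \<oplus>\<^bsub>E\<^esub> z) = f y + f z" "f (c \<odot>\<^bsub>E\<^esub> y) = c * f y"
    if "y \<in> carrier E" "z \<in> carrier E" for y z c
    using f that by (auto simp: mem_dual_iff)
  show "(\<lambda>a\<in>carrier A. f (lact E a x)) \<in> carrier (dual A)"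
    "(\<lambda>a\<in>carrier A. f (ract E x a)) \<in> carrier (dual A)"
    using x b unfolding mem_dual_iff
    by (simp_all add: add_lact add_ract smult_lact smult_ract lact_closed ract_closed A.smult_c lin)
qed

lemma inner_der_linear:
  assumes a: "a \<in> carrier A"
  shows "(\<lambda>x. inner_der E x a) \<in> carrier E \<rightarrow> carrier E"
    "x \<in> carrier E \<Longrightarrow> y \<in> carrier E \<Longrightarrow>
       inner_der E (x \<oplus>\<^bsub>E\<^esub> y) a = inner_der E x a \<oplus>\<^bsub>E\<^esub> inner_der E y a"
    "x \<in> carrier E \<Longrightarrow> inner_der E (c \<odot>\<^bsub>E\<^esub> x) a = c \<odot>\<^bsub>E\<^esub> inner_der E x a"
proof -
  note cl = lact_closed[OF a] ract_closed[OF a]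
  show "(\<lambda>x. inner_der E x a) \<in> carrier E \<rightarrow> carrier E" using cl by auto
  show "inner_der E (x \<oplus>\<^bsub>E\<^esub> y) a = inner_der E x a \<oplus>\<^bsub>E\<^esub> inner_der E y a"
    if xy: "x \<in> carrier E" "y \<in> carrier E"
  proof -
    have "inner_der E (x \<oplus>\<^bsub>E\<^esub> y) a =
      (lact E a x \<oplus>\<^bsub>E\<^esub> lact E a y) \<oplus>\<^bsub>E\<^esub> ((-1) \<odot>\<^bsub>E\<^esub> ract E x a \<oplus>\<^bsub>E\<^esub> (-1) \<odot>\<^bsub>E\<^esub> ract E y a)"
      using xy cl a E.smult_r_distr[of "-1" "ract E x a" "ract E y a"]
      by (simp add: lact_add ract_add E.minus_eq_smult)
    also have "\<dots> = inner_der E x a \<oplus>\<^bsub>E\<^esub> inner_der E y a"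
      using xy cl by (simp add: E.minus_eq_smult E.smult_c E.M.a_ac)
    finally show ?thesis .
  qed
  show "inner_der E (c \<odot>\<^bsub>E\<^esub> x) a = c \<odot>\<^bsub>E\<^esub> inner_der E x a" if x: "x \<in> carrier E"
  proof -
    have "inner_der E (c \<odot>\<^bsub>E\<^esub> x) a = c \<odot>\<^bsub>E\<^esub> lact E a x \<oplus>\<^bsub>E\<^esub> (-1) \<odot>\<^bsub>E\<^esub> (c \<odot>\<^bsub>E\<^esub> ract E x a)"
      using x cl a by (simp add: lact_smult ract_smult E.minus_eq_smult E.smult_c)
    also have "(-1) \<odot>\<^bsub>E\<^esub> (c \<odot>\<^bsub>E\<^esub> ract E x a) = c \<odot>\<^bsub>E\<^esub> ((-1) \<odot>\<^bsub>E\<^esub> ract E x a)"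
      using E.smult_assoc1[of c "-1" "ract E x a"] E.smult_assoc1[of "-1" c "ract E x a"] cl(2)[OF x]
      by simp
    finally show ?thesis
      using E.smult_r_distr[of c "lact E a x" "(-1) \<odot>\<^bsub>E\<^esub> ract E x a"] cl[OF x]
      by (simp add: E.minus_eq_smult E.smult_c)
  qed
qed

lemma functional_inner_der:
  assumes "f \<in> carrier (dual E)" "a \<in> carrier A" "x \<in> carrier E"
  shows "f (inner_der E x a) = f (lact E a x) - f (ract E x a)"
  using assms by (simp add: E.minus_eq_smult lact_closed ract_closed E.smult_c mem_dual_iff)

lemma commutes_with_mult:
  assumes "a \<in> carrier A" "b \<in> carrier A" "commutes_with E f a" "commutes_with E f b"
  shows "commutes_with E f (a \<otimes>\<^bsub>A\<^esub> b)"
  unfolding commutes_with_def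
proof
  fix x assume x: "x \<in> carrier E"
  have "f (ract E x (a \<otimes>\<^bsub>A\<^esub> b)) = f (lact E b (ract E x a))"
    using assms x by (simp add: ract_mult commutes_with_def ract_closed)
  also have "\<dots> = f (lact E a (lact E b x))"
    using assms x by (simp add: lact_ract commutes_with_def lact_closed)
  finally show "f (ract E x (a \<otimes>\<^bsub>A\<^esub> b)) = f (lact E (a \<otimes>\<^bsub>A\<^esub> b) x)"
    using assms x by (simp add: lact_mult)
qed

lemma commutes_with_add:
  assumes "a \<in> carrier A" "b \<in> carrier A" "commutes_with E f a" "commutes_with E f b"
    and "f \<in> carrier (dual E)"
  shows "commutes_with E f (a \<oplus>\<^bsub>A\<^esub> b)"
  using assms by (simp add: commutes_with_def add_lact add_ract mem_dual_iff lact_closed ract_closed)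

lemma commutes_with_smult:
  assumes "a \<in> carrier A" "commutes_with E f a" "f \<in> carrier (dual E)"
  shows "commutes_with E f (c \<odot>\<^bsub>A\<^esub> a)"
  using assms by (simp add: commutes_with_def smult_lact smult_ract mem_dual_iff lact_closed ract_closed)

text \<open>Applied to the value \<open>d = D e\<close> of a derivation. Multiplying the equation by \<open>e\<close> from the left gives
  \<open>e \<cdot> d \<cdot> e = 0\<close>; moving one factor \<open>e\<close> through \<open>f\<close> turns this into \<open>f (e \<cdot> d) = 0\<close>, and moving it once more
  into \<open>f (d \<cdot> e) = 0\<close>.\<close>

lemma commuting_functional_kills_idempotent:
  assumes f: "f \<in> carrier (dual E)" and d: "d \<in> carrier E"
    and e: "e \<in> carrier A" "e \<otimes>\<^bsub>A\<^esub> e = e" "commutes_with E f e"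
    and eq: "d = ract E d e \<oplus>\<^bsub>E\<^esub> lact E e d"
  shows "f d = 0"
proof -
  have add: "f (x \<oplus>\<^bsub>E\<^esub> y) = f x + f y" if "x \<in> carrier E" "y \<in> carrier E" for x y
    using f that by (simp add: mem_dual_iff)
  have "lact E e d = lact E e (ract E d e) \<oplus>\<^bsub>E\<^esub> lact E e (lact E e d)"
    using lact_add[OF e(1) ract_closed[OF e(1) d] lact_closed[OF e(1) d]] eq by simp
  also have "lact E e (lact E e d) = lact E e d"
    using lact_mult[of e e "d"] e d by simp
  finally have "f (lact E e (ract E d e)) = 0"
    using add[of "lact E e (ract E d e)" "lact E e d"] e d by (simp add: lact_closed ract_closed)
  then have "f (ract E (lact E e d) e) = 0" using e d by (simp add: lact_ract)
  then have "f (lact E e (lact E e d)) = 0"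
    using e d by (simp add: commutes_with_def lact_closed)
  then have z: "f (lact E e d) = 0"
    using lact_mult[of e e "d"] e d by simp
  moreover have "f (ract E d e) = f (lact E e d)" using e d by (simp add: commutes_with_def)
  ultimately show ?thesis
    using add[of "ract E d e" "lact E e d"] eq e d by (simp add: lact_closed ract_closed)
qed

end

lemma ell1_finite_level:
  assumes w1: "\<And>n. 1 \<le> \<omega> n" and a: "a \<in> carrier (ell1 \<omega>)" and c: "0 < c"
  shows "finite {n. c \<le> cmod (a n)}"
proof -
  have "(\<lambda>n. cmod (a n) * \<omega> n) \<longlonglongrightarrow> 0"
    using a by (auto simp: ell1_simps intro: summable_LIMSEQ_zero)
  then have "\<forall>\<^sub>F n in sequentially. cmod (a n) * \<omega> n < c" using c by (rule order_tendstoD)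
  then have "\<forall>\<^sub>F n in cofinite. \<not> c \<le> cmod (a n)"
    unfolding cofinite_eq_sequentially
  proof eventually_elim
    case (elim n)
    have "cmod (a n) * 1 \<le> cmod (a n) * \<omega> n" by (rule mult_left_mono[OF w1]) simp
    then show ?case using elim by simp
  qed
  then show ?thesis by (simp add: eventually_cofinite)
qed

locale ell1_bimodule = banach_bimodule "ell1 \<omega>" E
  for \<omega> :: "nat \<Rightarrow> real" and E :: "(nat \<Rightarrow> complex, 'e) bimodule" +
  assumes w1: "\<And>n. 1 \<le> \<omega> n"
begin

text \<open>Commutation with \<open>f\<close> is the vanishing, for each \<open>x\<close>, of a bounded functional on the algebra, and bounded functionals
  on \<open>\<ell>\<^sup>1(\<omega>)\<close> respect dominated pointwise convergence.\<close>

lemma commutes_with_limit: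
  assumes f: "f \<in> carrier (dual E)"
    and c: "\<And>k. c k \<in> carrier (ell1 \<omega>)" "\<And>k. commutes_with E f (c k)"
    and b: "b \<in> carrier (ell1 \<omega>)" "\<And>n. (\<lambda>k. c k n) \<longlonglongrightarrow> b n"
    and M: "M \<in> carrier (ell1 \<omega>)" "\<And>k n. cmod (c k n) \<le> cmod (M n)"
  shows "commutes_with E f b"
  unfolding commutes_with_def
proof
  fix x assume x: "x \<in> carrier E"
  have lim: "(\<lambda>k. g (c k)) \<longlonglongrightarrow> g b" if g: "g \<in> carrier (dual (ell1 \<omega>))" for g
  proof -
    define K where "K = nrm (dual (ell1 \<omega>)) g"
    have gu: "cmod (g (unit_seq n)) \<le> K * \<omega> n" for n
      using A.dual_bound[OF g unit_seq(1)] unit_seq(2)[OF w1] w1 by (simp add: K_def)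
    have "(\<lambda>k. \<Sum>n. c k n * g (unit_seq n)) \<longlonglongrightarrow> (\<Sum>n. b n * g (unit_seq n))"
    proof (rule suminf_tendsto_dominated)
      show "cmod (c k n * g (unit_seq n)) \<le> K * (cmod (M n) * \<omega> n)" for n k
        using mult_mono[OF M(2)[of k n] gu[of n]] by (simp add: norm_mult mult_ac)
      show "summable (\<lambda>n. K * (cmod (M n) * \<omega> n))"
        using M(1) by (auto simp: ell1_simps intro: summable_mult)
    qed (intro tendsto_intros b)
    then show ?thesis
      using dual_eval[OF w1 g] b(1) c(1) by (simp add: sums_iff)
  qed
  have "(\<lambda>k. f (lact E (c k) x)) \<longlonglongrightarrow> f (lact E b x)" "(\<lambda>k. f (ract E x (c k))) \<longlonglongrightarrow> f (ract E x b)"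
    using lim[OF act_functional_dual(1)[OF f x]] lim[OF act_functional_dual(2)[OF f x]] b c by simp_all
  then show "f (ract E x b) = f (lact E b x)"
    using c(2) x by (simp add: commutes_with_def LIMSEQ_unique)
qed

context
  fixes f :: "'e \<Rightarrow> complex" and a :: "nat \<Rightarrow> complex" and \<alpha> :: complex
  assumes f: "f \<in> carrier (dual E)" and a: "a \<in> carrier (ell1 \<omega>)" "commutes_with E f a" and \<alpha>: "\<alpha> \<noteq> 0"
begin

lemma commutes_with_power:
  "(\<lambda>n. (a n / \<alpha>) ^ Suc k) \<in> carrier (ell1 \<omega>) \<and> commutes_with E f (\<lambda>n. (a n / \<alpha>) ^ Suc k)"
proof (induction k)
  case 0
  have "(\<lambda>n. (a n / \<alpha>) ^ Suc 0) = (1 / \<alpha>) \<odot>\<^bsub>ell1 \<omega>\<^esub> a" by (simp add: ell1_simps)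
  then show ?case using commutes_with_smult[OF a f, of "1/\<alpha>"] A.smult_c[OF a(1)] by simp
next
  case (Suc k)
  have "(\<lambda>n. (a n / \<alpha>) ^ Suc (Suc k)) = (1 / \<alpha>) \<odot>\<^bsub>ell1 \<omega>\<^esub> (a \<otimes>\<^bsub>ell1 \<omega>\<^esub> (\<lambda>n. (a n / \<alpha>) ^ Suc k))"
    by (simp add: ell1_simps)
  moreover have "a \<otimes>\<^bsub>ell1 \<omega>\<^esub> (\<lambda>n. (a n / \<alpha>) ^ Suc k) \<in> carrier (ell1 \<omega>)"
    "commutes_with E f (a \<otimes>\<^bsub>ell1 \<omega>\<^esub> (\<lambda>n. (a n / \<alpha>) ^ Suc k))"
    using Suc a f by (blast intro: A.mult_closed commutes_with_mult)+
  ultimately show ?case using f by (simp only: A.smult_c commutes_with_smult)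
qed

text \<open>The first factor has no constant term in \<open>a\<close>, so the product is a polynomial in \<open>a\<close> that makes sense in
  the algebra, which has no unit.\<close>

lemma commutes_with_factors:
  assumes "finite Z" "\<alpha> \<notin> Z"
  shows "(\<lambda>n. (a n / \<alpha>) ^ Suc k * (\<Prod>\<mu>\<in>Z. (a n - \<mu>) / (\<alpha> - \<mu>))) \<in> carrier (ell1 \<omega>) \<and>
    commutes_with E f (\<lambda>n. (a n / \<alpha>) ^ Suc k * (\<Prod>\<mu>\<in>Z. (a n - \<mu>) / (\<alpha> - \<mu>)))"
  using assms
proof (induction Z)
  case empty
  then show ?case using commutes_with_power by simp
next
  case (insert \<mu> Z)
  define c where "c = (\<lambda>n. (a n / \<alpha>) ^ Suc k * (\<Prod>\<mu>\<in>Z. (a n - \<mu>) / (\<alpha> - \<mu>)))"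
  have c: "c \<in> carrier (ell1 \<omega>)" "commutes_with E f c" using insert by (auto simp: c_def)
  have "(\<lambda>n. (a n / \<alpha>) ^ Suc k * (\<Prod>\<mu>\<in>insert \<mu> Z. (a n - \<mu>) / (\<alpha> - \<mu>))) =
     (1 / (\<alpha> - \<mu>)) \<odot>\<^bsub>ell1 \<omega>\<^esub> (c \<otimes>\<^bsub>ell1 \<omega>\<^esub> a \<oplus>\<^bsub>ell1 \<omega>\<^esub> (- \<mu>) \<odot>\<^bsub>ell1 \<omega>\<^esub> c)"
  proof
    fix n
    have "(a n / \<alpha>) ^ Suc k * (\<Prod>\<mu>\<in>insert \<mu> Z. (a n - \<mu>) / (\<alpha> - \<mu>)) = c n * ((a n - \<mu>) / (\<alpha> - \<mu>))"
      using insert by (simp add: c_def mult_ac)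
    then show "(a n / \<alpha>) ^ Suc k * (\<Prod>\<mu>\<in>insert \<mu> Z. (a n - \<mu>) / (\<alpha> - \<mu>)) =
      ((1 / (\<alpha> - \<mu>)) \<odot>\<^bsub>ell1 \<omega>\<^esub> (c \<otimes>\<^bsub>ell1 \<omega>\<^esub> a \<oplus>\<^bsub>ell1 \<omega>\<^esub> (- \<mu>) \<odot>\<^bsub>ell1 \<omega>\<^esub> c)) n"
      by (simp add: ell1_simps right_diff_distrib diff_divide_distrib mult.commute)
  qed
  then show ?case using a c f
    by (simp add: A.mult_closed A.smult_c commutes_with_add commutes_with_mult commutes_with_smult)
qed

text \<open>The polynomials \<open>(z/\<alpha>)\<^sup>k\<^sup>+\<^sup>1 \<Prod>\<^sub>\<mu> (z - \<mu>) / (\<alpha> - \<mu>)\<close>, with \<open>\<mu>\<close> ranging over the finitely many values of \<open>a\<close>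
  other than \<open>\<alpha>\<close> that are at least \<open>|\<alpha>|/2\<close> in modulus, are \<open>1\<close> at \<open>\<alpha>\<close>, vanish at the other large values
  and tend to \<open>0\<close> geometrically at the small ones. Applied to \<open>a\<close> they converge to the indicator, dominated by a
  multiple of \<open>a\<close>.\<close>

lemma commutes_with_level_indicator:
  "(\<lambda>n. if a n = \<alpha> then 1 else 0) \<in> carrier (ell1 \<omega>)"
  "commutes_with E f (\<lambda>n. if a n = \<alpha> then 1 else 0)"
proof -
  define \<epsilon> :: "nat \<Rightarrow> complex" where "\<epsilon> = (\<lambda>n. if a n = \<alpha> then 1 else 0)"
  have M: "(\<lambda>n. c * a n) \<in> carrier (ell1 \<omega>)" for c
    using A.smult_c[OF a(1)] by (simp add: ell1_simps)
  have fin: "finite {n. cmod \<alpha> / 2 \<le> cmod (a n)}"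
    by (rule ell1_finite_level[OF w1 a(1)]) (use \<alpha> in auto)
  have "finite {n. a n = \<alpha>}"
    by (rule finite_subset[OF _ fin]) auto
  then obtain N where "\<And>n. a n = \<alpha> \<Longrightarrow> n < N"
    unfolding finite_nat_iff_bounded by blast
  then have \<epsilon>: "\<epsilon> \<in> carrier (ell1 \<omega>)"
    by (intro fin_supp(1)[OF w1, of N]) (force simp: \<epsilon>_def)
  define Z where "Z = a ` {n. cmod \<alpha> / 2 \<le> cmod (a n)} - {\<alpha>}"
  have Z: "finite Z" "\<alpha> \<notin> Z" using fin by (auto simp: Z_def)
  define q where "q n = (\<Prod>\<mu>\<in>Z. (a n - \<mu>) / (\<alpha> - \<mu>))" for n
  define K where "K = (\<Prod>\<mu>\<in>Z. (nrm (ell1 \<omega>) a + cmod \<mu>) / cmod (\<alpha> - \<mu>))"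
  have K: "cmod (q n) \<le> K" for n
    unfolding q_def K_def prod_norm[symmetric]
  proof (intro prod_mono conjI)
    fix \<mu>
    have "cmod (a n - \<mu>) \<le> nrm (ell1 \<omega>) a + cmod \<mu>"
      using ell1_entry'[OF w1 a(1), of n] norm_triangle_ineq4[of "a n" \<mu>] by linarith
    then show "cmod ((a n - \<mu>) / (\<alpha> - \<mu>)) \<le> (nrm (ell1 \<omega>) a + cmod \<mu>) / cmod (\<alpha> - \<mu>)"
      by (simp add: norm_divide divide_right_mono)
  qed auto
  have q1: "q n = 1" if "a n = \<alpha>" for n
    using that Z by (auto simp: q_def intro!: prod.neutral)
  have q0: "q n = 0" if "a n \<noteq> \<alpha>" "cmod \<alpha> / 2 \<le> cmod (a n)" for n
    using that Z by (auto simp: q_def Z_def intro!: prod_zero)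
  have small: "cmod (a n / \<alpha>) \<le> 1 / 2" if "\<not> cmod \<alpha> / 2 \<le> cmod (a n)" for n
    using that \<alpha> by (simp add: norm_divide field_simps)
  have "commutes_with E f \<epsilon>"
  proof (rule commutes_with_limit[OF f])
    show "(\<lambda>n. (a n / \<alpha>) ^ Suc k * q n) \<in> carrier (ell1 \<omega>)"
      "commutes_with E f (\<lambda>n. (a n / \<alpha>) ^ Suc k * q n)" for k
      using commutes_with_factors[OF Z] by (auto simp: q_def)
    show "(\<lambda>k. (a n / \<alpha>) ^ Suc k * q n) \<longlonglongrightarrow> \<epsilon> n" for n
    proof -
      consider "a n = \<alpha>" | "a n \<noteq> \<alpha>" "cmod \<alpha> / 2 \<le> cmod (a n)" | "a n \<noteq> \<alpha>" "\<not> cmod \<alpha> / 2 \<le> cmod (a n)"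
        by blast
      then show ?thesis
      proof cases
        case 3
        have "(\<lambda>k. (a n / \<alpha>) ^ Suc k) \<longlonglongrightarrow> 0"
          by (rule LIMSEQ_Suc, rule LIMSEQ_power_zero) (use small[OF 3(2)] in linarith)
        from tendsto_mult_right[OF this, of "q n"] show ?thesis
          using 3(1) by (simp only: \<epsilon>_def if_False mult_zero_left)
      qed (use q1 q0 \<alpha> in \<open>auto simp: \<epsilon>_def\<close>)
    qed
    show "cmod ((a n / \<alpha>) ^ Suc k * q n) \<le> cmod (complex_of_real (K / cmod \<alpha>) * a n)" for k n
    proof (cases "q n = 0")
      case False
      then have "cmod (a n / \<alpha>) \<le> 1"
        using q0[of n] small[of n] \<alpha> by (cases "a n = \<alpha>") fastforce+
      then have "cmod (a n / \<alpha>) ^ k \<le> 1" by (intro power_le_one) auto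
      then have "cmod (a n / \<alpha>) * cmod (a n / \<alpha>) ^ k \<le> cmod (a n / \<alpha>) * 1"
        by (intro mult_left_mono) auto
      then have "cmod ((a n / \<alpha>) ^ Suc k) \<le> cmod (a n / \<alpha>)"
        by (simp only: norm_mult norm_power power_Suc mult_1_right)
      then have "cmod ((a n / \<alpha>) ^ Suc k) * cmod (q n) \<le> cmod (a n / \<alpha>) * K"
        by (rule mult_mono[OF _ K]) auto
      also have "\<dots> \<le> cmod (complex_of_real (K / cmod \<alpha>) * a n)"
        using K[of n] by (simp add: norm_mult norm_divide mult.commute order_trans[OF norm_ge_zero])
      finally show ?thesis by (simp only: norm_mult)
    qed auto
  qed (rule \<epsilon> M)+
  then show "(\<lambda>n. if a n = \<alpha> then 1 else 0) \<in> carrier (ell1 \<omega>)"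
    "commutes_with E f (\<lambda>n. if a n = \<alpha> then 1 else 0)" using \<epsilon> by (simp_all add: \<epsilon>_def)
qed

end

text \<open>The functional \<open>f \<circ> D\<close> vanishes on each level idempotent of \<open>a\<close>. Cutting \<open>a\<close> off below \<open>1/(k+1)\<close> leaves a finite
  combination of level idempotents, and these cut-offs converge to \<open>a\<close> in norm.\<close>

lemma commuting_functional_kills_derivation:
  assumes f: "f \<in> carrier (dual E)" and D: "derivation (ell1 \<omega>) E D"
    and a: "a \<in> carrier (ell1 \<omega>)" "commutes_with E f a"
  shows "f (D a) = 0"
proof -
  define h where "h = (\<lambda>a\<in>carrier (ell1 \<omega>). f (D a))"
  have Dc: "D b \<in> carrier E" if "b \<in> carrier (ell1 \<omega>)" for b
    using D that by (auto simp: derivation_def bounded_linear_on_def)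
  obtain C where "\<forall>b\<in>carrier (ell1 \<omega>). nrm E (D b) \<le> C * nrm (ell1 \<omega>) b"
    using D unfolding derivation_def bounded_linear_on_def by blast
  then have C: "nrm E (D b) \<le> C * nrm (ell1 \<omega>) b" if "b \<in> carrier (ell1 \<omega>)" for b
    using that by blast
  have "cmod (f (D b)) \<le> (nrm (dual E) f * C) * nrm (ell1 \<omega>) b" if "b \<in> carrier (ell1 \<omega>)" for b
    using E.dual_bound[OF f Dc[OF that]] mult_left_mono[OF C[OF that] E.dual_nonneg[OF f]] by (simp add: mult_ac)
  then have "\<exists>K. \<forall>b\<in>carrier (ell1 \<omega>). cmod (f (D b)) \<le> K * nrm (ell1 \<omega>) b" by blast
  then have h: "h \<in> carrier (dual (ell1 \<omega>))"
    using D f unfolding mem_dual_iff derivation_def bounded_linear_on_def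
    by (simp add: h_def A.smult_c Dc)
  define g where "g n = h (unit_seq n)" for n
  have level: "finite {n. a n = \<alpha>} \<and> (\<Sum>n | a n = \<alpha>. g n) = 0" if \<alpha>: "\<alpha> \<noteq> 0" for \<alpha>
  proof -
    note e = commutes_with_level_indicator[OF f a \<alpha>]
    have fin: "finite {n. a n = \<alpha>}"
      by (rule finite_subset[OF _ ell1_finite_level[OF w1 a(1), of "cmod \<alpha>"]]) (use \<alpha> in auto)
    have "f (D (\<lambda>n. if a n = \<alpha> then 1 else 0)) = 0"
    proof (rule commuting_functional_kills_idempotent[OF f Dc[OF e(1)] e(1) _ e(2)])
      show "(\<lambda>n. if a n = \<alpha> then 1 else 0) \<otimes>\<^bsub>ell1 \<omega>\<^esub> (\<lambda>n. if a n = \<alpha> then 1 else 0) =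
        (\<lambda>n. if a n = \<alpha> then 1 else 0)" by (auto simp: ell1_simps)
      then show "D (\<lambda>n. if a n = \<alpha> then 1 else 0) =
        ract E (D (\<lambda>n. if a n = \<alpha> then 1 else 0)) (\<lambda>n. if a n = \<alpha> then 1 else 0) \<oplus>\<^bsub>E\<^esub>
        lact E (\<lambda>n. if a n = \<alpha> then 1 else 0) (D (\<lambda>n. if a n = \<alpha> then 1 else 0))"
        using D e(1) unfolding derivation_def by metis
    qed
    then have "(\<lambda>n. (if a n = \<alpha> then 1 else 0) * g n) sums 0"
      using dual_eval[OF w1 h e(1)] e(1) by (simp add: h_def[of] g_def)
    moreover have "(\<lambda>n. if n \<in> {n. a n = \<alpha>} then g n else 0) sums (\<Sum>n | a n = \<alpha>. g n)"
      by (rule sums_If_finite_set[OF fin])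
    ultimately show ?thesis using fin by (auto simp: if_distrib[of "\<lambda>x. x * _"] cong: if_cong dest: sums_unique2)
  qed
  define S where "S k = {n. 1 / real (Suc k) \<le> cmod (a n)}" for k
  have Sfin: "finite (S k)" for k unfolding S_def by (rule ell1_finite_level[OF w1 a(1)]) simp
  have "(\<Sum>n\<in>S k. a n * g n) = 0" for k
  proof -
    have "(\<Sum>n\<in>S k. a n * g n) = (\<Sum>\<alpha>\<in>a ` S k. \<Sum>n | n \<in> S k \<and> a n = \<alpha>. a n * g n)"
      by (rule sum.image_gen[OF Sfin])
    also have "\<dots> = (\<Sum>\<alpha>\<in>a ` S k. \<alpha> * (\<Sum>n | a n = \<alpha>. g n))"
    proof (rule sum.cong[OF refl])
      fix \<alpha> assume "\<alpha> \<in> a ` S k"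
      then have "{n. n \<in> S k \<and> a n = \<alpha>} = {n. a n = \<alpha>}" by (auto simp: S_def)
      then show "(\<Sum>n | n \<in> S k \<and> a n = \<alpha>. a n * g n) = \<alpha> * (\<Sum>n | a n = \<alpha>. g n)"
        by (simp add: sum_distrib_left)
    qed
    also have "\<dots> = 0"
    proof (rule sum.neutral, rule ballI)
      fix \<alpha> assume "\<alpha> \<in> a ` S k"
      then have "\<alpha> \<noteq> 0" by (auto simp: S_def)
      then show "\<alpha> * (\<Sum>n | a n = \<alpha>. g n) = 0" using level by simp
    qed
    finally show ?thesis .
  qed
  then have part: "(\<Sum>n. if n \<in> S k then a n * g n else 0) = 0" for k
    using sums_If_finite_set[OF Sfin, of k "\<lambda>n. a n * g n"] by (simp add: sums_iff)
  define K where "K = nrm (dual (ell1 \<omega>)) h"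
  have gu: "cmod (g n) \<le> K * \<omega> n" for n
    using A.dual_bound[OF h unit_seq(1)] unit_seq(2)[OF w1] w1 by (simp add: K_def g_def)
  have "(\<lambda>k. \<Sum>n. if n \<in> S k then a n * g n else 0) \<longlonglongrightarrow> (\<Sum>n. a n * g n)"
  proof (rule suminf_tendsto_dominated)
    show "cmod (if n \<in> S k then a n * g n else 0) \<le> K * (cmod (a n) * \<omega> n)" for n k
    proof -
      have "cmod (a n * g n) \<le> K * (cmod (a n) * \<omega> n)"
        using mult_left_mono[OF gu[of n], of "cmod (a n)"] by (simp add: norm_mult mult_ac)
      then show ?thesis using order_trans[OF norm_ge_zero] by auto
    qed
    show "summable (\<lambda>n. K * (cmod (a n) * \<omega> n))"
      using a(1) by (auto simp: ell1_simps intro: summable_mult)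
    show "(\<lambda>k. if n \<in> S k then a n * g n else 0) \<longlonglongrightarrow> a n * g n" for n
    proof (cases "a n = 0")
      case False
      then have "\<forall>\<^sub>F k in sequentially. 1 / real (Suc k) < cmod (a n)"
        using order_tendstoD(2)[OF LIMSEQ_Suc[OF lim_1_over_n], of "cmod (a n)"] by simp
      then have "\<forall>\<^sub>F k in sequentially. (if n \<in> S k then a n * g n else 0) = a n * g n"
        by (rule eventually_mono) (simp add: S_def)
      then show ?thesis by (rule tendsto_eventually)
    qed (simp cong: if_cong)
  qed
  then have "(\<Sum>n. a n * g n) = 0" unfolding part by (simp add: LIMSEQ_const_iff)
  then show ?thesis using dual_eval[OF w1 h a(1)] a(1) by (simp add: h_def g_def sums_iff)
qed

end

theorem ell1_pointwise_wstar_approx_Connes_amenable: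
  assumes w1: "\<And>n. 1 \<le> \<omega> n"
  shows "pointwise_wstar_approx_Connes_amenable TYPE('e) (ell1 \<omega>) (c0_predual \<omega>)"
  unfolding pointwise_wstar_approx_Connes_amenable_def
proof (intro ballI allI impI)
  fix a and E :: "(nat \<Rightarrow> complex, 'e) bimodule" and P D
  assume a: "a \<in> carrier (ell1 \<omega>)"
    and "normal_dual_bimodule (ell1 \<omega>) (c0_predual \<omega>) E P \<and>
      wstar_derivation (ell1 \<omega>) (c0_predual \<omega>) E P D"
  then have E: "banach_bimodule (ell1 \<omega>) E" and P: "submodule P complex_field (dual E)"
    and D: "derivation (ell1 \<omega>) E D"
    by (auto simp: normal_dual_bimodule_def dual_banach_bimodule_def predual_of_def wstar_derivation_def)
  interpret ell1_bimodule \<omega> E using E w1 by (simp add: ell1_bimodule_def ell1_bimodule_axioms_def)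
  have Da: "D a \<in> carrier E" using D a by (auto simp: derivation_def bounded_linear_on_def)
  show "\<exists>F. F \<noteq> bot \<and> (\<forall>\<^sub>F x in F. x \<in> carrier E) \<and>
    limitin (wstar_topology E P) (\<lambda>x. inner_der E x a) (D a) F"
  proof (rule E.wstar_limit_of_range[OF P Da inner_der_linear[OF a]])
    fix f assume "f \<in> P" and z: "\<And>x. x \<in> carrier E \<Longrightarrow> f (inner_der E x a) = 0"
    then have f: "f \<in> carrier (dual E)" using E.submodule_dualD(1)[OF P] by blast
    have "commutes_with E f a"
      using z functional_inner_der[OF f a] by (simp add: commutes_with_def)
    then show "f (D a) = 0" by (rule commuting_functional_kills_derivation[OF f D a])
  qed
qed

section \<open>One-sided actions on weighted sequences\<close>

lemma unit_seq_apply: "unit_seq n k = (if k = n then 1 else 0)"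
  using unit_seq_def[of "\<lambda>_. 1" n] by simp

lemma dual_small_on_support:
  assumes w1: "\<And>n. 1 \<le> \<omega> n" and f: "f \<in> carrier (dual (ell1 \<omega>))" and z: "z \<in> carrier (ell1 \<omega>)"
    and C: "0 \<le> C" "\<And>n. z n \<noteq> 0 \<Longrightarrow> cmod (f (unit_seq n)) \<le> C * \<omega> n"
  shows "cmod (f z) \<le> C * nrm (ell1 \<omega>) z"
proof -
  define b where "b n = (if z n = 0 then 0 else f (unit_seq n))" for n
  have b: "cmod (b n) \<le> C * \<omega> n" for n
    using C w1[of n] by (auto simp: b_def)
  have "(\<lambda>n. z n * b n) = (\<lambda>n. z n * f (unit_seq n))" by (auto simp: b_def)
  then have "f z = c0_functional \<omega> b z"
    using dual_eval[OF w1 f z] z by (simp add: c0_functional_def[OF w1] sums_iff)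
  then show ?thesis using c0_functional_summable(2)[OF w1 z b] by simp
qed

text \<open>Dominated convergence reduces the limit along \<open>u\<close> to the limits along the unit sequences.\<close>

lemma functionals_tendsto_zero:
  fixes g :: "nat \<Rightarrow> (nat \<Rightarrow> complex) \<Rightarrow> complex"
  assumes w1: "\<And>n. 1 \<le> \<omega> n" and v1: "\<And>n. 1 \<le> (v n :: real)" and u: "u \<in> carrier (ell1 \<omega>)"
    and g: "\<And>j. g j \<in> carrier (dual (ell1 \<omega>))"
    and bound: "\<And>i j. cmod (g j (unit_seq i)) \<le> K * \<omega> i * v j"
    and lim: "\<And>i. (\<lambda>j. g j (unit_seq i) / complex_of_real (v j)) \<longlonglongrightarrow> 0"
  shows "(\<lambda>j. g j u / complex_of_real (v j)) \<longlonglongrightarrow> 0"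
proof -
  have v0: "0 < v j" for j using v1[of j] by linarith
  have "(\<lambda>j. \<Sum>i. u i * (g j (unit_seq i) / complex_of_real (v j))) \<longlonglongrightarrow> (\<Sum>i. u i * 0)"
  proof (rule suminf_tendsto_dominated)
    show "summable (\<lambda>i. K * (cmod (u i) * \<omega> i))"
      using u by (auto simp: ell1_simps intro: summable_mult)
    show "cmod (u i * (g j (unit_seq i) / complex_of_real (v j))) \<le> K * (cmod (u i) * \<omega> i)" for i j
    proof -
      have "cmod (g j (unit_seq i) / complex_of_real (v j)) \<le> K * \<omega> i"
        using bound[where i = i and j = j] v0[of j] by (simp add: norm_divide pos_divide_le_eq)
      from mult_left_mono[OF this, of "cmod (u i)"] show ?thesis
        by (simp only: norm_mult mult_ac norm_ge_zero simp_thms)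
    qed
  qed (intro tendsto_intros lim)
  moreover have "(\<Sum>i. u i * (g j (unit_seq i) / complex_of_real (v j))) = g j u / complex_of_real (v j)" for j
    using sums_divide[OF dual_eval[OF w1 g[of j] u], of "complex_of_real (v j)"] by (simp add: sums_iff)
  ultimately show ?thesis by simp
qed

text \<open>Indices are shifted by one to make room for the index \<open>\<infinity>\<close> of the adjoined unit, which becomes
  \<open>0\<close>. Elements of the algebra vanish there.\<close>

definition ext_seq :: "(nat \<Rightarrow> complex) \<Rightarrow> nat \<Rightarrow> complex" where
  "ext_seq a s = (case s of 0 \<Rightarrow> 0 | Suc i \<Rightarrow> a i)"

definition ext_weight :: "(nat \<Rightarrow> real) \<Rightarrow> nat \<Rightarrow> real" where
  "ext_weight \<omega> s = (case s of 0 \<Rightarrow> 1 | Suc i \<Rightarrow> \<omega> i)"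

lemma ext_seq_simps [simp]: "ext_seq a 0 = 0" "ext_seq a (Suc i) = a i"
  by (simp_all add: ext_seq_def)

lemma ext_weight_simps [simp]: "ext_weight \<omega> 0 = 1" "ext_weight \<omega> (Suc i) = \<omega> i"
  by (simp_all add: ext_weight_def)

text \<open>Let \<open>n\<close> stand for a pair of indices, \<open>p n\<close> for the component on which \<open>a\<close> acts and \<open>q n\<close> for the
  pair in which this component is replaced by \<open>\<infinity>\<close>. Since \<open>\<delta>\<^sub>k \<cdot> 1 = \<delta>\<^sub>k\<close>, the coordinate of \<open>a \<cdot> x\<close> at
  \<open>n\<close> collects \<open>x n\<close> and \<open>x (q n)\<close>. The condition \<open>c\<close> selects the pairs that receive the second term.\<close>

definition half_act ::
  "(nat \<Rightarrow> nat) \<Rightarrow> (nat \<Rightarrow> nat) \<Rightarrow> (nat \<Rightarrow> bool) \<Rightarrow> (nat \<Rightarrow> complex) \<Rightarrow> (nat \<Rightarrow> complex) \<Rightarrow> nat \<Rightarrow> complex" where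
  "half_act p q c a x = (\<lambda>n. ext_seq a (p n) * (x n + (if c n then x (q n) else 0)))"

lemma ext_seq_linear:
  "ext_seq (\<lambda>n. a n + b n) s = ext_seq a s + ext_seq b s"
  "ext_seq (\<lambda>n. k * a n) s = k * ext_seq a s"
  "ext_seq (\<lambda>n. a n * b n) s = ext_seq a s * ext_seq b s"
  by (cases s; simp)+

lemma half_act_linear:
  "half_act p q c a (\<lambda>n. x n + y n) = (\<lambda>n. half_act p q c a x n + half_act p q c a y n)"
  "half_act p q c a (\<lambda>n. k * x n) = (\<lambda>n. k * half_act p q c a x n)"
  "half_act p q c (\<lambda>n. a n + b n) x = (\<lambda>n. half_act p q c a x n + half_act p q c b x n)"
  "half_act p q c (\<lambda>n. k * a n) x = (\<lambda>n. k * half_act p q c a x n)"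
  by (auto simp: half_act_def ext_seq_linear fun_eq_iff algebra_simps)

text \<open>With \<open>inj\<close>, a pair is determined by its two parts, so sums over pairs are bounded by product sums.
  The two order conditions ensure that a pair is large whenever one of its parts is, which
  gives \<open>c\<^sub>0\<close> conditions on coefficients separately in each part.\<close>

locale index_action =
  fixes \<omega> W :: "nat \<Rightarrow> real" and p q :: "nat \<Rightarrow> nat"
  assumes w1: "\<And>n. 1 \<le> \<omega> n" and W1: "\<And>n. 1 \<le> W n"
    and inj: "\<And>n n'. p n = p n' \<Longrightarrow> q n = q n' \<Longrightarrow> n = n'"
    and weight: "\<And>n. W n = ext_weight \<omega> (p n) * W (q n)"
    and p_le: "\<And>n. p n \<le> n" and q_le: "\<And>n. q n \<le> n"
begin

lemma ext_seq_le: "a \<in> carrier (ell1 \<omega>) \<Longrightarrow> cmod (ext_seq a s) \<le> nrm (ell1 \<omega>) a"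
  using ell1_entry'[OF w1] ell1_nonneg[OF w1] by (cases s) auto

lemma ext_seq_sum_le:
  assumes a: "a \<in> carrier (ell1 \<omega>)"
  shows "(\<Sum>s<N. cmod (ext_seq a s) * ext_weight \<omega> s) \<le> nrm (ell1 \<omega>) a"
proof (cases N)
  case (Suc M)
  have w0: "0 \<le> \<omega> n" for n using w1[of n] by simp
  have "(\<Sum>n<M. cmod (a n) * \<omega> n) \<le> nrm (ell1 \<omega>) a"
    using a w0 unfolding ell1_simps by (intro sum_le_suminf) auto
  then show ?thesis unfolding Suc sum.lessThan_Suc_shift by simp
qed (use ell1_nonneg[OF w1 a] in simp)

lemma half_act_bound:
  assumes a: "a \<in> carrier (ell1 \<omega>)" and x: "x \<in> carrier (ell1 W)"
  shows "half_act p q c a x \<in> carrier (ell1 W)"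
    "nrm (ell1 W) (half_act p q c a x) \<le> 2 * nrm (ell1 \<omega>) a * nrm (ell1 W) x"
proof -
  let ?A = "nrm (ell1 \<omega>) a" and ?X = "nrm (ell1 W) x"
  have W0: "0 \<le> W n" for n using W1[of n] by simp
  have w0: "0 \<le> ext_weight \<omega> s" for s using w1 order_trans[OF zero_le_one] by (cases s) auto
  have A0: "0 \<le> ?A" by (rule ell1_nonneg[OF w1 a])
  have xN: "(\<Sum>n<N. cmod (x n) * W n) \<le> ?X" for N
    using x W0 unfolding ell1_simps by (intro sum_le_suminf) auto
  have "(\<Sum>n<N. cmod (half_act p q c a x n) * W n) \<le> 2 * ?A * ?X" for N
  proof -
    let ?u = "\<lambda>s. cmod (ext_seq a s) * ext_weight \<omega> s" and ?v = "\<lambda>m. cmod (x m) * W m"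
    have le: "cmod (half_act p q c a x n) * W n \<le> ?A * ?v n + ?u (p n) * ?v (q n)" for n
    proof -
      have "cmod (half_act p q c a x n) \<le> cmod (ext_seq a (p n)) * (cmod (x n) + cmod (x (q n)))"
        unfolding half_act_def norm_mult
        by (intro mult_left_mono order_trans[OF norm_triangle_ineq]) auto
      then have "cmod (half_act p q c a x n) * W n \<le>
          cmod (ext_seq a (p n)) * (cmod (x n) + cmod (x (q n))) * W n"
        by (rule mult_right_mono[OF _ W0])
      also have "\<dots> = cmod (ext_seq a (p n)) * ?v n + ?u (p n) * ?v (q n)"
        using weight[of n] by (simp add: algebra_simps)
      also have "\<dots> \<le> ?A * ?v n + ?u (p n) * ?v (q n)"
        by (intro add_right_mono mult_right_mono ext_seq_le a mult_nonneg_nonneg W0) auto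
      finally show ?thesis .
    qed
    have "(\<Sum>n<N. ?u (p n) * ?v (q n)) = (\<Sum>(s,m)\<in>(\<lambda>n. (p n, q n)) ` {..<N}. ?u s * ?v m)"
      by (subst sum.reindex) (auto simp: inj_on_def intro: inj)
    also have "\<dots> \<le> (\<Sum>(s,m)\<in>{..<N} \<times> {..<N}. ?u s * ?v m)"
      by (rule sum_mono2) (use p_le q_le w0 W0 in \<open>auto intro: le_less_trans\<close>)
    also have "\<dots> = (\<Sum>s<N. ?u s) * (\<Sum>m<N. ?v m)"
      by (simp add: sum_product sum.cartesian_product)
    also have "\<dots> \<le> ?A * ?X"
      by (intro mult_mono ext_seq_sum_le a xN A0 sum_nonneg mult_nonneg_nonneg W0) auto
    finally have second: "(\<Sum>n<N. ?u (p n) * ?v (q n)) \<le> ?A * ?X" .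
    have "(\<Sum>n<N. cmod (half_act p q c a x n) * W n) \<le> (\<Sum>n<N. ?A * ?v n + ?u (p n) * ?v (q n))"
      by (intro sum_mono le)
    also have "\<dots> = ?A * (\<Sum>n<N. ?v n) + (\<Sum>n<N. ?u (p n) * ?v (q n))"
      by (simp add: sum.distrib sum_distrib_left)
    also have "\<dots> \<le> ?A * ?X + ?A * ?X"
      by (intro add_mono second mult_left_mono xN A0)
    finally show ?thesis by (simp add: mult_ac)
  qed
  from ell1_boundedI[OF W1 this] show "half_act p q c a x \<in> carrier (ell1 W)"
    "nrm (ell1 W) (half_act p q c a x) \<le> 2 * ?A * ?X" by simp_all
qed

context
  fixes f :: "(nat \<Rightarrow> complex) \<Rightarrow> complex" and c :: "nat \<Rightarrow> bool"
  assumes f: "f \<in> carrier (dual (ell1 W))"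
begin

lemma functional_half_act_bound:
  assumes "a \<in> carrier (ell1 \<omega>)" "x \<in> carrier (ell1 W)"
  shows "cmod (f (half_act p q c a x)) \<le> 2 * nrm (dual (ell1 W)) f * nrm (ell1 \<omega>) a * nrm (ell1 W) x"
proof -
  interpret L: normed_space "ell1 W" by (rule ell1_normed[OF W1])
  show ?thesis
    using L.dual_bound[OF f half_act_bound(1)[OF assms, of c]]
      mult_left_mono[OF half_act_bound(2)[OF assms, of c] L.dual_nonneg[OF f]] by (simp add: mult_ac)
qed

lemma functional_linear:
  "x \<in> carrier (ell1 W) \<Longrightarrow> y \<in> carrier (ell1 W) \<Longrightarrow> f (\<lambda>n. x n + y n) = f x + f y"
  "x \<in> carrier (ell1 W) \<Longrightarrow> f (\<lambda>n. k * x n) = k * f x"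
  using f by (auto simp: mem_dual_iff ell1_simps(2-6))

lemma half_act_dual_left:
  assumes x: "x \<in> carrier (ell1 W)"
  shows "(\<lambda>a\<in>carrier (ell1 \<omega>). f (half_act p q c a x)) \<in> carrier (dual (ell1 \<omega>))"
proof -
  have "\<exists>C. \<forall>a\<in>carrier (ell1 \<omega>). cmod (f (half_act p q c a x)) \<le> C * nrm (ell1 \<omega>) a"
    by (rule exI[of _ "2 * nrm (dual (ell1 W)) f * nrm (ell1 W) x"])
      (use functional_half_act_bound[OF _ x] in \<open>simp add: mult_ac\<close>)
  then show ?thesis
    using ell1_add[OF w1] ell1_smult[OF w1] half_act_bound(1)[OF _ x]
    unfolding mem_dual_iff ell1_simps(2-5) by (simp add: half_act_linear functional_linear)
qed

lemma half_act_dual_right: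
  assumes a: "a \<in> carrier (ell1 \<omega>)"
  shows "(\<lambda>x\<in>carrier (ell1 W). f (half_act p q c a x)) \<in> carrier (dual (ell1 W))"
proof -
  have "\<exists>C. \<forall>x\<in>carrier (ell1 W). cmod (f (half_act p q c a x)) \<le> C * nrm (ell1 W) x"
    by (rule exI[of _ "2 * nrm (dual (ell1 W)) f * nrm (ell1 \<omega>) a"])
      (use functional_half_act_bound[OF a] in \<open>simp add: mult_ac\<close>)
  then show ?thesis
    using ell1_add[OF W1] ell1_smult[OF W1] half_act_bound(1)[OF a]
    unfolding mem_dual_iff ell1_simps(2-5) by (simp add: half_act_linear functional_linear)
qed

end

lemma half_act_unit_support:
  assumes "half_act p q c (unit_seq k) (unit_seq m) n \<noteq> 0"
  shows "k \<le> n" "m \<le> n"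
proof -
  have "ext_seq (unit_seq k) (p n) \<noteq> 0" and *: "n = m \<or> q n = m"
    using assms by (auto simp: half_act_def unit_seq_apply split: if_splits)
  then have "p n = Suc k" by (cases "p n") (auto simp: unit_seq_apply split: if_splits)
  then show "k \<le> n" using p_le[of n] by simp
  show "m \<le> n" using * q_le[of n] by auto
qed

context
  fixes f :: "(nat \<Rightarrow> complex) \<Rightarrow> complex" and c :: "nat \<Rightarrow> bool"
  assumes f: "f \<in> c0_predual W"
begin

text \<open>The product \<open>\<delta>\<^sub>k \<cdot> e\<^sub>m\<close> is supported beyond both \<open>k\<close> and \<open>m\<close>, where the coefficients of \<open>f\<close> are small
  relative to \<open>W\<close>. So the double array of its values is negligible in each of the two indices.\<close>

lemma half_act_unit_small:
  assumes e: "0 < e"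
  obtains N where "\<And>k m. N \<le> k \<or> N \<le> m \<Longrightarrow>
    cmod (f (half_act p q c (unit_seq k) (unit_seq m))) \<le> e * \<omega> k * W m"
proof -
  have fd: "f \<in> carrier (dual (ell1 W))" using f by (rule P_dual[OF W1])
  have "(\<lambda>n. f (unit_seq n) / complex_of_real (W n)) \<longlonglongrightarrow> 0"
    using f by (simp add: mem_P_iff[OF W1] c0_inv_def)
  from LIMSEQ_D[OF this, of "e/2"] e obtain N
    where N: "\<And>n. N \<le> n \<Longrightarrow> cmod (f (unit_seq n) / complex_of_real (W n)) < e/2" by auto
  have small: "cmod (f (unit_seq n)) \<le> e/2 * W n" if "N \<le> n" for n
    using N[OF that] W1[of n] by (simp add: norm_divide divide_less_eq)
  have "cmod (f (half_act p q c (unit_seq k) (unit_seq m))) \<le> e * \<omega> k * W m" if "N \<le> k \<or> N \<le> m" for k m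
  proof -
    let ?z = "half_act p q c (unit_seq k) (unit_seq m)"
    note u = unit_seq[OF w1, where n = k] unit_seq[OF W1, where n = m]
    have "cmod (f ?z) \<le> e/2 * nrm (ell1 W) ?z"
    proof (rule dual_small_on_support[OF W1 fd half_act_bound(1)[OF u(1,3)]])
      show "cmod (f (unit_seq n)) \<le> e/2 * W n" if "?z n \<noteq> 0" for n
        using half_act_unit_support[OF that] \<open>N \<le> k \<or> N \<le> m\<close> by (intro small) linarith
    qed (use e in auto)
    also have "\<dots> \<le> e/2 * (2 * \<omega> k * W m)"
      using half_act_bound(2)[OF u(1,3), of c] e u by (intro mult_left_mono) auto
    finally show ?thesis by simp
  qed
  then show ?thesis by (rule that)
qed

lemma half_act_unit_bound:
  "cmod (f (half_act p q c (unit_seq k) (unit_seq m))) \<le> 2 * nrm (dual (ell1 W)) f * \<omega> k * W m"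
  using functional_half_act_bound[OF P_dual[OF W1 f], of "unit_seq k" "unit_seq m" c]
    unit_seq[OF w1, where n = k] unit_seq[OF W1, where n = m] by simp

text \<open>Weak* continuity of the action in the algebra variable.\<close>

lemma half_act_predual_left:
  assumes x: "x \<in> carrier (ell1 W)"
  shows "(\<lambda>a\<in>carrier (ell1 \<omega>). f (half_act p q c a x)) \<in> c0_predual \<omega>"
proof -
  have fd: "f \<in> carrier (dual (ell1 W))" using f by (rule P_dual[OF W1])
  define g where "g k = (\<lambda>x\<in>carrier (ell1 W). f (half_act p q c (unit_seq k) x))" for k
  have gu: "g k (unit_seq m) = f (half_act p q c (unit_seq k) (unit_seq m))" for k m
    using unit_seq(1)[OF W1] by (simp add: g_def)
  have "(\<lambda>k. g k x / complex_of_real (\<omega> k)) \<longlonglongrightarrow> 0"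
  proof (rule functionals_tendsto_zero[OF W1 w1 x])
    show "g k \<in> carrier (dual (ell1 W))" for k
      unfolding g_def by (rule half_act_dual_right[OF fd unit_seq(1)[OF w1]])
    show "cmod (g k (unit_seq m)) \<le> (2 * nrm (dual (ell1 W)) f) * W m * \<omega> k" for m k
      using half_act_unit_bound[of k m] by (simp add: gu mult_ac)
    show "(\<lambda>k. g k (unit_seq m) / complex_of_real (\<omega> k)) \<longlonglongrightarrow> 0" for m
    proof (rule LIMSEQ_I)
      fix r :: real assume r: "0 < r"
      have Wm: "0 < W m" using W1[of m] by linarith
      obtain N where N: "\<And>k m'. N \<le> k \<or> N \<le> m' \<Longrightarrow>
        cmod (f (half_act p q c (unit_seq k) (unit_seq m'))) \<le> r / (2 * W m) * \<omega> k * W m'"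
        using half_act_unit_small[of "r / (2 * W m)"] r Wm by auto
      have "cmod (g k (unit_seq m) / complex_of_real (\<omega> k) - 0) < r" if "N \<le> k" for k
      proof -
        have wk: "0 < \<omega> k" using w1[of k] by linarith
        have "cmod (g k (unit_seq m)) \<le> r / 2 * \<omega> k" using N[of k m] that Wm by (simp add: gu)
        then have "cmod (g k (unit_seq m) / complex_of_real (\<omega> k)) \<le> r / 2"
          using wk by (simp add: norm_divide divide_le_eq)
        then show ?thesis using r by simp
      qed
      then show "\<exists>N. \<forall>k\<ge>N. cmod (g k (unit_seq m) / complex_of_real (\<omega> k) - 0) < r" by blast
    qed
  qed
  then show ?thesis
    using half_act_dual_left[OF fd x] x unit_seq(1)[OF w1]
    by (simp add: mem_P_iff[OF w1] c0_inv_def g_def)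
qed

text \<open>Invariance of the predual under the dual action.\<close>

lemma half_act_predual_right:
  assumes a: "a \<in> carrier (ell1 \<omega>)"
  shows "(\<lambda>x\<in>carrier (ell1 W). f (half_act p q c a x)) \<in> c0_predual W"
proof -
  have fd: "f \<in> carrier (dual (ell1 W))" using f by (rule P_dual[OF W1])
  define g where "g m = (\<lambda>a\<in>carrier (ell1 \<omega>). f (half_act p q c a (unit_seq m)))" for m
  have gu: "g m (unit_seq k) = f (half_act p q c (unit_seq k) (unit_seq m))" for k m
    using unit_seq(1)[OF w1] by (simp add: g_def)
  have "(\<lambda>m. g m a / complex_of_real (W m)) \<longlonglongrightarrow> 0"
  proof (rule functionals_tendsto_zero[OF w1 W1 a])
    show "g m \<in> carrier (dual (ell1 \<omega>))" for m
      unfolding g_def by (rule half_act_dual_left[OF fd unit_seq(1)[OF W1]])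
    show "cmod (g m (unit_seq k)) \<le> (2 * nrm (dual (ell1 W)) f) * \<omega> k * W m" for m k
      using half_act_unit_bound[of k m] by (simp add: gu mult_ac)
    show "(\<lambda>m. g m (unit_seq k) / complex_of_real (W m)) \<longlonglongrightarrow> 0" for k
    proof (rule LIMSEQ_I)
      fix r :: real assume r: "0 < r"
      have wk: "0 < \<omega> k" using w1[of k] by linarith
      obtain N where N: "\<And>k' m. N \<le> k' \<or> N \<le> m \<Longrightarrow>
        cmod (f (half_act p q c (unit_seq k') (unit_seq m))) \<le> r / (2 * \<omega> k) * \<omega> k' * W m"
        using half_act_unit_small[of "r / (2 * \<omega> k)"] r wk by auto
      have "cmod (g m (unit_seq k) / complex_of_real (W m) - 0) < r" if "N \<le> m" for m
      proof -
        have Wm: "0 < W m" using W1[of m] by linarith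
        have "cmod (g m (unit_seq k)) \<le> r / 2 * W m" using N[where k' = k and m = m] that wk by (simp add: gu)
        then have "cmod (g m (unit_seq k) / complex_of_real (W m)) \<le> r / 2"
          using Wm by (simp add: norm_divide divide_le_eq)
        then show ?thesis using r by simp
      qed
      then show "\<exists>N. \<forall>m\<ge>N. cmod (g m (unit_seq k) / complex_of_real (W m) - 0) < r" by blast
    qed
  qed
  then show ?thesis
    using half_act_dual_right[OF fd a] a unit_seq(1)[OF W1]
    by (simp add: mem_P_iff[OF W1] c0_inv_def g_def)
qed

end

end

section \<open>The tensor square of the unitization without its unit\<close>

lemma c0_predual_nonempty: "(\<And>n. 1 \<le> \<omega> n) \<Longrightarrow> c0_predual \<omega> \<noteq> {}"
  using c0_functional_tr_P[of \<omega>] by blast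

text \<open>A Banach space becomes a bimodule record by adding two actions; none of the space axioms sees them.\<close>

definition with_actions :: "'e nspace \<Rightarrow> ('a \<Rightarrow> 'e \<Rightarrow> 'e) \<Rightarrow> ('e \<Rightarrow> 'a \<Rightarrow> 'e) \<Rightarrow> ('a, 'e) bimodule" where
  "with_actions X l r = nspace.extend X \<lparr>lact = l, ract = r\<rparr>"

lemma with_actions_simps [simp]:
  "carrier (with_actions X l r) = carrier X" "mult (with_actions X l r) = mult X"
  "one (with_actions X l r) = one X" "zero (with_actions X l r) = zero X"
  "add (with_actions X l r) = add X" "smult (with_actions X l r) = smult X"
  "nrm (with_actions X l r) = nrm X" "lact (with_actions X l r) = l" "ract (with_actions X l r) = r"
  by (auto simp: with_actions_def nspace.defs)

lemma banach_space_with_actions: "banach_space X \<Longrightarrow> banach_space (with_actions X l r)"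
  unfolding banach_space_def banach_space_axioms_def normed_space_def normed_space_axioms_def
    Module.module_def abelian_group_def abelian_monoid_def abelian_group_axioms_def module_axioms_def
    comm_group_def group_def group_axioms_def Group.comm_monoid_def comm_monoid_axioms_def Group.monoid_def
    Units_def ndist_def[abs_def] a_minus_def a_inv_def m_inv_def with_actions_simps
    partial_object.simps monoid.simps .

lemma dual_with_actions: "dual (with_actions X l r) = dual X"
  by (simp add: dual_def bounded_linear_on_def)

lemma predual_of_with_actions: "predual_of X P \<Longrightarrow> predual_of (with_actions X l r) P"
  by (simp add: predual_of_def dual_with_actions)

text \<open>The space of matrices is coded as a space of sequences, the entry \<open>(s,t)\<close> being stored at
  \<open>prod_encode (s,t)\<close>, with \<open>0\<close> in the role of \<open>\<infinity>\<close>. The maps \<open>row_end\<close> and \<open>col_end\<close> lead to the boundary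
  entries \<open>(s,\<infinity>)\<close> and \<open>(\<infinity>,t)\<close>.\<close>

definition row :: "nat \<Rightarrow> nat" where "row n = fst (prod_decode n)"
definition col :: "nat \<Rightarrow> nat" where "col n = snd (prod_decode n)"
definition row_end :: "nat \<Rightarrow> nat" where "row_end n = prod_encode (row n, 0)"
definition col_end :: "nat \<Rightarrow> nat" where "col_end n = prod_encode (0, col n)"

lemma row_col_simps [simp]:
  "row (prod_encode (s, t)) = s" "col (prod_encode (s, t)) = t"
  "row (row_end n) = row n" "col (row_end n) = 0" "row (col_end n) = 0" "col (col_end n) = col n"
  by (auto simp: row_def col_def row_end_def col_end_def)

lemma row_col_eqI: "row n = row m \<Longrightarrow> col n = col m \<Longrightarrow> n = m"
  unfolding row_def col_def by (metis prod_decode_eq prod_eqI)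

lemma row_col_0 [simp]: "row 0 = 0" "col 0 = 0"
proof -
  have "(0::nat) = prod_encode (0, 0)" by (simp add: prod_encode_def)
  then show "row 0 = 0" "col 0 = 0" by (metis row_col_simps(1), metis \<open>0 = prod_encode (0, 0)\<close> row_col_simps(2))
qed

lemma triangle_mono: "m \<le> n \<Longrightarrow> triangle m \<le> triangle n"
  by (induction rule: dec_induct) auto

lemma index_le: "row n \<le> n" "col n \<le> n" "row_end n \<le> n" "col_end n \<le> n"
proof -
  have n: "n = prod_encode (row n, col n)" by (rule row_col_eqI) simp_all
  show "row n \<le> n" "col n \<le> n"
    using le_prod_encode_1[of "row n" "col n"] le_prod_encode_2[of "col n" "row n"] n by simp_all
  have "prod_encode (row n, 0) \<le> prod_encode (row n, col n)"
    "prod_encode (0, col n) \<le> prod_encode (row n, col n)"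
    using triangle_mono[of "row n" "row n + col n"] triangle_mono[of "col n" "row n + col n"]
    by (auto simp: prod_encode_def)
  then show "row_end n \<le> n" "col_end n \<le> n" using n by (simp_all add: row_end_def col_end_def)
qed

definition pair_weight :: "(nat \<Rightarrow> real) \<Rightarrow> nat \<Rightarrow> real" where
  "pair_weight \<omega> n = ext_weight \<omega> (row n) * ext_weight \<omega> (col n)"

text \<open>The conditions \<open>col n \<noteq> 0\<close> and \<open>row n \<noteq> 0\<close> cut off the entry \<open>(\<infinity>,\<infinity>)\<close>, which belongs to \<open>1 \<otimes> 1\<close>: it
  neither acts on other entries nor is reached by the actions. With it, the derivation below would be inner.\<close>

abbreviation left_act :: "(nat \<Rightarrow> complex) \<Rightarrow> (nat \<Rightarrow> complex) \<Rightarrow> nat \<Rightarrow> complex" where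
  "left_act \<equiv> half_act row col_end (\<lambda>n. col n \<noteq> 0)"

abbreviation right_act :: "(nat \<Rightarrow> complex) \<Rightarrow> (nat \<Rightarrow> complex) \<Rightarrow> nat \<Rightarrow> complex" where
  "right_act \<equiv> half_act col row_end (\<lambda>n. row n \<noteq> 0)"

definition pair_bimodule :: "(nat \<Rightarrow> real) \<Rightarrow> (nat \<Rightarrow> complex, nat \<Rightarrow> complex) bimodule" where
  "pair_bimodule \<omega> = with_actions (ell1 (pair_weight \<omega>)) left_act (\<lambda>x a. right_act a x)"

text \<open>The derivation \<open>a \<mapsto> a \<otimes> 1 - 1 \<otimes> a\<close>.\<close>

definition pair_der :: "(nat \<Rightarrow> complex) \<Rightarrow> nat \<Rightarrow> complex" where
  "pair_der a n = (if col n = 0 then ext_seq a (row n) else 0) - (if row n = 0 then ext_seq a (col n) else 0)"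

lemma pair_bimodule_simps [simp]:
  "carrier (pair_bimodule \<omega>) = carrier (ell1 (pair_weight \<omega>))"
  "add (pair_bimodule \<omega>) = add (ell1 (pair_weight \<omega>))"
  "smult (pair_bimodule \<omega>) = smult (ell1 (pair_weight \<omega>))"
  "nrm (pair_bimodule \<omega>) = nrm (ell1 (pair_weight \<omega>))"
  "dual (pair_bimodule \<omega>) = dual (ell1 (pair_weight \<omega>))"
  "lact (pair_bimodule \<omega>) a x = left_act a x" "ract (pair_bimodule \<omega>) x a = right_act a x"
  by (simp_all add: pair_bimodule_def dual_with_actions)

context
  fixes \<omega> :: "nat \<Rightarrow> real"
  assumes w1: "\<And>n. 1 \<le> \<omega> n"
begin

lemma ext_weight_ge_1: "1 \<le> ext_weight \<omega> s"
  using w1 by (cases s) auto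

lemma pair_weight_ge_1: "1 \<le> pair_weight \<omega> n"
  using mult_mono[OF ext_weight_ge_1[of "row n"] ext_weight_ge_1[of "col n"]] ext_weight_ge_1[of "row n"]
  by (simp add: pair_weight_def)

lemma index_action_left: "index_action \<omega> (pair_weight \<omega>) row col_end"
proof
  show "n = m" if "row n = row m" "col_end n = col_end m" for n m
    using row_col_eqI[OF that(1)] arg_cong[OF that(2), of col] by simp
qed (auto simp: w1 pair_weight_ge_1 index_le, simp add: pair_weight_def)

lemma index_action_right: "index_action \<omega> (pair_weight \<omega>) col row_end"
proof
  show "n = m" if "col n = col m" "row_end n = row_end m" for n m
    using row_col_eqI[OF _ that(1)] arg_cong[OF that(2), of row] by simp
qed (auto simp: w1 pair_weight_ge_1 index_le, simp add: pair_weight_def)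

interpretation L: index_action \<omega> "pair_weight \<omega>" row col_end by (rule index_action_left)
interpretation R: index_action \<omega> "pair_weight \<omega>" col row_end by (rule index_action_right)

lemma banach_bimodule_pair: "banach_bimodule (ell1 \<omega>) (pair_bimodule \<omega>)"
proof (intro banach_bimodule.intro banach_bimodule_axioms.intro ell1_banach_algebra w1)
  show "banach_space (pair_bimodule \<omega>)"
    unfolding pair_bimodule_def
    by (intro banach_space_with_actions banach_algebra.axioms(1) ell1_banach_algebra pair_weight_ge_1)
  show "\<exists>C. \<forall>a\<in>carrier (ell1 \<omega>). \<forall>x\<in>carrier (pair_bimodule \<omega>).
    nrm (pair_bimodule \<omega>) (lact (pair_bimodule \<omega>) a x) \<le> C * nrm (ell1 \<omega>) a * nrm (pair_bimodule \<omega>) x \<and>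
    nrm (pair_bimodule \<omega>) (ract (pair_bimodule \<omega>) x a) \<le> C * nrm (ell1 \<omega>) a * nrm (pair_bimodule \<omega>) x"
    by (rule exI[of _ 2]) (simp add: L.half_act_bound R.half_act_bound)
qed (simp_all add: L.half_act_bound R.half_act_bound ell1_simps(2-5) half_act_linear,
    auto simp: half_act_def ext_seq_linear algebra_simps fun_eq_iff)

lemma normal_dual_bimodule_pair:
  "normal_dual_bimodule (ell1 \<omega>) (c0_predual \<omega>) (pair_bimodule \<omega>) (c0_predual (pair_weight \<omega>))"
proof -
  have pd: "predual_of (ell1 (pair_weight \<omega>)) (c0_predual (pair_weight \<omega>))"
    by (rule predual_ell1[OF pair_weight_ge_1])
  note ne = c0_predual_nonempty[OF w1] c0_predual_nonempty[OF pair_weight_ge_1]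
  have "dual_banach_bimodule (ell1 \<omega>) (pair_bimodule \<omega>) (c0_predual (pair_weight \<omega>))"
    unfolding dual_banach_bimodule_def
    using banach_bimodule_pair predual_of_with_actions[OF pd]
    by (simp add: L.half_act_predual_right R.half_act_predual_right flip: pair_bimodule_def)
      (simp add: pair_bimodule_def)
  moreover have "continuous_map (wstar_topology (ell1 \<omega>) (c0_predual \<omega>))
      (wstar_topology (pair_bimodule \<omega>) (c0_predual (pair_weight \<omega>))) (\<lambda>a. left_act a x)"
    "continuous_map (wstar_topology (ell1 \<omega>) (c0_predual \<omega>))
      (wstar_topology (pair_bimodule \<omega>) (c0_predual (pair_weight \<omega>))) (\<lambda>a. right_act a x)"
    if x: "x \<in> carrier (ell1 (pair_weight \<omega>))" for x
    by (intro continuous_map_wstar ne; use x in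
      \<open>simp add: L.half_act_bound R.half_act_bound L.half_act_predual_left R.half_act_predual_left\<close>)+
  ultimately show ?thesis by (simp add: normal_dual_bimodule_def)
qed

text \<open>In the full tensor square of the unitization, \<open>1 \<otimes> 1\<close> implements the derivation. This expresses the
  derivation by actions to which the earlier bounds apply.\<close>

lemma pair_der_half_acts:
  "pair_der a = (\<lambda>n. half_act row col_end (\<lambda>_. True) a (unit_seq 0) n +
     (-1) * half_act col row_end (\<lambda>_. True) a (unit_seq 0) n)"
proof
  fix n
  have "col_end n = 0 \<longleftrightarrow> col n = 0" "row_end n = 0 \<longleftrightarrow> row n = 0"
    by (metis row_col_0 row_col_eqI row_col_simps(5,6), metis row_col_0 row_col_eqI row_col_simps(3,4))
  then show "pair_der a n = half_act row col_end (\<lambda>_. True) a (unit_seq 0) n +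
     (-1) * half_act col row_end (\<lambda>_. True) a (unit_seq 0) n"
    by (cases "n = 0") (auto simp: pair_der_def half_act_def unit_seq_apply)
qed

lemma pair_der_closed:
  assumes a: "a \<in> carrier (ell1 \<omega>)"
  shows "pair_der a \<in> carrier (ell1 (pair_weight \<omega>))"
    "nrm (ell1 (pair_weight \<omega>)) (pair_der a) \<le> 4 * nrm (ell1 \<omega>) a"
    "f \<in> carrier (dual (ell1 (pair_weight \<omega>))) \<Longrightarrow>
      f (pair_der a) = f (half_act row col_end (\<lambda>_. True) a (unit_seq 0)) -
        f (half_act col row_end (\<lambda>_. True) a (unit_seq 0))"
proof -
  interpret V: normed_space "ell1 (pair_weight \<omega>)" by (rule ell1_normed[OF pair_weight_ge_1])
  note u = unit_seq[OF pair_weight_ge_1, where n = 0]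
  let ?l = "half_act row col_end (\<lambda>_. True) a (unit_seq 0)"
  let ?r = "half_act col row_end (\<lambda>_. True) a (unit_seq 0)"
  note l = L.half_act_bound[OF a u(1), of "\<lambda>_. True"]
  note r = R.half_act_bound[OF a u(1), of "\<lambda>_. True"]
  have eq: "pair_der a = ?l \<oplus>\<^bsub>ell1 (pair_weight \<omega>)\<^esub> ((-1) \<odot>\<^bsub>ell1 (pair_weight \<omega>)\<^esub> ?r)"
    unfolding pair_der_half_acts by (simp add: ell1_simps(3,5))
  note mr = V.smult_c[OF r(1), of "-1"]
  show "pair_der a \<in> carrier (ell1 (pair_weight \<omega>))" unfolding eq using l mr by simp
  have "nrm (ell1 (pair_weight \<omega>)) (pair_der a) \<le> nrm (ell1 (pair_weight \<omega>)) ?l + nrm (ell1 (pair_weight \<omega>)) ?r"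
    unfolding eq using V.nrm_triangle[OF l(1) mr] V.nrm_smult[OF r(1), of "-1"] by simp
  also have "\<dots> \<le> 4 * nrm (ell1 \<omega>) a" using l(2) r(2) u(2) by (simp add: pair_weight_def)
  finally show "nrm (ell1 (pair_weight \<omega>)) (pair_der a) \<le> 4 * nrm (ell1 \<omega>) a" .
  show "f (pair_der a) = f ?l - f ?r" if "f \<in> carrier (dual (ell1 (pair_weight \<omega>)))"
    unfolding eq using that l(1) r(1) mr by (simp add: mem_dual_iff)
qed

lemma wstar_derivation_pair:
  "wstar_derivation (ell1 \<omega>) (c0_predual \<omega>) (pair_bimodule \<omega>) (c0_predual (pair_weight \<omega>)) pair_der"
proof -
  note u = unit_seq(1)[OF pair_weight_ge_1, where n = 0]
  have "bounded_linear_on (ell1 \<omega>) (pair_bimodule \<omega>) pair_der"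
    unfolding bounded_linear_on_def
  proof (intro conjI)
    show "\<exists>C. \<forall>a\<in>carrier (ell1 \<omega>). nrm (pair_bimodule \<omega>) (pair_der a) \<le> C * nrm (ell1 \<omega>) a"
      using pair_der_closed(2) by auto
  qed (auto simp: pair_der_closed, auto simp: ell1_simps(3,5) pair_der_def ext_seq_linear fun_eq_iff algebra_simps)
  moreover have "pair_der (a \<otimes>\<^bsub>ell1 \<omega>\<^esub> b) = ract (pair_bimodule \<omega>) (pair_der a) b
      \<oplus>\<^bsub>pair_bimodule \<omega>\<^esub> lact (pair_bimodule \<omega>) a (pair_der b)" for a b
    by (auto simp: ell1_simps(3,4) pair_der_def half_act_def ext_seq_linear fun_eq_iff algebra_simps)
  moreover have "continuous_map (wstar_topology (ell1 \<omega>) (c0_predual \<omega>))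
      (wstar_topology (pair_bimodule \<omega>) (c0_predual (pair_weight \<omega>))) pair_der"
  proof (rule continuous_map_wstar[OF c0_predual_nonempty[OF w1] c0_predual_nonempty[OF pair_weight_ge_1]])
    show "pair_der \<in> carrier (ell1 \<omega>) \<rightarrow> carrier (pair_bimodule \<omega>)" by (simp add: pair_der_closed)
    fix f assume f: "f \<in> c0_predual (pair_weight \<omega>)"
    have "(\<lambda>a\<in>carrier (ell1 \<omega>). f (pair_der a)) =
      (\<lambda>a\<in>carrier (ell1 \<omega>). f (half_act row col_end (\<lambda>_. True) a (unit_seq 0))) \<oplus>\<^bsub>dual (ell1 \<omega>)\<^esub>
      ((-1) \<odot>\<^bsub>dual (ell1 \<omega>)\<^esub> (\<lambda>a\<in>carrier (ell1 \<omega>). f (half_act col row_end (\<lambda>_. True) a (unit_seq 0))))"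
      using pair_der_closed(3)[OF _ P_dual[OF pair_weight_ge_1 f]]
      by (simp add: dual_simps(3,4) restrict_def fun_eq_iff)
    then show "(\<lambda>a\<in>carrier (ell1 \<omega>). f (pair_der a)) \<in> c0_predual \<omega>"
      by (simp only: P_add[OF w1] P_smult[OF w1] L.half_act_predual_left[OF f u] R.half_act_predual_left[OF f u])
  qed
  ultimately show ?thesis by (simp add: wstar_derivation_def derivation_def)
qed

lemma inner_der_pair:
  assumes "a \<in> carrier (ell1 \<omega>)" "x \<in> carrier (ell1 (pair_weight \<omega>))"
  shows "inner_der (pair_bimodule \<omega>) x a = (\<lambda>n. left_act a x n - right_act a x n)"
proof -
  interpret banach_bimodule "ell1 \<omega>" "pair_bimodule \<omega>" by (rule banach_bimodule_pair)
  show ?thesis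
    using E.minus_eq_smult[of "left_act a x" "right_act a x"] assms
    by (simp add: L.half_act_bound R.half_act_bound ell1_simps(3,5))
qed

end

section \<open>A small matrix with prescribed row and column sums\<close>

definition ratio :: "nat \<Rightarrow> nat \<Rightarrow> real" where
  "ratio u v = real u / real (u + v)"

text \<open>The second mixed difference telescopes along rows and along columns, so its sums depend only on the
  boundary behaviour of \<open>u / (u + v)\<close>: the limits along a row and along a column are \<open>0\<close> and \<open>1\<close>, and
  the only irregularity is \<open>0/0 = 0\<close> at the origin, where a continuation of the first column would have \<open>1\<close>.\<close>

definition ratio_diff :: "nat \<Rightarrow> nat \<Rightarrow> real" where
  "ratio_diff u v = ratio (Suc u) (Suc v) - ratio (Suc u) v - ratio u (Suc v) + ratio u v"

lemma ratio_tendsto: "(\<lambda>v. ratio u v) \<longlonglongrightarrow> 0" "(\<lambda>u. ratio u v) \<longlonglongrightarrow> 1"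
proof -
  show "(\<lambda>v. ratio u v) \<longlonglongrightarrow> 0" unfolding ratio_def of_nat_add by real_asymp
  show "(\<lambda>u. ratio u v) \<longlonglongrightarrow> 1" unfolding ratio_def of_nat_add by real_asymp
qed

lemma ratio_diff_row: "(\<lambda>v. ratio_diff u v) sums (if u = 0 then - 1 else 0)"
proof -
  have "(\<lambda>v. ratio (Suc u) v - ratio u v) \<longlonglongrightarrow> 0 - 0" by (intro tendsto_intros ratio_tendsto)
  from telescope_sums[OF this] show ?thesis
    by (auto simp: ratio_diff_def ratio_def algebra_simps)
qed

lemma ratio_diff_col: "(\<lambda>u. ratio_diff u v) sums 0"
proof -
  have "(\<lambda>u. ratio u (Suc v) - ratio u v) \<longlonglongrightarrow> 1 - 1" by (intro tendsto_intros ratio_tendsto)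
  from telescope_sums[OF this] show ?thesis
    by (auto simp: ratio_diff_def ratio_def algebra_simps)
qed

text \<open>Away from the origin the mixed difference equals \<open>(u - v) / ((u + v) (u + v + 1) (u + v + 2))\<close>.\<close>

lemma ratio_diff_bound: "\<bar>ratio_diff u v\<bar> \<le> 1 / (real (u + v + 1))\<^sup>2"
proof (cases "u + v = 0")
  case False
  define U V where "U = real u" and "V = real v"
  have n: "1 \<le> U + V" "0 \<le> U" "0 \<le> V" using False by (auto simp: U_def V_def)
  have "ratio_diff u v = (U + 1) / (U + V + 2) - (U + 1) / (U + V + 1) - U / (U + V + 1) + U / (U + V)"
    by (simp add: ratio_diff_def ratio_def U_def V_def add_ac)
  also have "\<dots> = (U - V) / ((U + V) * (U + V + 1) * (U + V + 2))"
    using n by (simp add: divide_simps) (simp add: algebra_simps)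
  finally have "\<bar>ratio_diff u v\<bar> = \<bar>U - V\<bar> / ((U + V) * (U + V + 1) * (U + V + 2))"
    using n by (simp add: abs_mult)
  also have "\<dots> \<le> (U + V) / ((U + V) * (U + V + 1) * (U + V + 2))"
    using n by (intro divide_right_mono) auto
  also have "\<dots> = 1 / ((U + V + 1) * (U + V + 2))" using n by simp
  also have "\<dots> \<le> 1 / (U + V + 1)\<^sup>2"
    unfolding power2_eq_square using n by (intro divide_left_mono mult_left_mono) auto
  finally show ?thesis by (simp add: U_def V_def add_ac)
qed (simp add: ratio_diff_def ratio_def)

text \<open>The matrix of mixed differences, with its rows moved to the even and its columns to the odd numbers, so that
  sequences can be supported on row indices only or on column indices only.\<close>

definition chess :: "nat \<Rightarrow> nat \<Rightarrow> real" where
  "chess i j = (if even i \<and> odd j then ratio_diff (i div 2) (j div 2) else 0)"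

lemma chess_row: "(\<lambda>j. chess i j) sums (if i = 0 then - 1 else 0)"
proof (cases "even i")
  case True
  have "(\<lambda>v. chess i (2 * v + 1)) sums (if i = 0 then - 1 else 0)"
    using ratio_diff_row[of "i div 2"] True by (auto simp: chess_def elim!: evenE)
  moreover have "(\<lambda>v. chess i (2 * v + 1)) sums c \<longleftrightarrow> (\<lambda>j. chess i j) sums c" for c
    by (rule sums_mono_reindex) (auto simp: strict_mono_def chess_def elim!: oddE)
  ultimately show ?thesis by blast
next
  case False
  then have "i \<noteq> 0" "(\<lambda>j. chess i j) = (\<lambda>j. 0)" by (auto simp: chess_def intro!: Nat.gr0I)
  then show ?thesis by simp
qed

lemma chess_col: "(\<lambda>i. chess i j) sums 0"
proof (cases "odd j")
  case True
  have "(\<lambda>u. chess (2 * u) j) sums 0"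
    using ratio_diff_col[of "j div 2"] True by (simp add: chess_def)
  moreover have "(\<lambda>u. chess (2 * u) j) sums 0 \<longleftrightarrow> (\<lambda>i. chess i j) sums 0"
    by (rule sums_mono_reindex) (auto simp: strict_mono_def chess_def elim!: evenE)
  ultimately show ?thesis by blast
qed (simp add: chess_def)

lemma chess_bound: "\<bar>chess i j\<bar> \<le> 4 / (real (i + j + 1))\<^sup>2"
proof (cases "even i \<and> odd j")
  case True
  then obtain u v where uv: "i = 2 * u" "j = 2 * v + 1" by (auto elim!: evenE oddE)
  have "\<bar>chess i j\<bar> \<le> 1 / (real (u + v + 1))\<^sup>2" using ratio_diff_bound[of u v] by (simp add: chess_def uv)
  also have "\<dots> = 4 / (2 * real (u + v + 1))\<^sup>2" by (simp only: power_mult_distrib) simp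
  also have "2 * real (u + v + 1) = real (i + j + 1)" by (simp add: uv)
  finally show ?thesis .
qed (auto simp: chess_def)

text \<open>The exponent lies between \<open>1\<close>, which makes the sequence summable against \<open>\<omega>\<close>, and \<open>2\<close>, which makes
  the quotients of \<open>chess\<close> by it tend to zero.\<close>

definition decay :: "(nat \<Rightarrow> real) \<Rightarrow> nat \<Rightarrow> real" where
  "decay \<omega> i = 1 / (real (i + 1) powr (3/2) * \<omega> i)"

definition matrix_seq :: "(nat \<Rightarrow> nat \<Rightarrow> real) \<Rightarrow> nat \<Rightarrow> complex" where
  "matrix_seq h n = (case row n of 0 \<Rightarrow> 0 | Suc i \<Rightarrow> (case col n of 0 \<Rightarrow> 0 | Suc j \<Rightarrow> complex_of_real (h i j)))"

lemma matrix_seq_simps [simp]: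
  "row n = 0 \<Longrightarrow> matrix_seq h n = 0" "col n = 0 \<Longrightarrow> matrix_seq h n = 0"
  "row n = Suc i \<Longrightarrow> col n = Suc j \<Longrightarrow> matrix_seq h n = complex_of_real (h i j)"
  by (auto simp: matrix_seq_def split: nat.splits)

lemma row_col_at_top: "filterlim (\<lambda>n. row n + col n) at_top sequentially"
  unfolding filterlim_at_top
proof
  fix Z
  have "{n. \<not> Z \<le> row n + col n} \<subseteq> prod_encode ` ({..<Z} \<times> {..<Z})"
  proof
    fix n assume "n \<in> {n. \<not> Z \<le> row n + col n}"
    moreover have "n = prod_encode (row n, col n)" by (rule row_col_eqI) simp_all
    ultimately show "n \<in> prod_encode ` ({..<Z} \<times> {..<Z})" by (intro image_eqI[of _ _ "(row n, col n)"]) auto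
  qed
  then have "finite {n. \<not> Z \<le> row n + col n}" by (rule finite_subset) auto
  then show "\<forall>\<^sub>F n in sequentially. Z \<le> row n + col n"
    unfolding cofinite_eq_sequentially[symmetric] eventually_cofinite .
qed

context
  fixes \<omega> :: "nat \<Rightarrow> real"
  assumes w1: "\<And>n. 1 \<le> \<omega> n"
begin

interpretation L: index_action \<omega> "pair_weight \<omega>" row col_end by (rule index_action_left[OF w1])
interpretation R: index_action \<omega> "pair_weight \<omega>" col row_end by (rule index_action_right[OF w1])

lemma decay_pos: "0 < decay \<omega> i"
  using order_less_le_trans[OF zero_less_one w1[of i]] by (simp add: decay_def)

lemma decay_ell1:
  "(\<lambda>i. if Q i then complex_of_real (decay \<omega> i) else 0) \<in> carrier (ell1 \<omega>)"
proof -
  have w0: "0 < \<omega> i" for i using w1[of i] by linarith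
  have "summable (\<lambda>i. real (i + 1) powr (- (3/2)))"
    using summable_ignore_initial_segment[of "\<lambda>i. real i powr (- (3/2))" 1]
    by (simp add: summable_real_powr_iff)
  then have "summable (\<lambda>i. cmod (if Q i then complex_of_real (decay \<omega> i) else 0) * \<omega> i)"
  proof (rule summable_comparison_test'[where N = 0])
    show "norm (cmod (if Q i then complex_of_real (decay \<omega> i) else 0) * \<omega> i) \<le> real (i + 1) powr (- (3/2))" for i
    proof -
      have "decay \<omega> i * \<omega> i = real (i + 1) powr (- (3/2))"
        using w0[of i] by (simp add: decay_def powr_minus_divide)
      moreover have "cmod (complex_of_real (decay \<omega> i)) = decay \<omega> i"
        using decay_pos[of i] by (simp only: norm_of_real abs_of_pos)
      ultimately show ?thesis using w0[of i] decay_pos[of i] by simp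
    qed
  qed
  then show ?thesis by (simp add: ell1_simps)
qed

text \<open>The choice \<open>k i j = i\<close> yields the functional \<open>f\<close> and \<open>k i j = j\<close> the functional \<open>g\<close> of the
  obstruction.\<close>

lemma chess_functional:
  assumes k: "\<And>i j. k i j = i \<or> k i j = j"
  shows "c0_functional (pair_weight \<omega>) (matrix_seq (\<lambda>i j. chess i j / decay \<omega> (k i j))) \<in> c0_predual (pair_weight \<omega>)"
proof -
  let ?h = "\<lambda>i j. chess i j / decay \<omega> (k i j)"
  have W1: "1 \<le> pair_weight \<omega> n" for n by (rule pair_weight_ge_1[OF w1])
  have w0: "0 < \<omega> i" for i using w1[of i] by linarith
  have h: "\<bar>?h i j\<bar> \<le> 4 / sqrt (real (i + j + 1)) * (\<omega> i * \<omega> j)" for i j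
  proof -
    define s where "s = real (i + j + 1)"
    have s: "1 \<le> s" by (simp add: s_def)
    have "real (k i j + 1) \<le> s" using k[of i j] by (auto simp: s_def)
    then have p: "real (k i j + 1) powr (3/2) \<le> s powr (3/2)" by (intro powr_mono2) auto
    have "\<omega> (k i j) \<le> \<omega> i * \<omega> j"
      using k[of i j] w0[of i] w0[of j] mult_left_mono[OF w1[of j], of "\<omega> i"] mult_right_mono[OF w1[of i], of "\<omega> j"]
      by (elim disjE) simp_all
    then have m: "real (k i j + 1) powr (3/2) * \<omega> (k i j) \<le> s powr (3/2) * (\<omega> i * \<omega> j)"
      by (intro mult_mono p) (use w0[of "k i j"] in auto)
    have "\<bar>?h i j\<bar> = \<bar>chess i j\<bar> * (real (k i j + 1) powr (3/2) * \<omega> (k i j))"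
      using w0[of "k i j"] by (simp add: decay_def abs_mult)
    also have "\<dots> \<le> 4 / s\<^sup>2 * (s powr (3/2) * (\<omega> i * \<omega> j))"
      by (rule mult_mono[OF _ m]) (use chess_bound[of i j] w0[of "k i j"] in \<open>auto simp: s_def\<close>)
    also have "s powr (3/2) = s\<^sup>2 / sqrt s"
    proof -
      have "s powr (3/2) = s powr (2 - 1/2)" by simp
      also have "\<dots> = s\<^sup>2 / sqrt s"
        using s by (simp only: powr_diff powr_half_sqrt) (simp add: powr_numeral)
      finally show ?thesis .
    qed
    also have "4 / s\<^sup>2 * (s\<^sup>2 / sqrt s * (\<omega> i * \<omega> j)) = 4 / sqrt s * (\<omega> i * \<omega> j)" using s by simp
    finally show ?thesis by (simp only: s_def)
  qed
  have "(\<lambda>n. matrix_seq ?h n / complex_of_real (pair_weight \<omega> n)) \<longlonglongrightarrow> 0"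
  proof (rule Lim_null_comparison)
    show "\<forall>\<^sub>F n in sequentially. cmod (matrix_seq ?h n / complex_of_real (pair_weight \<omega> n)) \<le>
        4 / sqrt (real (row n + col n) - 1)"
    proof (rule eventually_mono[OF eventually_gt_at_top[of 0]])
      fix n :: nat assume n: "0 < n"
      have "0 < pair_weight \<omega> n" using W1[of n] by linarith
      show "cmod (matrix_seq ?h n / complex_of_real (pair_weight \<omega> n)) \<le> 4 / sqrt (real (row n + col n) - 1)"
      proof (cases "row n = 0 \<or> col n = 0")
        case False
        then obtain i j where ij: "row n = Suc i" "col n = Suc j" by (auto simp: gr0_conv_Suc)
        have "0 < \<omega> i * \<omega> j" using w0 by simp
        then have "\<bar>?h i j\<bar> / (\<omega> i * \<omega> j) \<le> 4 / sqrt (real (i + j + 1))"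
          using h[of i j] by (simp only: pos_divide_le_eq)
        then show ?thesis using w0[of i] w0[of j]
          by (simp add: ij norm_divide norm_mult pair_weight_def abs_mult)
      next
        case True
        have "row n + col n \<noteq> 0" using n row_col_eqI[of n 0] by auto
        then show ?thesis using True by (auto simp: Suc_le_eq)
      qed
    qed
    have "((\<lambda>d. 4 / sqrt (real d - 1)) \<longlongrightarrow> 0) sequentially" by real_asymp
    then show "(\<lambda>n. 4 / sqrt (real (row n + col n) - 1)) \<longlonglongrightarrow> 0"
      by (rule filterlim_compose[OF _ row_col_at_top])
  qed
  then have "matrix_seq ?h \<in> c0_inv (pair_weight \<omega>)" by (simp add: c0_inv_def)
  then show ?thesis unfolding c0_predual_def c0_functional_def[OF W1] by blast
qed

context
  fixes h :: "nat \<Rightarrow> nat \<Rightarrow> real" and f :: "(nat \<Rightarrow> complex) \<Rightarrow> complex"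
  assumes f_def: "f = c0_functional (pair_weight \<omega>) (matrix_seq h)"
    and fP: "f \<in> c0_predual (pair_weight \<omega>)"
begin

lemma matrix_functional_unit: "f (unit_seq n) = matrix_seq h n"
  unfolding f_def by (rule c0_functional_unit_seq[OF pair_weight_ge_1[OF w1]])

lemma matrix_functional_dual: "f \<in> carrier (dual (ell1 (pair_weight \<omega>)))"
  by (rule P_dual[OF pair_weight_ge_1[OF w1] fP])

lemma matrix_functional_scaled_unit: "f (\<lambda>n. c * unit_seq m n) = c * matrix_seq h m"
  using L.functional_linear(2)[OF matrix_functional_dual unit_seq(1)[OF pair_weight_ge_1[OF w1]]] by (simp add: matrix_functional_unit)

text \<open>On a proper row a unit matrix is only rescaled, whereas the boundary unit matrix \<open>(\<infinity>,j)\<close> is spread out over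
  the whole column \<open>j\<close>.\<close>

lemma matrix_functional_left_act:
  assumes a: "a \<in> carrier (ell1 \<omega>)"
  shows "row m \<noteq> 0 \<Longrightarrow> f (left_act a (unit_seq m)) = ext_seq a (row m) * matrix_seq h m"
    "row m = 0 \<Longrightarrow> col m = Suc j \<Longrightarrow> (\<lambda>k. a k * h k j) sums f (left_act a (unit_seq m))"
proof -
  show "f (left_act a (unit_seq m)) = ext_seq a (row m) * matrix_seq h m" if m: "row m \<noteq> 0"
  proof -
    have "col_end n \<noteq> m" for n using m by (metis row_col_simps(5))
    then have "left_act a (unit_seq m) = (\<lambda>n. ext_seq a (row m) * unit_seq m n)"
      by (auto simp: half_act_def unit_seq_apply fun_eq_iff)
    then show ?thesis by (simp add: matrix_functional_scaled_unit)
  qed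
  assume m: "row m = 0" "col m = Suc j"
  have u: "left_act (unit_seq k) (unit_seq m) = unit_seq (prod_encode (Suc k, Suc j))" for k
  proof
    fix n
    have 1: "col_end n = m \<longleftrightarrow> col n = Suc j"
      using m row_col_eqI[of "col_end n" m] by (metis row_col_simps(5,6))
    have 2: "n = prod_encode (Suc k, Suc j) \<longleftrightarrow> row n = Suc k \<and> col n = Suc j"
      by (metis row_col_eqI row_col_simps(1,2))
    show "left_act (unit_seq k) (unit_seq m) n = unit_seq (prod_encode (Suc k, Suc j)) n"
      using m by (cases "row n") (auto simp: half_act_def unit_seq_apply 1 2)
  qed
  note D = L.half_act_dual_left[OF matrix_functional_dual unit_seq(1)[OF pair_weight_ge_1[OF w1]], of "\<lambda>n. col n \<noteq> 0" m]
  show "(\<lambda>k. a k * h k j) sums f (left_act a (unit_seq m))"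
    using dual_eval[OF w1 D a] a unit_seq(1)[OF w1] by (simp add: u matrix_functional_unit del: neq0_conv)
qed

lemma matrix_functional_right_act:
  assumes a: "a \<in> carrier (ell1 \<omega>)"
  shows "col m \<noteq> 0 \<Longrightarrow> f (right_act a (unit_seq m)) = ext_seq a (col m) * matrix_seq h m"
    "col m = 0 \<Longrightarrow> row m = Suc i \<Longrightarrow> (\<lambda>k. a k * h i k) sums f (right_act a (unit_seq m))"
proof -
  show "f (right_act a (unit_seq m)) = ext_seq a (col m) * matrix_seq h m" if m: "col m \<noteq> 0"
  proof -
    have "row_end n \<noteq> m" for n using m by (metis row_col_simps(4))
    then have "right_act a (unit_seq m) = (\<lambda>n. ext_seq a (col m) * unit_seq m n)"
      by (auto simp: half_act_def unit_seq_apply fun_eq_iff)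
    then show ?thesis by (simp add: matrix_functional_scaled_unit)
  qed
  assume m: "col m = 0" "row m = Suc i"
  have u: "right_act (unit_seq k) (unit_seq m) = unit_seq (prod_encode (Suc i, Suc k))" for k
  proof
    fix n
    have 1: "row_end n = m \<longleftrightarrow> row n = Suc i"
      using m row_col_eqI[of "row_end n" m] by (metis row_col_simps(3,4))
    have 2: "n = prod_encode (Suc i, Suc k) \<longleftrightarrow> row n = Suc i \<and> col n = Suc k"
      by (metis row_col_eqI row_col_simps(1,2))
    show "right_act (unit_seq k) (unit_seq m) n = unit_seq (prod_encode (Suc i, Suc k)) n"
      using m by (cases "col n") (auto simp: half_act_def unit_seq_apply 1 2)
  qed
  note D = R.half_act_dual_left[OF matrix_functional_dual unit_seq(1)[OF pair_weight_ge_1[OF w1]], of "\<lambda>n. row n \<noteq> 0" m]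
  show "(\<lambda>k. a k * h i k) sums f (right_act a (unit_seq m))"
    using dual_eval[OF w1 D a] a unit_seq(1)[OF w1] by (simp add: u matrix_functional_unit del: neq0_conv)
qed

end

end

section \<open>Non-inner derivations into the tensor square\<close>

lemma coordinate_functional:
  assumes "\<And>n. 1 \<le> \<omega> n"
  shows "c0_functional \<omega> (unit_seq m) \<in> c0_predual \<omega>"
    "x \<in> carrier (ell1 \<omega>) \<Longrightarrow> c0_functional \<omega> (unit_seq m) x = x m"
proof -
  show "c0_functional \<omega> (unit_seq m) \<in> c0_predual \<omega>" by (rule c0_functional_unit_seq_P[OF assms])
  have "(\<lambda>k. if k = m then x k else 0) sums x m" by (rule sums_single)
  then show "c0_functional \<omega> (unit_seq m) x = x m" if "x \<in> carrier (ell1 \<omega>)"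
    using that by (simp add: c0_functional_def[OF assms] unit_seq_apply sums_iff if_distrib cong: if_cong)
qed

text \<open>A constant net.\<close>

lemma Connes_amenable_imp_wstar_approx:
  fixes A :: "'a nspace"
  assumes C: "Connes_amenable TYPE('e) A PA"
  shows "wstar_approx_Connes_amenable TYPE('e) A PA"
  unfolding wstar_approx_Connes_amenable_def
proof (intro allI impI)
  fix E :: "('a, 'e) bimodule" and P D
  assume N: "normal_dual_bimodule A PA E P \<and> wstar_derivation A PA E P D"
  then obtain x where x: "x \<in> carrier E" "\<And>a. a \<in> carrier A \<Longrightarrow> D a = inner_der E x a"
    using C unfolding Connes_amenable_def by blast
  have "submodule P complex_field (dual E)" "normed_space E"
    using N by (auto simp: normal_dual_bimodule_def dual_banach_bimodule_def predual_of_def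
      banach_bimodule_def banach_space_def)
  then have "P \<noteq> {}" using normed_space.submodule_dualD(2) by blast
  moreover have "D a \<in> carrier E" if "a \<in> carrier A" for a
    using N that by (auto simp: wstar_derivation_def derivation_def bounded_linear_on_def)
  ultimately have "limitin (wstar_topology E P) (\<lambda>y. inner_der E y a) (D a) (principal {x})" if "a \<in> carrier A" for a
    using x(2)[OF that, symmetric] that unfolding limitin_def by (simp add: topspace_wstar eventually_principal)
  then show "\<exists>F. F \<noteq> bot \<and> (\<forall>\<^sub>F x in F. x \<in> carrier E) \<and>
      (\<forall>a\<in>carrier A. limitin (wstar_topology E P) (\<lambda>x. inner_der E x a) (D a) F)"
    using x(1) by (intro exI[of _ "principal {x}"]) (auto simp: eventually_principal principal_eq_bot_iff)
qed

context
  fixes \<omega> :: "nat \<Rightarrow> real"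
  assumes w1: "\<And>n. 1 \<le> \<omega> n"
begin

lemma row_end_coordinate:
  assumes a: "a \<in> carrier (ell1 \<omega>)" and x: "x \<in> carrier (ell1 (pair_weight \<omega>))"
  shows "inner_der (pair_bimodule \<omega>) x a (prod_encode (Suc i, 0)) = a i * x (prod_encode (Suc i, 0))"
    "pair_der a (prod_encode (Suc i, 0)) = a i"
  by (simp only: inner_der_pair[OF w1 a x], simp add: half_act_def) (simp add: pair_der_def)

text \<open>For \<open>a\<close> without zeros an implementing \<open>x\<close> would have the constant value \<open>1\<close> on the boundary entries \<open>(s,\<infinity>)\<close>.\<close>

lemma not_pointwise_Connes_amenable:
  "\<not> pointwise_Connes_amenable TYPE(nat \<Rightarrow> complex) (ell1 \<omega>) (c0_predual \<omega>)"
proof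
  assume "pointwise_Connes_amenable TYPE(nat \<Rightarrow> complex) (ell1 \<omega>) (c0_predual \<omega>)"
  moreover define a where "a i = complex_of_real (decay \<omega> i)" for i
  have a: "a \<in> carrier (ell1 \<omega>)" using decay_ell1[of \<omega>, OF w1, of "\<lambda>_. True"] by (simp add: a_def[abs_def])
  have nz: "a i \<noteq> 0" for i using decay_pos[of \<omega>, OF w1, of i] by (simp add: a_def)
  ultimately obtain x where x: "x \<in> carrier (ell1 (pair_weight \<omega>))"
    and eq: "pair_der a = inner_der (pair_bimodule \<omega>) x a"
    using normal_dual_bimodule_pair[of \<omega>, OF w1] wstar_derivation_pair[of \<omega>, OF w1] a
    unfolding pointwise_Connes_amenable_def pair_bimodule_simps(1)[symmetric] by blast
  have "x (prod_encode (Suc i, 0)) = 1" for i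
    using fun_cong[OF eq, of "prod_encode (Suc i, 0)"] row_end_coordinate[OF a x, of i] nz[of i] by simp
  then have "range (\<lambda>i. prod_encode (Suc i, 0)) \<subseteq> {n. 1 \<le> cmod (x n)}" by auto
  moreover have "finite {n. 1 \<le> cmod (x n)}"
    by (rule ell1_finite_level[OF pair_weight_ge_1[of \<omega>, OF w1] x]) simp
  ultimately have "finite (range (\<lambda>i. prod_encode (Suc i, 0)))" by (rule finite_subset)
  then show False by (auto dest!: finite_imageD simp: inj_def)
qed

text \<open>Both sides of the identity are functionals of the predual, so it is enough to compare them on unit
  matrices: proper pairs cancel by the choice of the quotients, and the boundary ones give the row and column sums
  of \<open>chess\<close>.\<close>

lemma obstruction:
  obtains a b f g where "a \<in> carrier (ell1 \<omega>)" "b \<in> carrier (ell1 \<omega>)" "a 0 \<noteq> 0"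
    "f \<in> c0_predual (pair_weight \<omega>)" "g \<in> c0_predual (pair_weight \<omega>)"
    "f (pair_der a) = 0" "g (pair_der b) = 0"
    "\<And>x. x \<in> carrier (ell1 (pair_weight \<omega>)) \<Longrightarrow>
       f (inner_der (pair_bimodule \<omega>) x a) + g (inner_der (pair_bimodule \<omega>) x b) = x (prod_encode (Suc 0, 0))"
proof -
  let ?W = "pair_weight \<omega>"
  have W1: "1 \<le> ?W n" for n by (rule pair_weight_ge_1[of \<omega>, OF w1])
  interpret L: index_action \<omega> ?W row col_end by (rule index_action_left[OF w1])
  interpret R: index_action \<omega> ?W col row_end by (rule index_action_right[OF w1])
  interpret B: banach_bimodule "ell1 \<omega>" "pair_bimodule \<omega>" by (rule banach_bimodule_pair[OF w1])
  define a where "a i = (if even i then complex_of_real (decay \<omega> i) else 0)" for i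
  define b where "b i = (if odd i then complex_of_real (decay \<omega> i) else 0)" for i
  define hf where "hf i j = chess i j / decay \<omega> i" for i j
  define hg where "hg i j = chess i j / decay \<omega> j" for i j
  define f where "f = c0_functional ?W (matrix_seq hf)"
  define g where "g = c0_functional ?W (matrix_seq hg)"
  have a: "a \<in> carrier (ell1 \<omega>)" and b: "b \<in> carrier (ell1 \<omega>)"
    unfolding a_def[abs_def] b_def[abs_def] by (rule decay_ell1[of \<omega>, OF w1])+
  have fP: "f \<in> c0_predual ?W" and gP: "g \<in> c0_predual ?W"
    unfolding f_def g_def hf_def[abs_def] hg_def[abs_def] by (rule chess_functional[OF w1]; simp)+
  note fd = P_dual[OF W1 fP] and gd = P_dual[OF W1 gP]
  have nz: "complex_of_real (decay \<omega> i) \<noteq> 0" for i using decay_pos[of \<omega>, OF w1, of i] by simp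
  have "c0_functional ?W (matrix_seq h) (pair_der c) = 0" if "c \<in> carrier (ell1 \<omega>)" for h c
  proof -
    have "(\<lambda>n. pair_der c n * matrix_seq h n) = (\<lambda>n. 0)"
    proof
      show "pair_der c n * matrix_seq h n = 0" for n
        by (cases "row n = 0 \<or> col n = 0") (auto simp: pair_der_def)
    qed
    then show ?thesis using pair_der_closed(1)[of \<omega>, OF w1 that] by (simp add: c0_functional_def[OF W1])
  qed
  then have van: "f (pair_der a) = 0" "g (pair_der b) = 0" using a b by (simp_all add: f_def g_def)
  \<comment> \<open>the left hand side of the identity, assembled inside the predual\<close>
  let ?D = "dual (ell1 ?W)"
  let ?l = "\<lambda>f a. \<lambda>x\<in>carrier (ell1 ?W). f (left_act a x)"
  let ?r = "\<lambda>f a. \<lambda>x\<in>carrier (ell1 ?W). f (right_act a x)"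
  define \<Lambda> where "\<Lambda> = (?l f a \<oplus>\<^bsub>?D\<^esub> ((-1) \<odot>\<^bsub>?D\<^esub> ?r f a)) \<oplus>\<^bsub>?D\<^esub> (?l g b \<oplus>\<^bsub>?D\<^esub> ((-1) \<odot>\<^bsub>?D\<^esub> ?r g b))"
  have \<Lambda>P: "\<Lambda> \<in> c0_predual ?W"
    unfolding \<Lambda>_def using fP gP a b
    by (intro P_add[OF W1] P_smult[OF W1] L.half_act_predual_right R.half_act_predual_right)
  have \<Lambda>: "\<Lambda> x = (f (left_act a x) - f (right_act a x)) + (g (left_act b x) - g (right_act b x))"
    if "x \<in> carrier (ell1 ?W)" for x
    using that by (simp add: \<Lambda>_def dual_simps(3,4))
  have ch: "chess i j = 0" if "odd i \<or> even j" for i j using that by (auto simp: chess_def)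
  have "\<Lambda> (unit_seq m) = c0_functional ?W (unit_seq (prod_encode (Suc 0, 0))) (unit_seq m)" for m
  proof -
    note u = unit_seq(1)[OF W1, where n = m]
    have m: "m = prod_encode (Suc 0, 0) \<longleftrightarrow> row m = Suc 0 \<and> col m = 0"
      by (metis row_col_eqI row_col_simps(1,2))
    have rhs: "c0_functional ?W (unit_seq (prod_encode (Suc 0, 0))) (unit_seq m) =
        (if row m = Suc 0 \<and> col m = 0 then 1 else 0)"
      using coordinate_functional(2)[OF W1 u] m by (auto simp: unit_seq_apply)
    note lf = matrix_functional_left_act[OF w1 f_def fP a, of m] and lg = matrix_functional_left_act[OF w1 g_def gP b, of m]
    note rf = matrix_functional_right_act[OF w1 f_def fP a, of m] and rg = matrix_functional_right_act[OF w1 g_def gP b, of m]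
    consider i j where "row m = Suc i" "col m = Suc j" | j where "row m = 0" "col m = Suc j"
      | i where "row m = Suc i" "col m = 0" | "row m = 0" "col m = 0"
      by (metis not0_implies_Suc)
    then show ?thesis
    proof cases
      case (1 i j)
      then show ?thesis
        using lf(1) lg(1) rf(1) rg(1) nz[of i] nz[of j] ch[of i j] u
        by (simp add: \<Lambda> rhs a_def b_def hf_def hg_def)
    next
      case (2 j)
      have "(\<lambda>k. a k * hf k j) = (\<lambda>k. complex_of_real (chess k j))" "(\<lambda>k. b k * hg k j) = (\<lambda>k. 0)"
        using nz ch by (auto simp: a_def b_def hf_def hg_def fun_eq_iff)
      then have "f (left_act a (unit_seq m)) = 0" "g (left_act b (unit_seq m)) = 0"
        using lf(2)[OF 2] lg(2)[OF 2] chess_col[of j] sums_of_real[OF chess_col[of j], where ?'a = complex]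
        by (auto dest: sums_unique2)
      then show ?thesis using rf(1) rg(1) 2 u by (simp add: \<Lambda> rhs)
    next
      case (3 i)
      have "(\<lambda>k. a k * hf i k) = (\<lambda>k. 0)" "(\<lambda>k. b k * hg i k) = (\<lambda>k. complex_of_real (chess i k))"
        using nz ch by (auto simp: a_def b_def hf_def hg_def fun_eq_iff)
      then have "f (right_act a (unit_seq m)) = 0" "g (right_act b (unit_seq m)) = (if i = 0 then - 1 else 0)"
        using rf(2)[OF 3(2,1)] rg(2)[OF 3(2,1)] sums_of_real[OF chess_row[of i], where ?'a = complex]
        by (auto dest: sums_unique2 split: if_splits)
      then show ?thesis using lf(1) lg(1) 3 u by (simp add: \<Lambda> rhs)
    next
      case 4
      then have "m = 0" using row_col_eqI[of m 0] by simp
      moreover have "col_end n = 0 \<longleftrightarrow> col n = 0" "row_end n = 0 \<longleftrightarrow> row n = 0" for n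
        by (metis row_col_0 row_col_eqI row_col_simps(5,6), metis row_col_0 row_col_eqI row_col_simps(3,4))
      ultimately have "left_act c (unit_seq m) = (\<lambda>n. 0 * unit_seq m n)"
        "right_act c (unit_seq m) = (\<lambda>n. 0 * unit_seq m n)" for c
        by (auto simp: half_act_def unit_seq_apply fun_eq_iff)
      then show ?thesis using 4 u L.functional_linear(2)[OF fd u] L.functional_linear(2)[OF gd u]
        by (simp only: \<Lambda> rhs) simp
    qed
  qed
  then have eq: "\<Lambda> = c0_functional ?W (unit_seq (prod_encode (Suc 0, 0)))"
    by (intro dual_ext[of ?W] W1 P_dual[of ?W, OF W1] \<Lambda>P coordinate_functional(1)[of ?W, OF W1]) simp
  have "f (inner_der (pair_bimodule \<omega>) x a) + g (inner_der (pair_bimodule \<omega>) x b) = x (prod_encode (Suc 0, 0))"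
    if x: "x \<in> carrier (ell1 ?W)" for x
    using B.functional_inner_der[of f a x] B.functional_inner_der[of g b x] fd gd a b x \<Lambda>[OF x]
      coordinate_functional(2)[OF W1 x] by (simp add: eq)
  moreover have "a 0 \<noteq> 0" using nz[of 0] by (simp add: a_def)
  ultimately show ?thesis using a b fP gP van by (intro that)
qed

lemma not_wstar_approx_Connes_amenable:
  "\<not> wstar_approx_Connes_amenable TYPE(nat \<Rightarrow> complex) (ell1 \<omega>) (c0_predual \<omega>)"
proof
  let ?W = "pair_weight \<omega>" and ?E = "pair_bimodule \<omega>" and ?n = "prod_encode (Suc 0, 0)"
  have W1: "1 \<le> ?W n" for n by (rule pair_weight_ge_1[of \<omega>, OF w1])
  interpret B: banach_bimodule "ell1 \<omega>" ?E by (rule banach_bimodule_pair[OF w1])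
  assume "wstar_approx_Connes_amenable TYPE(nat \<Rightarrow> complex) (ell1 \<omega>) (c0_predual \<omega>)"
  then obtain F where F: "F \<noteq> bot" "\<forall>\<^sub>F x in F. x \<in> carrier ?E"
    and lim: "\<And>a. a \<in> carrier (ell1 \<omega>) \<Longrightarrow>
      limitin (wstar_topology ?E (c0_predual ?W)) (\<lambda>x. inner_der ?E x a) (pair_der a) F"
    using normal_dual_bimodule_pair[of \<omega>, OF w1] wstar_derivation_pair[of \<omega>, OF w1]
    unfolding wstar_approx_Connes_amenable_def by blast
  have tends: "((\<lambda>x. f (inner_der ?E x a)) \<longlongrightarrow> f (pair_der a)) F"
    if "a \<in> carrier (ell1 \<omega>)" "f \<in> c0_predual ?W" for a f
    by (rule limitin_wstarD[OF lim[OF that(1)] that(2)]) (use pair_der_closed(1)[of \<omega>, OF w1 that(1)] in simp)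
  obtain a b f g where a: "a \<in> carrier (ell1 \<omega>)" "a 0 \<noteq> 0" and b: "b \<in> carrier (ell1 \<omega>)"
    and fg: "f \<in> c0_predual ?W" "g \<in> c0_predual ?W" "f (pair_der a) = 0" "g (pair_der b) = 0"
    and obs: "\<And>x. x \<in> carrier (ell1 ?W) \<Longrightarrow> f (inner_der ?E x a) + g (inner_der ?E x b) = x ?n"
    using obstruction by metis
  have "((\<lambda>x. f (inner_der ?E x a) + g (inner_der ?E x b)) \<longlongrightarrow> 0 + 0) F"
    using tends[OF a(1) fg(1)] tends[OF b fg(2)] fg(3,4) by (intro tendsto_add) simp_all
  moreover have "\<forall>\<^sub>F x in F. f (inner_der ?E x a) + g (inner_der ?E x b) = x ?n"
    using F(2) by (rule eventually_mono) (simp only: obs pair_bimodule_simps(1))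
  ultimately have zero: "((\<lambda>x. x ?n) \<longlongrightarrow> 0) F" by (simp add: tendsto_cong)
  let ?e = "c0_functional ?W (unit_seq ?n)"
  have "((\<lambda>x. ?e (inner_der ?E x a)) \<longlongrightarrow> ?e (pair_der a)) F"
    by (rule tends[OF a(1) coordinate_functional(1)[OF W1]])
  moreover have "?e (pair_der a) = a 0"
    using coordinate_functional(2)[of ?W, OF W1 pair_der_closed(1)[of \<omega>, OF w1 a(1)], of ?n] by (simp add: pair_der_def)
  moreover have "\<forall>\<^sub>F x in F. ?e (inner_der ?E x a) = a 0 * x ?n"
    using F(2)
  proof (rule eventually_mono)
    fix x assume x: "x \<in> carrier ?E"
    have "inner_der ?E x a \<in> carrier ?E" using B.inner_der_linear(1)[OF a(1)] x by auto
    then show "?e (inner_der ?E x a) = a 0 * x ?n"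
      using coordinate_functional(2)[of ?W, OF W1, of "inner_der ?E x a" ?n] row_end_coordinate(1)[OF a(1), of x 0] x by simp
  qed
  ultimately have "((\<lambda>x. a 0 * x ?n) \<longlongrightarrow> a 0) F" by (simp add: tendsto_cong)
  moreover have "((\<lambda>x. a 0 * x ?n) \<longlongrightarrow> a 0 * 0) F" by (intro tendsto_mult tendsto_const zero)
  ultimately show False using tendsto_unique[OF F(1)] a(2) by fastforce
qed

end

theorem theorem3p1:
  fixes \<omega> :: "nat \<Rightarrow> real"
  assumes "weight \<omega>"
  shows "\<not> Connes_amenable TYPE(nat \<Rightarrow> complex) (ell1 \<omega>) (c0_predual \<omega>) \<and>
    \<not> pointwise_Connes_amenable TYPE(nat \<Rightarrow> complex) (ell1 \<omega>) (c0_predual \<omega>) \<and>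
    \<not> wstar_approx_Connes_amenable TYPE(nat \<Rightarrow> complex) (ell1 \<omega>) (c0_predual \<omega>) \<and>
    pointwise_wstar_approx_Connes_amenable TYPE('e) (ell1 \<omega>) (c0_predual \<omega>)"
proof -
  have w1: "1 \<le> \<omega> n" for n using assms by (simp add: weight_def)
  show ?thesis
    using not_pointwise_Connes_amenable[of \<omega>, OF w1] not_wstar_approx_Connes_amenable[of \<omega>, OF w1]
      ell1_pointwise_wstar_approx_Connes_amenable[of \<omega>, OF w1] Connes_amenable_imp_wstar_approx by blast
qed

end
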